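(* Let $X$ be a diffeological space. Then there is an isomorphism $$QX\cong N[QX_1\rightrightarrows QX_0]$$ where $QX$ is regarded as a simplicial diffeological space (or as a simplicial presheaf on $\mathsf{Cart}$) and $N[QX_1\rightrightarrows QX_0]$ is the nerve of the diffeological category (respectively presheaf of categories) $[QX_1\rightrightarrows QX_0]$.
   Context: Diffeology. A cartesian space is a smooth manifold diffeomorphic to $\mathbb{R}^n$ for some $n\ge 0$; $\mathsf{Cart}$ is the category of cartesian spaces and smooth maps, regarded as small. A good open cover of a manifold is an open cover $\{U_i\}$ by cartesian spaces all of whose finite non-empty intersections are cartesian spaces. A diffeological space is a set $X$ with a collection of functions $p:U\to X$, $U\in\mathsf{Cart}$, called plots, such that (1) every map $\mathbb{R}^0\to X$ is a plot; (2) if $p:U\to X$ is a plot and $f:V\to U$ is smooth, then $pf$ is a plot; (3) if $p:U\to X$ is a function and $p|_{U_i}$ is a plot for every member of some good open cover $\{U_i\subseteq U\}$, then $p$ is a plot. A function $f:X\to Y$ is smooth if $fp$ is a plot of $Y$ for every plot $p$ of $X$. Limits and colimits are formed on underlying sets: a function into a limit is a plot iff all its components are; a function $U\to\mathrm{colim}\,F$ is a plot iff on the members of some good open cover of $U$ it lifts to plots of the terms of the diagram. Maps of plots $f_0:U_{p_1}\to U_{p_0}$ of $X$ are smooth maps with $p_0f_0=p_1$, where $p_i:U_{p_i}\to X$ are plots. The resolution $QX$. $QX_k=\coprod_{U_{p_k}\xrightarrow{f_{k-1}}\cdots\xrightarrow{f_0}U_{p_0}}U_{p_k}$, the coproduct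 over all chains of $k$ composable maps of plots of $X$, with elements $(x_{p_k},f_{k-1},\dots,f_0)$, $x_{p_k}\in U_{p_k}$. Faces: $d_0(x_{p_k},f_{k-1},\dots,f_0)=(f_{k-1}(x_{p_k}),f_{k-2},\dots,f_0)$; for $0<i<k$, $d_i$ replaces $f_{k-i},f_{k-i-1}$ by the composite $f_{k-i-1}f_{k-i}$; $d_k$ drops $f_0$. Degeneracies insert identities. As a simplicial presheaf, $U_{p_k}$ is replaced by the representable presheaf $yU_{p_k}$ and the coproduct is taken in presheaves. The diffeological category (category internal to diffeological spaces) $[QX_1\rightrightarrows QX_0]$ has source $s(x_{p_1},f_0)=x_{p_1}$, target $t(x_{p_1},f_0)=f_0(x_{p_1})$, unit $u(x_p)=(x_p,1_{U_p})$, and composition sending $(x_{p_2},f_1),(x_{p_1},f_0)$ with $f_1(x_{p_2})=x_{p_1}$ to $(x_{p_2},f_0f_1)$. The nerve of a diffeological category $C$ is the simplicial diffeological space with $NC_k=C_1\times_{t,C_0,s}C_1\times_{t,C_0,s}\dots\times_{t,C_0,s}C_1$ ($k$ factors; $NC_0=C_0$), with the usual faces and degeneracies ($d_0$ drops the first arrow, $d_k$ the last, inner faces compose). *)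

theory Defs
  imports "HOL-Analysis.Analysis"
begin

section \<open>Smooth maps between open subsets of Euclidean spaces\<close>

text \<open>
  Points of \<open>\<real>\<^sup>n\<close> are sequences vanishing from index \<open>n\<close> on, as in the library topology
  \<^const>\<open>Euclidean_space\<close>. Everywhere below, a set-theoretic function on a set \<open>A\<close> is represented
  by a function that is extensional on \<open>A\<close>, so that equality of such functions is equality in HOL.
\<close>

type_synonym rvec = "nat \<Rightarrow> real"

text \<open>\<open>Ck n k S f\<close>: on the open set \<open>S\<close> of \<open>\<real>\<^sup>n\<close>, all iterated partial derivatives of \<open>f\<close> of
  order at most \<open>k\<close> exist and are continuous.\<close>

primrec Ck :: "nat \<Rightarrow> nat \<Rightarrow> rvec set \<Rightarrow> (rvec \<Rightarrow> real) \<Rightarrow> bool" where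
  "Ck n 0 S f \<longleftrightarrow> continuous_map (subtopology (Euclidean_space n) S) euclideanreal f"
| "Ck n (Suc k) S f \<longleftrightarrow> continuous_map (subtopology (Euclidean_space n) S) euclideanreal f \<and>
     (\<forall>i<n. \<exists>g. (\<forall>x\<in>S. ((\<lambda>t. f (x(i := t))) has_real_derivative g x) (at (x i))) \<and> Ck n k S g)"

definition euclid_smooth :: "nat \<Rightarrow> nat \<Rightarrow> rvec set \<Rightarrow> (rvec \<Rightarrow> rvec) \<Rightarrow> bool" where
  "euclid_smooth m n S f \<longleftrightarrow>
     f \<in> S \<rightarrow> topspace (Euclidean_space n) \<and> (\<forall>j<n. \<forall>k. Ck m k S (\<lambda>x. f x j))"

section \<open>Smooth manifolds and cartesian spaces\<close>

text \<open>
  To have a small category of cartesian spaces, the underlying sets of manifolds are taken to be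
  subsets of the fixed type \<^typ>\<open>rvec\<close>, with an arbitrary smooth structure (a maximal atlas, which
  need not be related to the topology of \<^typ>\<open>rvec\<close>). Up to diffeomorphism this is no
  restriction, as a manifold has at most continuum many points.
\<close>

record mfd =
  mcarrier :: "rvec set"
  mdim :: nat
  matlas :: "(rvec set \<times> (rvec \<Rightarrow> rvec)) set"

definition chart_on :: "rvec set \<Rightarrow> nat \<Rightarrow> rvec set \<times> (rvec \<Rightarrow> rvec) \<Rightarrow> bool" where
  "chart_on M n = (\<lambda>(D, \<phi>). D \<subseteq> M \<and> inj_on \<phi> D \<and> openin (Euclidean_space n) (\<phi> ` D))"

definition smooth_transition ::
    "nat \<Rightarrow> rvec set \<times> (rvec \<Rightarrow> rvec) \<Rightarrow> rvec set \<times> (rvec \<Rightarrow> rvec) \<Rightarrow> bool" where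
  "smooth_transition n = (\<lambda>(D, \<phi>) (E, \<psi>). openin (Euclidean_space n) (\<phi> ` (D \<inter> E)) \<and>
     euclid_smooth n n (\<phi> ` (D \<inter> E)) (\<psi> \<circ> inv_into D \<phi>))"

definition compatible_charts ::
    "nat \<Rightarrow> rvec set \<times> (rvec \<Rightarrow> rvec) \<Rightarrow> rvec set \<times> (rvec \<Rightarrow> rvec) \<Rightarrow> bool" where
  "compatible_charts n c c' \<longleftrightarrow> smooth_transition n c c' \<and> smooth_transition n c' c"

text \<open>In a maximal atlas the chart domains form a base of the manifold topology.\<close>

definition mfd_topology :: "mfd \<Rightarrow> rvec topology" where
  "mfd_topology M = topology_generated_by (fst ` matlas M)"

definition smooth_manifold :: "mfd \<Rightarrow> bool" where
  "smooth_manifold M \<longleftrightarrow>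
     (\<forall>c\<in>matlas M. chart_on (mcarrier M) (mdim M) c) \<and>
     \<Union> (fst ` matlas M) = mcarrier M \<and>
     (\<forall>c\<in>matlas M. \<forall>c'\<in>matlas M. compatible_charts (mdim M) c c') \<and>
     (\<forall>c. chart_on (mcarrier M) (mdim M) c \<and> (\<forall>c'\<in>matlas M. compatible_charts (mdim M) c c')
        \<longrightarrow> c \<in> matlas M) \<and>
     Hausdorff_space (mfd_topology M) \<and> second_countable (mfd_topology M)"

definition mfd_smooth :: "mfd \<Rightarrow> mfd \<Rightarrow> (rvec \<Rightarrow> rvec) \<Rightarrow> bool" where
  "mfd_smooth M N f \<longleftrightarrow> f \<in> mcarrier M \<rightarrow> mcarrier N \<and>
     (\<forall>x\<in>mcarrier M. \<exists>(D, \<phi>)\<in>matlas M. \<exists>(E, \<psi>)\<in>matlas N. x \<in> D \<and> f ` D \<subseteq> E \<and>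
        euclid_smooth (mdim M) (mdim N) (\<phi> ` D) (\<psi> \<circ> f \<circ> inv_into D \<phi>))"

definition mfd_diffeomorphism :: "mfd \<Rightarrow> mfd \<Rightarrow> (rvec \<Rightarrow> rvec) \<Rightarrow> bool" where
  "mfd_diffeomorphism M N f \<longleftrightarrow> bij_betw f (mcarrier M) (mcarrier N) \<and>
     mfd_smooth M N f \<and> mfd_smooth N M (inv_into (mcarrier M) f)"

definition euclidean_mfd :: "nat \<Rightarrow> mfd" where
  "euclidean_mfd n =
     \<lparr>mcarrier = topspace (Euclidean_space n), mdim = n,
      matlas = {c. chart_on (topspace (Euclidean_space n)) n c \<and>
                   compatible_charts n c (topspace (Euclidean_space n), \<lambda>x. x)}\<rparr>"

definition open_submfd :: "mfd \<Rightarrow> rvec set \<Rightarrow> mfd" where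
  "open_submfd M W =
     \<lparr>mcarrier = W, mdim = mdim M, matlas = {(D, \<phi>) \<in> matlas M. D \<subseteq> W}\<rparr>"

definition cartesian_space :: "mfd \<Rightarrow> bool" where
  "cartesian_space U \<longleftrightarrow> smooth_manifold U \<and> (\<exists>n f. mfd_diffeomorphism U (euclidean_mfd n) f)"

definition cart_hom :: "mfd \<Rightarrow> mfd \<Rightarrow> (rvec \<Rightarrow> rvec) set" where
  "cart_hom U V = {f \<in> mcarrier U \<rightarrow>\<^sub>E mcarrier V. mfd_smooth U V f}"

definition good_open_cover :: "mfd \<Rightarrow> rvec set set \<Rightarrow> bool" where
  "good_open_cover U \<W> \<longleftrightarrow>
     (\<forall>W\<in>\<W>. openin (mfd_topology U) W \<and> cartesian_space (open_submfd U W)) \<and>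
     \<Union> \<W> = mcarrier U \<and>
     (\<forall>\<F>. finite \<F> \<and> \<F> \<noteq> {} \<and> \<F> \<subseteq> \<W> \<and> \<Inter> \<F> \<noteq> {} \<longrightarrow> cartesian_space (open_submfd U (\<Inter> \<F>)))"

section \<open>Diffeological spaces\<close>

record 'x diffsp =
  points :: "'x set"
  plots :: "(mfd \<times> (rvec \<Rightarrow> 'x)) set"

definition diffeological_space :: "'x diffsp \<Rightarrow> bool" where
  "diffeological_space X \<longleftrightarrow>
     (\<forall>(U, p)\<in>plots X. cartesian_space U \<and> p \<in> mcarrier U \<rightarrow>\<^sub>E points X) \<and>
     (\<forall>p \<in> mcarrier (euclidean_mfd 0) \<rightarrow>\<^sub>E points X. (euclidean_mfd 0, p) \<in> plots X) \<and>
     (\<forall>U p V f. (U, p) \<in> plots X \<and> cartesian_space V \<and> f \<in> cart_hom V U \<longrightarrow>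
        (V, compose (mcarrier V) p f) \<in> plots X) \<and>
     (\<forall>U p \<W>. cartesian_space U \<and> p \<in> mcarrier U \<rightarrow>\<^sub>E points X \<and> good_open_cover U \<W> \<and>
        (\<forall>W\<in>\<W>. (open_submfd U W, restrict p W) \<in> plots X) \<longrightarrow> (U, p) \<in> plots X)"

definition dsmooth :: "'x diffsp \<Rightarrow> 'y diffsp \<Rightarrow> ('x \<Rightarrow> 'y) \<Rightarrow> bool" where
  "dsmooth X Y f \<longleftrightarrow> f \<in> points X \<rightarrow> points Y \<and>
     (\<forall>(U, p)\<in>plots X. (U, compose (mcarrier U) f p) \<in> plots Y)"

definition ddiffeomorphism :: "'x diffsp \<Rightarrow> 'y diffsp \<Rightarrow> ('x \<Rightarrow> 'y) \<Rightarrow> bool" where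
  "ddiffeomorphism X Y f \<longleftrightarrow> bij_betw f (points X) (points Y) \<and>
     dsmooth X Y f \<and> dsmooth Y X (inv_into (points X) f)"

definition cart_diffsp :: "mfd \<Rightarrow> rvec diffsp" where
  "cart_diffsp U =
     \<lparr>points = mcarrier U, plots = {(V, f). cartesian_space V \<and> f \<in> cart_hom V U}\<rparr>"

definition dcoproduct :: "'i set \<Rightarrow> ('i \<Rightarrow> 'x diffsp) \<Rightarrow> ('x \<times> 'i) diffsp" where
  "dcoproduct I F =
     (let P = {(x, i). i \<in> I \<and> x \<in> points (F i)} in
      \<lparr>points = P,
       plots = {(U, p). cartesian_space U \<and> p \<in> mcarrier U \<rightarrow>\<^sub>E P \<and>
         (\<exists>\<W>. good_open_cover U \<W> \<and>
           (\<forall>W\<in>\<W>. \<exists>i\<in>I. \<exists>q. (open_submfd U W, q) \<in> plots (F i) \<and> (\<forall>x\<in>W. p x = (q x, i))))}\<rparr>)"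

definition dpullback ::
    "'x diffsp \<Rightarrow> 'y diffsp \<Rightarrow> ('x \<Rightarrow> 'z) \<Rightarrow> ('y \<Rightarrow> 'z) \<Rightarrow> ('x \<times> 'y) diffsp" where
  "dpullback X Y f g =
     (let P = {(x, y). x \<in> points X \<and> y \<in> points Y \<and> f x = g y} in
      \<lparr>points = P,
       plots = {(U, p). cartesian_space U \<and> p \<in> mcarrier U \<rightarrow>\<^sub>E P \<and>
         (U, compose (mcarrier U) fst p) \<in> plots X \<and> (U, compose (mcarrier U) snd p) \<in> plots Y}\<rparr>)"

section \<open>Simplicial sets, categories and nerves on bare sets\<close>

text \<open>The face \<open>d k i\<close> goes from level \<open>k\<close> to level \<open>k - 1\<close> (used for \<open>k \<ge> 1\<close>), and the
  degeneracy \<open>s k i\<close> from level \<open>k\<close> to level \<open>k + 1\<close>.\<close>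

definition simplicial_set ::
    "(nat \<Rightarrow> 'e set) \<Rightarrow> (nat \<Rightarrow> nat \<Rightarrow> 'e \<Rightarrow> 'e) \<Rightarrow> (nat \<Rightarrow> nat \<Rightarrow> 'e \<Rightarrow> 'e) \<Rightarrow> bool" where
  "simplicial_set S d s \<longleftrightarrow>
     (\<forall>k. \<forall>i\<le>Suc k. d (Suc k) i \<in> S (Suc k) \<rightarrow> S k) \<and>
     (\<forall>k. \<forall>i\<le>k. s k i \<in> S k \<rightarrow> S (Suc k)) \<and>
     (\<forall>k i j. \<forall>x\<in>S (k + 2). i < j \<and> j \<le> k + 2 \<longrightarrow>
        d (k + 1) i (d (k + 2) j x) = d (k + 1) (j - 1) (d (k + 2) i x)) \<and>
     (\<forall>k i j. \<forall>x\<in>S k. i \<le> j \<and> j \<le> k \<longrightarrow>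
        s (k + 1) i (s k j x) = s (k + 1) (j + 1) (s k i x)) \<and>
     (\<forall>k i j. \<forall>x\<in>S k. i < j \<and> j \<le> k \<longrightarrow>
        d (k + 1) i (s k j x) = s (k - 1) (j - 1) (d k i x)) \<and>
     (\<forall>k j. \<forall>x\<in>S k. j \<le> k \<longrightarrow> d (k + 1) j (s k j x) = x \<and> d (k + 1) (j + 1) (s k j x) = x) \<and>
     (\<forall>k i j. \<forall>x\<in>S k. j + 1 < i \<and> i \<le> k + 1 \<longrightarrow>
        d (k + 1) i (s k j x) = s (k - 1) j (d k (i - 1) x))"

text \<open>Composition is written in diagrammatic order: \<open>cmp a b\<close> is first \<open>a\<close>, then \<open>b\<close>.\<close>

definition small_category ::
    "'o set \<Rightarrow> 'a set \<Rightarrow> ('a \<Rightarrow> 'o) \<Rightarrow> ('a \<Rightarrow> 'o) \<Rightarrow> ('o \<Rightarrow> 'a) \<Rightarrow> ('a \<Rightarrow> 'a \<Rightarrow> 'a) \<Rightarrow> bool" where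
  "small_category Ob Ar src tgt unit cmp \<longleftrightarrow>
     src \<in> Ar \<rightarrow> Ob \<and> tgt \<in> Ar \<rightarrow> Ob \<and> unit \<in> Ob \<rightarrow> Ar \<and>
     (\<forall>a\<in>Ar. \<forall>b\<in>Ar. tgt a = src b \<longrightarrow>
        cmp a b \<in> Ar \<and> src (cmp a b) = src a \<and> tgt (cmp a b) = tgt b) \<and>
     (\<forall>x\<in>Ob. src (unit x) = x \<and> tgt (unit x) = x) \<and>
     (\<forall>a\<in>Ar. cmp (unit (src a)) a = a \<and> cmp a (unit (tgt a)) = a) \<and>
     (\<forall>a\<in>Ar. \<forall>b\<in>Ar. \<forall>c\<in>Ar. tgt a = src b \<and> tgt b = src c \<longrightarrow>
        cmp (cmp a b) c = cmp a (cmp b c))"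

text \<open>A \<open>0\<close>-simplex of a nerve is an object, a \<open>k\<close>-simplex with \<open>k \<ge> 1\<close> is a list of \<open>k\<close>
  composable arrows.\<close>

datatype ('o, 'a) nsimplex = Vertex (the_vertex: 'o) | Path (the_path: "'a list")

definition nerve_set ::
    "'o set \<Rightarrow> 'a set \<Rightarrow> ('a \<Rightarrow> 'o) \<Rightarrow> ('a \<Rightarrow> 'o) \<Rightarrow> nat \<Rightarrow> ('o, 'a) nsimplex set" where
  "nerve_set Ob Ar src tgt k =
     (if k = 0 then Vertex ` Ob
      else Path ` {as. length as = k \<and> set as \<subseteq> Ar \<and>
                       (\<forall>j. Suc j < k \<longrightarrow> tgt (as ! j) = src (as ! Suc j))})"

definition nerve_face ::
    "('a \<Rightarrow> 'o) \<Rightarrow> ('a \<Rightarrow> 'o) \<Rightarrow> ('a \<Rightarrow> 'a \<Rightarrow> 'a) \<Rightarrow>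
     nat \<Rightarrow> nat \<Rightarrow> ('o, 'a) nsimplex \<Rightarrow> ('o, 'a) nsimplex" where
  "nerve_face src tgt cmp k i z =
     (let as = the_path z in
      if k = 1 then Vertex (if i = 0 then tgt (as ! 0) else src (as ! 0))
      else if i = 0 then Path (tl as)
      else if i = k then Path (butlast as)
      else Path (take (i - 1) as @ [cmp (as ! (i - 1)) (as ! i)] @ drop (i + 1) as))"

definition nerve_degen ::
    "('a \<Rightarrow> 'o) \<Rightarrow> ('a \<Rightarrow> 'o) \<Rightarrow> ('o \<Rightarrow> 'a) \<Rightarrow>
     nat \<Rightarrow> nat \<Rightarrow> ('o, 'a) nsimplex \<Rightarrow> ('o, 'a) nsimplex" where
  "nerve_degen src tgt unit k i z =
     (if k = 0 then Path [unit (the_vertex z)]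
      else let as = the_path z;
               v = (if i < k then src (as ! i) else tgt (last as))
           in Path (take i as @ [unit v] @ drop i as))"

section \<open>Simplicial diffeological spaces and diffeological categories\<close>

record 'e sdiffsp =
  sd_level :: "nat \<Rightarrow> 'e diffsp"
  sd_face :: "nat \<Rightarrow> nat \<Rightarrow> 'e \<Rightarrow> 'e"
  sd_degen :: "nat \<Rightarrow> nat \<Rightarrow> 'e \<Rightarrow> 'e"

definition simplicial_diffsp :: "'e sdiffsp \<Rightarrow> bool" where
  "simplicial_diffsp A \<longleftrightarrow>
     (\<forall>k. diffeological_space (sd_level A k)) \<and>
     simplicial_set (\<lambda>k. points (sd_level A k)) (sd_face A) (sd_degen A) \<and>
     (\<forall>k. \<forall>i\<le>Suc k. dsmooth (sd_level A (Suc k)) (sd_level A k) (sd_face A (Suc k) i)) \<and>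
     (\<forall>k. \<forall>i\<le>k. dsmooth (sd_level A k) (sd_level A (Suc k)) (sd_degen A k i))"

definition sdiffsp_isomorphic :: "'e sdiffsp \<Rightarrow> 'f sdiffsp \<Rightarrow> bool" where
  "sdiffsp_isomorphic A B \<longleftrightarrow> simplicial_diffsp A \<and> simplicial_diffsp B \<and>
     (\<exists>\<Phi>. (\<forall>k. ddiffeomorphism (sd_level A k) (sd_level B k) (\<Phi> k)) \<and>
        (\<forall>k. \<forall>i\<le>Suc k. \<forall>x\<in>points (sd_level A (Suc k)).
           \<Phi> k (sd_face A (Suc k) i x) = sd_face B (Suc k) i (\<Phi> (Suc k) x)) \<and>
        (\<forall>k. \<forall>i\<le>k. \<forall>x\<in>points (sd_level A k).
           \<Phi> (Suc k) (sd_degen A k i x) = sd_degen B k i (\<Phi> k x)))"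

record ('o, 'a) diffcat =
  dc_Ob :: "'o diffsp"
  dc_Ar :: "'a diffsp"
  dc_src :: "'a \<Rightarrow> 'o"
  dc_tgt :: "'a \<Rightarrow> 'o"
  dc_unit :: "'o \<Rightarrow> 'a"
  dc_comp :: "'a \<Rightarrow> 'a \<Rightarrow> 'a"

definition diffeological_category :: "('o, 'a) diffcat \<Rightarrow> bool" where
  "diffeological_category C \<longleftrightarrow>
     diffeological_space (dc_Ob C) \<and> diffeological_space (dc_Ar C) \<and>
     small_category (points (dc_Ob C)) (points (dc_Ar C))
       (dc_src C) (dc_tgt C) (dc_unit C) (dc_comp C) \<and>
     dsmooth (dc_Ar C) (dc_Ob C) (dc_src C) \<and> dsmooth (dc_Ar C) (dc_Ob C) (dc_tgt C) \<and>
     dsmooth (dc_Ob C) (dc_Ar C) (dc_unit C) \<and>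
     dsmooth (dpullback (dc_Ar C) (dc_Ar C) (dc_tgt C) (dc_src C)) (dc_Ar C)
       (\<lambda>(a, b). dc_comp C a b)"

text \<open>The diffeology on the nerve is that of the iterated fibre product: plots are the functions
  all of whose components are plots.\<close>

definition dnerve :: "('o, 'a) diffcat \<Rightarrow> ('o, 'a) nsimplex sdiffsp" where
  "dnerve C =
     (let N = nerve_set (points (dc_Ob C)) (points (dc_Ar C)) (dc_src C) (dc_tgt C) in
      \<lparr>sd_level = (\<lambda>k.
         \<lparr>points = N k,
          plots = {(U, p). cartesian_space U \<and> p \<in> mcarrier U \<rightarrow>\<^sub>E N k \<and>
            (if k = 0 then (U, \<lambda>x\<in>mcarrier U. the_vertex (p x)) \<in> plots (dc_Ob C)
             else \<forall>j<k. (U, \<lambda>x\<in>mcarrier U. the_path (p x) ! j) \<in> plots (dc_Ar C))}\<rparr>),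
       sd_face = nerve_face (dc_src C) (dc_tgt C) (dc_comp C),
       sd_degen = nerve_degen (dc_src C) (dc_tgt C) (dc_unit C)\<rparr>)"

section \<open>Simplicial presheaves and presheaves of categories on cartesian spaces\<close>

text \<open>\<open>ps_res P W V f\<close> is the restriction \<open>P(V) \<rightarrow> P(W)\<close> along \<open>f : W \<rightarrow> V\<close>.\<close>

record 'e psh =
  ps_set :: "mfd \<Rightarrow> 'e set"
  ps_res :: "mfd \<Rightarrow> mfd \<Rightarrow> (rvec \<Rightarrow> rvec) \<Rightarrow> 'e \<Rightarrow> 'e"

definition presheaf :: "'e psh \<Rightarrow> bool" where
  "presheaf P \<longleftrightarrow>
     (\<forall>V W f. cartesian_space V \<and> cartesian_space W \<and> f \<in> cart_hom W V \<longrightarrow>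
        ps_res P W V f \<in> ps_set P V \<rightarrow> ps_set P W) \<and>
     (\<forall>V. cartesian_space V \<longrightarrow> (\<forall>x\<in>ps_set P V. ps_res P V V (\<lambda>y\<in>mcarrier V. y) x = x)) \<and>
     (\<forall>V W Z f g. cartesian_space V \<and> cartesian_space W \<and> cartesian_space Z \<and>
        f \<in> cart_hom W V \<and> g \<in> cart_hom Z W \<longrightarrow>
        (\<forall>x\<in>ps_set P V. ps_res P Z V (compose (mcarrier Z) f g) x =
           ps_res P Z W g (ps_res P W V f x)))"

definition psh_map :: "'e psh \<Rightarrow> 'f psh \<Rightarrow> (mfd \<Rightarrow> 'e \<Rightarrow> 'f) \<Rightarrow> bool" where
  "psh_map P R \<eta> \<longleftrightarrow>
     (\<forall>V. cartesian_space V \<longrightarrow> \<eta> V \<in> ps_set P V \<rightarrow> ps_set R V) \<and>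
     (\<forall>V W f. cartesian_space V \<and> cartesian_space W \<and> f \<in> cart_hom W V \<longrightarrow>
        (\<forall>x\<in>ps_set P V. \<eta> W (ps_res P W V f x) = ps_res R W V f (\<eta> V x)))"

definition yoneda :: "mfd \<Rightarrow> (rvec \<Rightarrow> rvec) psh" where
  "yoneda U = \<lparr>ps_set = (\<lambda>V. cart_hom V U), ps_res = (\<lambda>W V f g. compose (mcarrier W) g f)\<rparr>"

definition psh_coproduct :: "'i set \<Rightarrow> ('i \<Rightarrow> 'e psh) \<Rightarrow> ('e \<times> 'i) psh" where
  "psh_coproduct I F =
     \<lparr>ps_set = (\<lambda>V. {(x, i). i \<in> I \<and> x \<in> ps_set (F i) V}),
      ps_res = (\<lambda>W V f (x, i). (ps_res (F i) W V f x, i))\<rparr>"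

record 'e spsh =
  sp_level :: "nat \<Rightarrow> 'e psh"
  sp_face :: "nat \<Rightarrow> nat \<Rightarrow> mfd \<Rightarrow> 'e \<Rightarrow> 'e"
  sp_degen :: "nat \<Rightarrow> nat \<Rightarrow> mfd \<Rightarrow> 'e \<Rightarrow> 'e"

definition simplicial_presheaf :: "'e spsh \<Rightarrow> bool" where
  "simplicial_presheaf A \<longleftrightarrow>
     (\<forall>k. presheaf (sp_level A k)) \<and>
     (\<forall>V. cartesian_space V \<longrightarrow>
        simplicial_set (\<lambda>k. ps_set (sp_level A k) V)
          (\<lambda>k i. sp_face A k i V) (\<lambda>k i. sp_degen A k i V)) \<and>
     (\<forall>k. \<forall>i\<le>Suc k. psh_map (sp_level A (Suc k)) (sp_level A k) (sp_face A (Suc k) i)) \<and>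
     (\<forall>k. \<forall>i\<le>k. psh_map (sp_level A k) (sp_level A (Suc k)) (sp_degen A k i))"

definition spsh_isomorphic :: "'e spsh \<Rightarrow> 'f spsh \<Rightarrow> bool" where
  "spsh_isomorphic A B \<longleftrightarrow> simplicial_presheaf A \<and> simplicial_presheaf B \<and>
     (\<exists>\<Phi>. (\<forall>k. psh_map (sp_level A k) (sp_level B k) (\<Phi> k)) \<and>
        (\<forall>k V. cartesian_space V \<longrightarrow>
           bij_betw (\<Phi> k V) (ps_set (sp_level A k) V) (ps_set (sp_level B k) V)) \<and>
        (\<forall>k V. \<forall>i\<le>Suc k. cartesian_space V \<longrightarrow> (\<forall>x\<in>ps_set (sp_level A (Suc k)) V.
           \<Phi> k V (sp_face A (Suc k) i V x) = sp_face B (Suc k) i V (\<Phi> (Suc k) V x))) \<and>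
        (\<forall>k V. \<forall>i\<le>k. cartesian_space V \<longrightarrow> (\<forall>x\<in>ps_set (sp_level A k) V.
           \<Phi> (Suc k) V (sp_degen A k i V x) = sp_degen B k i V (\<Phi> k V x))))"

record ('o, 'a) pshcat =
  pc_Ob :: "'o psh"
  pc_Ar :: "'a psh"
  pc_src :: "mfd \<Rightarrow> 'a \<Rightarrow> 'o"
  pc_tgt :: "mfd \<Rightarrow> 'a \<Rightarrow> 'o"
  pc_unit :: "mfd \<Rightarrow> 'o \<Rightarrow> 'a"
  pc_comp :: "mfd \<Rightarrow> 'a \<Rightarrow> 'a \<Rightarrow> 'a"

definition presheaf_of_categories :: "('o, 'a) pshcat \<Rightarrow> bool" where
  "presheaf_of_categories C \<longleftrightarrow>
     presheaf (pc_Ob C) \<and> presheaf (pc_Ar C) \<and>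
     (\<forall>V. cartesian_space V \<longrightarrow> small_category (ps_set (pc_Ob C) V) (ps_set (pc_Ar C) V)
        (pc_src C V) (pc_tgt C V) (pc_unit C V) (pc_comp C V)) \<and>
     psh_map (pc_Ar C) (pc_Ob C) (pc_src C) \<and> psh_map (pc_Ar C) (pc_Ob C) (pc_tgt C) \<and>
     psh_map (pc_Ob C) (pc_Ar C) (pc_unit C) \<and>
     (\<forall>V W f. cartesian_space V \<and> cartesian_space W \<and> f \<in> cart_hom W V \<longrightarrow>
        (\<forall>a\<in>ps_set (pc_Ar C) V. \<forall>b\<in>ps_set (pc_Ar C) V. pc_tgt C V a = pc_src C V b \<longrightarrow>
           ps_res (pc_Ar C) W V f (pc_comp C V a b) =
           pc_comp C W (ps_res (pc_Ar C) W V f a) (ps_res (pc_Ar C) W V f b)))"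

definition psh_nerve :: "('o, 'a) pshcat \<Rightarrow> ('o, 'a) nsimplex spsh" where
  "psh_nerve C =
     \<lparr>sp_level = (\<lambda>k.
        \<lparr>ps_set = (\<lambda>V. nerve_set (ps_set (pc_Ob C) V) (ps_set (pc_Ar C) V)
                         (pc_src C V) (pc_tgt C V) k),
         ps_res = (\<lambda>W V f. map_nsimplex (ps_res (pc_Ob C) W V f) (ps_res (pc_Ar C) W V f))\<rparr>),
      sp_face = (\<lambda>k i V. nerve_face (pc_src C V) (pc_tgt C V) (pc_comp C V) k i),
      sp_degen = (\<lambda>k i V. nerve_degen (pc_src C V) (pc_tgt C V) (pc_unit C V) k i)\<rparr>"

section \<open>Chains of maps of plots\<close>

type_synonym 'x plot = "mfd \<times> (rvec \<Rightarrow> 'x)"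

text \<open>
  The chain of \<open>k\<close> maps \<open>U\<^bsub>p\<^sub>k\<^esub> \<rightarrow> \<dots> \<rightarrow> U\<^bsub>p\<^sub>0\<^esub>\<close> is the pair of lists
  \<open>([p\<^sub>k, \<dots>, p\<^sub>0], [f\<^bsub>k-1\<^esub>, \<dots>, f\<^sub>0])\<close>. So list position \<open>j\<close> holds \<open>p\<^bsub>k-j\<^esub>\<close>,
  resp. \<open>f\<^bsub>k-1-j\<^esub>\<close>.
\<close>

type_synonym 'x plot_chain = "'x plot list \<times> (rvec \<Rightarrow> rvec) list"

definition plot_map :: "'x plot \<Rightarrow> 'x plot \<Rightarrow> (rvec \<Rightarrow> rvec) \<Rightarrow> bool" where
  "plot_map p1 p0 f \<longleftrightarrow>
     f \<in> cart_hom (fst p1) (fst p0) \<and> compose (mcarrier (fst p1)) (snd p0) f = snd p1"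

definition plot_chains :: "'x diffsp \<Rightarrow> nat \<Rightarrow> 'x plot_chain set" where
  "plot_chains X k = {(ps, fs). length ps = Suc k \<and> length fs = k \<and> set ps \<subseteq> plots X \<and>
     (\<forall>j<k. plot_map (ps ! j) (ps ! Suc j) (fs ! j))}"

definition chain_dom :: "'x plot_chain \<Rightarrow> mfd" where
  "chain_dom c = fst (hd (fst c))"

definition chain_face :: "nat \<Rightarrow> nat \<Rightarrow> 'x plot_chain \<Rightarrow> 'x plot_chain" where
  "chain_face k i = (\<lambda>(ps, fs).
     if i = 0 then (tl ps, tl fs)
     else if i = k then (butlast ps, butlast fs)
     else (take i ps @ drop (i + 1) ps,
           take (i - 1) fs @ [compose (mcarrier (fst (ps ! (i - 1)))) (fs ! i) (fs ! (i - 1))]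
             @ drop (i + 1) fs))"

definition chain_degen :: "nat \<Rightarrow> 'x plot_chain \<Rightarrow> 'x plot_chain" where
  "chain_degen i = (\<lambda>(ps, fs).
     (take (i + 1) ps @ drop i ps,
      take i fs @ [\<lambda>x\<in>mcarrier (fst (ps ! i)). x] @ drop i fs))"

section \<open>The resolution and its category of one-simplices\<close>

text \<open>
  An element of \<open>QX\<^sub>k\<close> is a pair \<open>(y, c)\<close> of a chain \<open>c\<close> and \<open>y\<close>, which is a point of the domain
  of \<open>c\<close> in the diffeological case, and a smooth map from \<open>V\<close> to it in the presheaf case (at the
  cartesian space \<open>V\<close>). The structure maps of both versions are given by the same formulas, once
  the way \<open>act f y\<close> in which a smooth map \<open>f\<close> acts on such a \<open>y\<close> is abstracted: it is \<open>f y\<close> for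
  points and the composite of \<open>f\<close> and \<open>y\<close> for smooth maps.
\<close>

definition Q_face :: "((rvec \<Rightarrow> rvec) \<Rightarrow> 'y \<Rightarrow> 'y) \<Rightarrow>
    nat \<Rightarrow> nat \<Rightarrow> 'y \<times> 'x plot_chain \<Rightarrow> 'y \<times> 'x plot_chain" where
  "Q_face act k i = (\<lambda>(y, c). (if i = 0 then act (hd (snd c)) y else y, chain_face k i c))"

definition Q_degen :: "nat \<Rightarrow> 'y \<times> 'x plot_chain \<Rightarrow> 'y \<times> 'x plot_chain" where
  "Q_degen i = (\<lambda>(y, c). (y, chain_degen i c))"

definition Q_src :: "'y \<times> 'x plot_chain \<Rightarrow> 'y \<times> 'x plot_chain" where
  "Q_src = (\<lambda>(y, (ps, fs)). (y, ([ps ! 0], [])))"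

definition Q_tgt :: "((rvec \<Rightarrow> rvec) \<Rightarrow> 'y \<Rightarrow> 'y) \<Rightarrow> 'y \<times> 'x plot_chain \<Rightarrow> 'y \<times> 'x plot_chain" where
  "Q_tgt act = (\<lambda>(y, (ps, fs)). (act (fs ! 0) y, ([ps ! 1], [])))"

definition Q_unit :: "'y \<times> 'x plot_chain \<Rightarrow> 'y \<times> 'x plot_chain" where
  "Q_unit = (\<lambda>(y, (ps, fs)). (y, ([ps ! 0, ps ! 0], [\<lambda>x\<in>mcarrier (fst (ps ! 0)). x])))"

definition Q_comp :: "'y \<times> 'x plot_chain \<Rightarrow> 'y \<times> 'x plot_chain \<Rightarrow> 'y \<times> 'x plot_chain" where
  "Q_comp = (\<lambda>(y, (ps, fs)) (y', (ps', fs')).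
     (y, ([ps ! 0, ps' ! 1], [compose (mcarrier (fst (ps ! 0))) (fs' ! 0) (fs ! 0)])))"

definition Q_diffsp :: "'x diffsp \<Rightarrow> nat \<Rightarrow> (rvec \<times> 'x plot_chain) diffsp" where
  "Q_diffsp X k = dcoproduct (plot_chains X k) (\<lambda>c. cart_diffsp (chain_dom c))"

definition Q_sdiffsp :: "'x diffsp \<Rightarrow> (rvec \<times> 'x plot_chain) sdiffsp" where
  "Q_sdiffsp X = \<lparr>sd_level = Q_diffsp X, sd_face = Q_face (\<lambda>f x. f x), sd_degen = (\<lambda>k. Q_degen)\<rparr>"

definition Q_diffcat ::
    "'x diffsp \<Rightarrow> (rvec \<times> 'x plot_chain, rvec \<times> 'x plot_chain) diffcat" where
  "Q_diffcat X =
     \<lparr>dc_Ob = Q_diffsp X 0, dc_Ar = Q_diffsp X 1,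
      dc_src = Q_src, dc_tgt = Q_tgt (\<lambda>f x. f x), dc_unit = Q_unit, dc_comp = Q_comp\<rparr>"

definition Q_psh :: "'x diffsp \<Rightarrow> nat \<Rightarrow> ((rvec \<Rightarrow> rvec) \<times> 'x plot_chain) psh" where
  "Q_psh X k = psh_coproduct (plot_chains X k) (\<lambda>c. yoneda (chain_dom c))"

definition Q_spsh :: "'x diffsp \<Rightarrow> ((rvec \<Rightarrow> rvec) \<times> 'x plot_chain) spsh" where
  "Q_spsh X =
     \<lparr>sp_level = Q_psh X,
      sp_face = (\<lambda>k i V. Q_face (\<lambda>f g. compose (mcarrier V) f g) k i),
      sp_degen = (\<lambda>k i V. Q_degen i)\<rparr>"

definition Q_pshcat :: "'x diffsp \<Rightarrow>
    ((rvec \<Rightarrow> rvec) \<times> 'x plot_chain, (rvec \<Rightarrow> rvec) \<times> 'x plot_chain) pshcat" where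
  "Q_pshcat X =
     \<lparr>pc_Ob = Q_psh X 0, pc_Ar = Q_psh X 1,
      pc_src = (\<lambda>V. Q_src), pc_tgt = (\<lambda>V. Q_tgt (\<lambda>f g. compose (mcarrier V) f g)),
      pc_unit = (\<lambda>V. Q_unit), pc_comp = (\<lambda>V. Q_comp)\<rparr>"

end

(*
  A k-simplex of QX is a composable chain of maps of plots together with an element y of the domain
  of the chain. Pushing y along the chain yields k composable arrows of QX_1, and every string of
  composable arrows arises from exactly one simplex in this way. As y enters only through the action
  of smooth maps on it, the same bijection handles points and smooth maps V -> U.

  On diffeologies the point is that cartesian spaces are connected, so that a plot of a coproduct
  lies in a single summand. A plot of QX_k is therefore a smooth map into the domain of one fixed
  chain, and componentwise plots of the nerve have constant chains which glue. The nerve inherits its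
  diffeological (or presheaf) structure along the bijection, while QX inherits the simplicial
  identities from the nerve.
*)
theory Submission
  imports Defs
begin

section \<open>Smooth functions on open subsets of Euclidean space\<close>

text \<open>Smoothness is defined by iterated partial derivatives in charts, so closure under
  composition has to be derived from the one-variable mean value theorem; this explains the long
  analytic beginning. What the rest takes from it is composition and locality of smooth maps,
  smoothness of maps out of a point, and that cartesian spaces are connected and non-empty.

  Structure is transferred in both directions because each half is easy on one side only. In a nerve
  the simplicial identities are category axioms compared entry by entry, whereas on chains the
  element, the plots and the maps would each need their own computation. Conversely, every plot of
  \<open>Q_diffsp X k\<close> has the normal form of a smooth map paired with one fixed chain, so
  smoothness of faces and degeneracies reduces to smooth maps between domains, whereas a plot of the
  nerve is known only through its components.

  Level 0 is treated apart throughout: a vertex of the nerve is an object and not an empty path, and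
  the list of arrows of a chain of length 0 would forget the chain.\<close>

text \<open>A basic open set of the product topology restricts finitely many coordinates, so the
  radii have a positive minimum; the coordinates from \<open>n\<close> on are zero and need no
  control.\<close>

lemma Euclidean_space_cube_subset:
  assumes "openin (Euclidean_space n) T" "y \<in> T"
  obtains d where "d > 0"
    "\<And>z. z \<in> topspace (Euclidean_space n) \<Longrightarrow> (\<And>j. j < n \<Longrightarrow> \<bar>z j - y j\<bar> < d) \<Longrightarrow> z \<in> T"
proof -
  obtain G where G: "openin (powertop_real UNIV) G" "T = G \<inter> {x. \<forall>i\<ge>n. x i = 0}"
    using assms(1) unfolding Euclidean_space_def openin_subtopology by auto
  with assms(2) obtain U where U: "finite {i. U i \<noteq> (UNIV :: real set)}" "\<And>i. open (U i)"
      "y \<in> Pi\<^sub>E UNIV U" "Pi\<^sub>E UNIV U \<subseteq> G"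
    unfolding openin_product_topology_alt by simp blast
  have "\<exists>d>0. \<forall>s. \<bar>s - y i\<bar> < d \<longrightarrow> s \<in> U i" for i
    using U(2)[of i] U(3) by (auto simp: PiE_iff open_dist dist_real_def)
  then obtain d where d: "\<And>i. d i > 0" "\<And>i s. \<bar>s - y i\<bar> < d i \<Longrightarrow> s \<in> U i"
    by metis
  \<comment> \<open>The 1 keeps the set non-empty when no coordinate is restricted.\<close>
  let ?D = "Min (insert 1 (d ` {i. U i \<noteq> UNIV}))"
  show thesis
  proof (rule that)
    show "?D > 0" using U(1) d(1) by (subst Min_gr_iff) auto
    fix z assume z: "z \<in> topspace (Euclidean_space n)" "\<And>j. j < n \<Longrightarrow> \<bar>z j - y j\<bar> < ?D"
    have "z j \<in> U j" for j
    proof (cases "j < n \<and> U j \<noteq> UNIV")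
      case True
      then have "?D \<le> d j" using U(1) by (intro Min_le) auto
      then show ?thesis using z(2)[of j] True d(2) by force
    next
      case False
      moreover have "\<not> j < n \<Longrightarrow> z j = y j"
        using z(1) G(2) assms(2) by (auto simp: topspace_Euclidean_space)
      ultimately show ?thesis using U(3) by (cases "U j = UNIV") (auto simp: PiE_iff)
    qed
    then show "z \<in> T" using U(4) z(1) G(2) by (auto simp: topspace_Euclidean_space)
  qed
qed

text \<open>Partial derivatives are taken along \<open>x(i := t)\<close>; near \<open>x i\<close>
  this line stays in the open set.\<close>

lemma eventually_fun_upd_in_open:
  assumes "openin (Euclidean_space n) S" "x \<in> S" "i < n"
  shows "eventually (\<lambda>t. x(i := t) \<in> S) (nhds (x i))"
proof -
  obtain d where d: "d > 0"
    "\<And>z. z \<in> topspace (Euclidean_space n) \<Longrightarrow> (\<And>j. j < n \<Longrightarrow> \<bar>z j - x j\<bar> < d) \<Longrightarrow> z \<in> S"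
    using Euclidean_space_cube_subset[OF assms(1,2)] by metis
  have x: "x \<in> topspace (Euclidean_space n)" using assms openin_subset by blast
  have "x(i := t) \<in> S" if "dist t (x i) < d" for t
    using that x assms(3) d(1) by (intro d(2)) (auto simp: topspace_Euclidean_space dist_real_def)
  then show ?thesis using d(1) unfolding eventually_nhds_metric by blast
qed

section \<open>Closure properties of the classes of k times differentiable functions\<close>

lemma Ck_subset: "Ck n k S f \<Longrightarrow> T \<subseteq> S \<Longrightarrow> Ck n k T f"
proof (induction k arbitrary: f)
  case 0
  then show ?case using continuous_map_from_subtopology_mono by auto
next
  case (Suc k)
  have "continuous_map (subtopology (Euclidean_space n) T) euclideanreal f"
    using Suc.prems by (auto intro: continuous_map_from_subtopology_mono)
  then show ?case using Suc unfolding Ck.simps by (meson subsetD)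
qed

lemma Ck_imp_continuous_map:
  "Ck n k S f \<Longrightarrow> continuous_map (subtopology (Euclidean_space n) S) euclideanreal f"
  by (cases k) auto

lemma Ck_Suc_imp_Ck: "Ck n (Suc k) S f \<Longrightarrow> Ck n k S f"
proof (induction k arbitrary: f)
  case 0
  then show ?case by simp
next
  case (Suc k)
  from Suc.prems Suc.IH show ?case
    unfolding Ck.simps(2)[of n k S f] Ck.simps(2)[of n "Suc k" S f] by blast
qed

text \<open>Difference quotients at a point of the open set \<open>S\<close> eventually see only
  values on \<open>S\<close>. This allows chart expressions to be rewritten, whose values off the
  chart are arbitrary.\<close>

lemma Ck_cong:
  assumes "openin (Euclidean_space n) S" "\<And>x. x \<in> S \<Longrightarrow> f x = g x" "Ck n k S f"
  shows "Ck n k S g"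
proof (cases k)
  case 0
  then show ?thesis using assms
    by (auto intro: continuous_map_eq[where f = f] dest: openin_subset)
next
  case (Suc l)
  have "((\<lambda>t. g (x(i := t))) has_real_derivative h x) (at (x i))"
    if "x \<in> S" "i < n" "((\<lambda>t. f (x(i := t))) has_real_derivative h x) (at (x i))" for x i h
  proof -
    have "eventually (\<lambda>t. f (x(i := t)) = g (x(i := t))) (nhds (x i))"
      using eventually_fun_upd_in_open[OF assms(1) that(1,2)] by eventually_elim (use assms(2) in auto)
    from DERIV_cong_ev[OF refl this refl] that(3) show ?thesis by simp
  qed
  moreover have "continuous_map (subtopology (Euclidean_space n) S) euclideanreal g"
    using assms Ck_imp_continuous_map by (auto intro: continuous_map_eq[where f = f])
  ultimately show ?thesis using assms(3) Suc by simp meson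
qed

lemma Ck_const: "Ck n k S (\<lambda>x. c)"
proof (induction k arbitrary: c)
  case (Suc k)
  show ?case using Suc[of 0] by (auto intro!: exI[of _ "\<lambda>x. 0"])
qed simp

lemma continuous_map_Euclidean_coordinate:
  "continuous_map (subtopology (Euclidean_space n) S) euclideanreal (\<lambda>x. x j)"
  unfolding Euclidean_space_def
  by (intro continuous_map_from_subtopology continuous_map_product_projection) auto

lemma Ck_coordinate: "Ck n k S (\<lambda>x. x j)"
proof (cases k)
  case (Suc l)
  have "((\<lambda>t. (x(i := t)) j) has_real_derivative (if i = j then 1 else 0)) (at (x i))" for x :: rvec and i
    by (cases "i = j") (auto intro!: derivative_eq_intros)
  then show ?thesis using Suc continuous_map_Euclidean_coordinate
    by (auto intro!: exI[of _ "\<lambda>x. if _ = j then 1 else 0"] Ck_const)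
qed (auto simp: continuous_map_Euclidean_coordinate)

lemma Ck_add: "Ck n k S f \<Longrightarrow> Ck n k S g \<Longrightarrow> Ck n k S (\<lambda>x. f x + g x)"
proof (induction k arbitrary: f g)
  case (Suc k)
  show ?case unfolding Ck.simps
  proof (intro conjI allI impI)
    show "continuous_map (subtopology (Euclidean_space n) S) euclideanreal (\<lambda>x. f x + g x)"
      using Suc.prems by (auto intro: continuous_map_add)
    fix i assume "i < n"
    with Suc.prems obtain f' g' where *:
      "\<And>x. x \<in> S \<Longrightarrow> ((\<lambda>t. f (x(i := t))) has_real_derivative f' x) (at (x i))" "Ck n k S f'"
      "\<And>x. x \<in> S \<Longrightarrow> ((\<lambda>t. g (x(i := t))) has_real_derivative g' x) (at (x i))" "Ck n k S g'"
      by (simp) metis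
    then show "\<exists>h. (\<forall>x\<in>S. ((\<lambda>t. f (x(i := t)) + g (x(i := t))) has_real_derivative h x) (at (x i))) \<and> Ck n k S h"
      by (intro exI[of _ "\<lambda>x. f' x + g' x"] conjI ballI DERIV_add Suc.IH) auto
  qed
qed (auto intro: continuous_map_add)

text \<open>The product rule brings back \<open>f\<close> and \<open>g\<close> themselves next to
  their derivatives, so the induction also uses them at the lower order, through
  \<open>Ck_Suc_imp_Ck\<close>.\<close>

lemma Ck_mult: "Ck n k S f \<Longrightarrow> Ck n k S g \<Longrightarrow> Ck n k S (\<lambda>x. f x * g x)"
proof (induction k arbitrary: f g)
  case (Suc k)
  show ?case unfolding Ck.simps
  proof (intro conjI allI impI)
    show "continuous_map (subtopology (Euclidean_space n) S) euclideanreal (\<lambda>x. f x * g x)"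
      using Suc.prems by (auto intro: continuous_map_real_mult)
    fix i assume "i < n"
    with Suc.prems obtain f' g' where *:
      "\<And>x. x \<in> S \<Longrightarrow> ((\<lambda>t. f (x(i := t))) has_real_derivative f' x) (at (x i))" "Ck n k S f'"
      "\<And>x. x \<in> S \<Longrightarrow> ((\<lambda>t. g (x(i := t))) has_real_derivative g' x) (at (x i))" "Ck n k S g'"
      by (simp) metis
    show "\<exists>h. (\<forall>x\<in>S. ((\<lambda>t. f (x(i := t)) * g (x(i := t))) has_real_derivative h x) (at (x i))) \<and> Ck n k S h"
    proof (intro exI[of _ "\<lambda>x. f' x * g x + g' x * f x"] conjI ballI)
      show "Ck n k S (\<lambda>x. f' x * g x + g' x * f x)"
        using * Suc.prems by (intro Ck_add Suc.IH) (auto dest: Ck_Suc_imp_Ck simp del: Ck.simps)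
      fix x assume "x \<in> S"
      from DERIV_mult[OF *(1)[OF this] *(3)[OF this]]
      show "((\<lambda>t. f (x(i := t)) * g (x(i := t))) has_real_derivative f' x * g x + g' x * f x) (at (x i))"
        by simp
    qed
  qed
qed (auto intro: continuous_map_real_mult)

lemma Ck_sum: "(\<And>j. j \<in> J \<Longrightarrow> Ck n k S (f j)) \<Longrightarrow> Ck n k S (\<lambda>x. \<Sum>j\<in>J. f j x)"
  by (induction J rule: infinite_finite_induct) (simp_all add: Ck_const Ck_add)

section \<open>Total differentiability and the chain rule\<close>

text \<open>Continuous partial derivatives give total differentiability: pass from \<open>y\<close>
  to \<open>z\<close> one coordinate at a time and apply the mean value theorem to each move. The
  error is measured by the sum of the coordinate differences.\<close>

lemma total_difference_estimate:
  fixes g :: "rvec \<Rightarrow> real"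
  assumes T: "openin (Euclidean_space n) T" and y: "y \<in> T" and e: "e > 0"
    and der: "\<And>j z. j < n \<Longrightarrow> z \<in> T \<Longrightarrow> ((\<lambda>t. g (z(j := t))) has_real_derivative g' j z) (at (z j))"
    and cont: "\<And>j. j < n \<Longrightarrow> continuous_map (subtopology (Euclidean_space n) T) euclideanreal (g' j)"
  obtains d where "d > 0"
    "\<And>z. z \<in> topspace (Euclidean_space n) \<Longrightarrow> (\<And>j. j < n \<Longrightarrow> \<bar>z j - y j\<bar> < d) \<Longrightarrow>
       \<bar>g z - g y - (\<Sum>j<n. g' j y * (z j - y j))\<bar> \<le> e * (\<Sum>j<n. \<bar>z j - y j\<bar>)"
proof -
  have top: "topspace (subtopology (Euclidean_space n) T) = T"
    using openin_subset[OF T] by auto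
  \<comment> \<open>The part of \<open>T\<close> on which every partial derivative is within
    \<open>e\<close> of its value at \<open>y\<close>; it is an open neighbourhood of
    \<open>y\<close> and so contains a cube around \<open>y\<close>.\<close>
  define T' where "T' = {z \<in> T. \<forall>j<n. \<bar>g' j z - g' j y\<bar> < e}"
  have "openin (Euclidean_space n) {z \<in> T. \<bar>g' j z - g' j y\<bar> < e}" if "j < n" for j
  proof -
    have "openin (subtopology (Euclidean_space n) T)
        {z \<in> topspace (subtopology (Euclidean_space n) T). g' j z \<in> ball (g' j y) e}"
      by (rule openin_continuous_map_preimage[OF cont[OF that]]) auto
    moreover have "{z \<in> topspace (subtopology (Euclidean_space n) T). g' j z \<in> ball (g' j y) e}
        = {z \<in> T. \<bar>g' j z - g' j y\<bar> < e}"
      unfolding top by (auto simp: dist_real_def)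
    ultimately show ?thesis using T by (simp add: openin_open_subtopology)
  qed
  then have "openin (Euclidean_space n) (T \<inter> (\<Inter>j\<in>{..<n}. {z \<in> T. \<bar>g' j z - g' j y\<bar> < e}))"
  \<comment> \<open>For \<open>n = 0\<close> the intersection has no members and
    \<open>openin_Inter\<close> does not apply.\<close>
  proof (cases "n = 0")
    case False
    assume *: "\<And>j. j < n \<Longrightarrow> openin (Euclidean_space n) {z \<in> T. \<bar>g' j z - g' j y\<bar> < e}"
    show ?thesis using False * T by (intro openin_Int openin_Inter) auto
  qed (use T in simp)
  moreover have "T \<inter> (\<Inter>j\<in>{..<n}. {z \<in> T. \<bar>g' j z - g' j y\<bar> < e}) = T'"
    by (auto simp: T'_def)
  ultimately have "openin (Euclidean_space n) T'" by simp
  moreover have "y \<in> T'" using y e by (auto simp: T'_def)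
  ultimately obtain d where d: "d > 0"
    "\<And>z. z \<in> topspace (Euclidean_space n) \<Longrightarrow> (\<And>j. j < n \<Longrightarrow> \<bar>z j - y j\<bar> < d) \<Longrightarrow> z \<in> T'"
    using Euclidean_space_cube_subset by metis
  have ytop: "y \<in> topspace (Euclidean_space n)" using y T openin_subset by blast
  show thesis
  proof (rule that[OF d(1)])
    fix z assume z: "z \<in> topspace (Euclidean_space n)" "\<And>j. j < n \<Longrightarrow> \<bar>z j - y j\<bar> < d"
    \<comment> \<open>A staircase from \<open>y = w 0\<close> to \<open>z = w n\<close>; consecutive
      points differ in one coordinate only, and all of them stay in the cube.\<close>
    define w where "w = (\<lambda>l j. if j < l then z j else y j)"
    have w_upd: "(w l)(l := z l) = w (Suc l)" "(w l)(l := y l) = w l" for l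
      by (auto simp: w_def less_Suc_eq)
    have step: "\<bar>g (w (Suc l)) - g (w l) - g' l y * (z l - y l)\<bar> \<le> e * \<bar>z l - y l\<bar>" if l: "l < n" for l
    proof -
      have in_T': "(w l)(l := t) \<in> T'" if "\<bar>t - y l\<bar> \<le> \<bar>z l - y l\<bar>" for t
        using that z l ytop d(1) le_less_trans[OF that z(2)[OF l]]
        by (intro d(2)) (auto simp: topspace_Euclidean_space w_def)
      have deriv: "((\<lambda>t. g ((w l)(l := t))) has_real_derivative g' l ((w l)(l := t))) (at t)"
        if "\<bar>t - y l\<bar> \<le> \<bar>z l - y l\<bar>" for t
        using der[OF l, of "(w l)(l := t)"] in_T'[OF that] by (auto simp: T'_def)
      show ?thesis
      proof (cases "z l = y l")
        case True
        then show ?thesis using w_upd[of l] by simp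
      next
        case False
        \<comment> \<open>\<open>MVT2\<close> wants its endpoints in increasing order; for the
          opposite order the equation is multiplied by -1.\<close>
        have "\<exists>t. \<bar>t - y l\<bar> \<le> \<bar>z l - y l\<bar> \<and>
          g ((w l)(l := z l)) - g ((w l)(l := y l)) = (z l - y l) * g' l ((w l)(l := t))"
        proof (cases "y l < z l")
          case True
          from MVT2[OF True, of "\<lambda>t. g ((w l)(l := t))" "\<lambda>t. g' l ((w l)(l := t))"] deriv True
          show ?thesis by force
        next
          case f: False
          with False have "z l < y l" by simp
          from MVT2[OF this, of "\<lambda>t. g ((w l)(l := t))" "\<lambda>t. g' l ((w l)(l := t))"] deriv \<open>z l < y l\<close>
          obtain t where "z l < t" "t < y l"
            "g ((w l)(l := y l)) - g ((w l)(l := z l)) = (y l - z l) * g' l ((w l)(l := t))" by force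
          then show ?thesis by (intro exI[of _ t]) (auto simp: algebra_simps)
        qed
        then obtain t where t: "\<bar>t - y l\<bar> \<le> \<bar>z l - y l\<bar>"
          "g (w (Suc l)) - g (w l) = (z l - y l) * g' l ((w l)(l := t))"
          using w_upd[of l] by auto
        have "\<bar>g' l ((w l)(l := t)) - g' l y\<bar> \<le> e"
          using in_T'[OF t(1)] l by (auto simp: T'_def intro: less_imp_le)
        moreover have "g (w (Suc l)) - g (w l) - g' l y * (z l - y l) =
            (g' l ((w l)(l := t)) - g' l y) * (z l - y l)"
          using t(2) by (simp add: algebra_simps)
        ultimately show ?thesis by (simp add: abs_mult mult_right_mono)
      qed
    qed
    have "w n = z" "w 0 = y"
      using z(1) ytop by (auto simp: w_def fun_eq_iff topspace_Euclidean_space not_less)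
    then have "g z - g y = (\<Sum>l<n. g (w (Suc l)) - g (w l))"
      using sum_lessThan_telescope[of "\<lambda>l. g (w l)" n] by simp
    then have "\<bar>g z - g y - (\<Sum>j<n. g' j y * (z j - y j))\<bar> =
        \<bar>\<Sum>l<n. g (w (Suc l)) - g (w l) - g' l y * (z l - y l)\<bar>"
      by (simp add: sum_subtractf)
    also have "\<dots> \<le> (\<Sum>l<n. e * \<bar>z l - y l\<bar>)"
      using step by (intro order.trans[OF sum_abs] sum_mono) auto
    finally show "\<bar>g z - g y - (\<Sum>j<n. g' j y * (z j - y j))\<bar> \<le> e * (\<Sum>j<n. \<bar>z j - y j\<bar>)"
      by (simp add: sum_distrib_left)
  qed
qed

text \<open>Split \<open>g\<close> along the curve into its linearisation at \<open>h s\<close> and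
  a remainder \<open>r\<close>. Each coordinate of \<open>h\<close> is Lipschitz at
  \<open>s\<close>, so \<open>total_difference_estimate\<close> makes \<open>r\<close> of smaller
  order than \<open>t - s\<close>, and only the linear part contributes to the derivative.\<close>

lemma partial_chain_rule:
  fixes g :: "rvec \<Rightarrow> real" and h :: "real \<Rightarrow> rvec"
  assumes T: "openin (Euclidean_space n) T" and y: "h s \<in> T"
    and der: "\<And>j z. j < n \<Longrightarrow> z \<in> T \<Longrightarrow> ((\<lambda>t. g (z(j := t))) has_real_derivative g' j z) (at (z j))"
    and cont: "\<And>j. j < n \<Longrightarrow> continuous_map (subtopology (Euclidean_space n) T) euclideanreal (g' j)"
    and ev: "eventually (\<lambda>t. h t \<in> topspace (Euclidean_space n)) (nhds s)"
    and h: "\<And>j. j < n \<Longrightarrow> ((\<lambda>t. h t j) has_real_derivative h' j) (at s)"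
  shows "((\<lambda>t. g (h t)) has_real_derivative (\<Sum>j<n. g' j (h s) * h' j)) (at s)"
proof -
  \<comment> \<open>The sum of the Lipschitz constants that \<open>lip\<close> gives for the
    coordinates of \<open>h\<close>; the added 1 in each leaves room above the limit of the
    difference quotient.\<close>
  define C where "C = (\<Sum>j<n. \<bar>h' j\<bar> + 1)"
  have C: "C \<ge> 0" by (auto simp: C_def intro: sum_nonneg)
  define r where "r = (\<lambda>t. g (h t) - g (h s) - (\<Sum>j<n. g' j (h s) * (h t j - h s j)))"
  have lip: "eventually (\<lambda>t. \<bar>h t j - h s j\<bar> \<le> (\<bar>h' j\<bar> + 1) * \<bar>t - s\<bar>) (nhds s)" if "j < n" for j
  proof -
    from h[OF that] have "((\<lambda>t. (h t j - h s j) / (t - s)) \<longlongrightarrow> h' j) (at s)"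
      by (simp add: has_field_derivative_iff)
    then have "((\<lambda>t. \<bar>(h t j - h s j) / (t - s)\<bar>) \<longlongrightarrow> \<bar>h' j\<bar>) (at s)" by (rule tendsto_rabs)
    then have "eventually (\<lambda>t. \<bar>(h t j - h s j) / (t - s)\<bar> < \<bar>h' j\<bar> + 1) (at s)"
      by (rule order_tendstoD) auto
    then have "eventually (\<lambda>t. \<bar>h t j - h s j\<bar> \<le> (\<bar>h' j\<bar> + 1) * \<bar>t - s\<bar>) (at s)"
      using eventually_neq_at_within[of s s UNIV]
      by eventually_elim (auto simp: abs_divide divide_simps mult.commute split: if_splits)
    then show ?thesis by (auto simp: eventually_at_filter elim!: eventually_mono)
  qed
  have close: "eventually (\<lambda>t. \<bar>h t j - h s j\<bar> < d) (nhds s)" if "j < n" "d > 0" for j d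
  proof -
    have "isCont (\<lambda>t. h t j) s" using h[OF that(1)] by (rule DERIV_isCont)
    then have "((\<lambda>t. h t j) \<longlongrightarrow> h s j) (nhds s)"
      using tendsto_at_iff_tendsto_nhds[of "\<lambda>t. h t j" s] by (simp add: continuous_at)
    then show ?thesis using that(2) by (auto simp: tendsto_iff dist_real_def)
  qed
  have small: "eventually (\<lambda>t. \<bar>r t\<bar> \<le> e * \<bar>t - s\<bar>) (nhds s)" if e: "e > 0" for e
  proof -
    \<comment> \<open>Dividing by \<open>C + 1\<close> rather than by \<open>C\<close> avoids a zero
      denominator when \<open>n = 0\<close>.\<close>
    have "e / (C + 1) > 0" using e C by simp
    from total_difference_estimate[OF T y this der cont]
    obtain d where d: "d > 0" "\<And>z. z \<in> topspace (Euclidean_space n) \<Longrightarrow> (\<And>j. j < n \<Longrightarrow> \<bar>z j - h s j\<bar> < d) \<Longrightarrow>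
       \<bar>g z - g (h s) - (\<Sum>j<n. g' j (h s) * (z j - h s j))\<bar> \<le> e / (C + 1) * (\<Sum>j<n. \<bar>z j - h s j\<bar>)"
      by blast
    have "eventually (\<lambda>t. \<forall>j\<in>{..<n}. \<bar>h t j - h s j\<bar> < d) (nhds s)"
      using close d(1) by (intro eventually_ball_finite) auto
    moreover have "eventually (\<lambda>t. \<forall>j\<in>{..<n}. \<bar>h t j - h s j\<bar> \<le> (\<bar>h' j\<bar> + 1) * \<bar>t - s\<bar>) (nhds s)"
      using lip by (intro eventually_ball_finite) auto
    ultimately show ?thesis using ev
    proof eventually_elim
      case (elim t)
      have "\<bar>r t\<bar> \<le> e / (C + 1) * (\<Sum>j<n. \<bar>h t j - h s j\<bar>)"
        unfolding r_def using elim by (intro d(2)) auto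
      also have "\<dots> \<le> e / (C + 1) * (C * \<bar>t - s\<bar>)"
        unfolding C_def sum_distrib_right using elim e C[unfolded C_def]
        by (intro mult_left_mono sum_mono) auto
      also have "\<dots> = e * (C / (C + 1)) * \<bar>t - s\<bar>" by simp
      also have "\<dots> \<le> e * 1 * \<bar>t - s\<bar>"
        using e C by (intro mult_right_mono mult_left_mono) auto
      finally show ?case by simp
    qed
  qed
  have "eventually (\<lambda>t. norm (r t - r s - 0) \<le> e * norm (t - s)) (at s)" if "e > 0" for e
    using small[OF that] by (auto simp: eventually_at_filter r_def elim!: eventually_mono)
  then have "(r has_derivative (\<lambda>t. 0)) (at s)"
    unfolding has_derivative_within_alt2 by auto
  then have r: "(r has_real_derivative 0) (at s)"
    by (simp add: has_field_derivative_def mult_zero_class.mult_zero_left[abs_def])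
  have "((\<lambda>t. r t + g (h s) + (\<Sum>j<n. g' j (h s) * (h t j - h s j))) has_real_derivative
      0 + 0 + (\<Sum>j<n. g' j (h s) * (h' j - 0))) (at s)"
    by (intro DERIV_add DERIV_sum DERIV_cmult DERIV_diff r h DERIV_const) auto
  then show ?thesis by (simp add: r_def)
qed

lemma continuous_map_into_Euclidean_space:
  assumes "\<And>x. x \<in> topspace X \<Longrightarrow> f x \<in> topspace (Euclidean_space n)"
    "\<And>j. j < n \<Longrightarrow> continuous_map X euclideanreal (\<lambda>x. f x j)"
  shows "continuous_map X (Euclidean_space n) f"
proof (rule continuous_map_eq)
  show "continuous_map X (Euclidean_space n) (\<lambda>x i. if i < n then f x i else 0)"
    using assms(2) by (simp add: continuous_map_componentwise_Euclidean_space)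
qed (use assms(1) in \<open>auto simp: fun_eq_iff topspace_Euclidean_space\<close>)

text \<open>By the chain rule a partial derivative of the composite is a sum of products of
  \<open>g' j (f x)\<close> and \<open>f' j x\<close>. The first factor is again a composite, of
  lower order, so the induction runs over \<open>k\<close> with \<open>g\<close> arbitrary.\<close>

lemma Ck_compose:
  assumes S: "openin (Euclidean_space m) S" and T: "openin (Euclidean_space n) T"
    and f: "f \<in> S \<rightarrow> T" "\<And>j. j < n \<Longrightarrow> Ck m k S (\<lambda>x. f x j)" and g: "Ck n k T g"
  shows "Ck m k S (\<lambda>x. g (f x))"
proof -
  have top: "topspace (subtopology (Euclidean_space m) S) = S" "T \<subseteq> topspace (Euclidean_space n)"
    using openin_subset[OF S] openin_subset[OF T] by auto
  have contf: "continuous_map (subtopology (Euclidean_space m) S) (subtopology (Euclidean_space n) T) f"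
    using f top
    by (auto simp: continuous_map_in_subtopology image_subset_iff Pi_iff
        intro!: continuous_map_into_Euclidean_space Ck_imp_continuous_map)
  show ?thesis using f(2) g
  proof (induction k arbitrary: g)
    case 0
    then show ?case using continuous_map_compose[OF contf] by (simp add: o_def)
  next
    case (Suc k)
    \<comment> \<open>\<open>f\<close> itself survives inside \<open>g' j (f x)\<close>, hence it is
      needed at the lower order as well.\<close>
    have fk: "\<And>j. j < n \<Longrightarrow> Ck m k S (\<lambda>x. f x j)" using Suc.prems(1) Ck_Suc_imp_Ck by blast
    from Suc.prems(2) obtain g' where g': "\<And>j. j < n \<Longrightarrow> Ck n k T (g' j)"
      "\<And>j z. j < n \<Longrightarrow> z \<in> T \<Longrightarrow> ((\<lambda>t. g (z(j := t))) has_real_derivative g' j z) (at (z j))"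
      by simp metis
    show ?case unfolding Ck.simps
    proof (intro conjI allI impI)
      show "continuous_map (subtopology (Euclidean_space m) S) euclideanreal (\<lambda>x. g (f x))"
        using continuous_map_compose[OF contf Ck_imp_continuous_map[OF Suc.prems(2)]] unfolding o_def .
      fix i assume i: "i < m"
      have "\<exists>f'. (\<forall>x\<in>S. ((\<lambda>t. f (x(i := t)) j) has_real_derivative f' x) (at (x i))) \<and> Ck m k S f'"
        if "j < n" for j
        using Suc.prems(1)[OF that] i unfolding Ck.simps by blast
      then obtain f' where f': "\<And>j. j < n \<Longrightarrow> Ck m k S (f' j)"
        "\<And>j x. j < n \<Longrightarrow> x \<in> S \<Longrightarrow> ((\<lambda>t. f (x(i := t)) j) has_real_derivative f' j x) (at (x i))"
        by metis
      show "\<exists>h. (\<forall>x\<in>S. ((\<lambda>t. g (f (x(i := t)))) has_real_derivative h x) (at (x i))) \<and> Ck m k S h"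
      proof (intro exI[of _ "\<lambda>x. \<Sum>j<n. g' j (f x) * f' j x"] conjI ballI)
        show "Ck m k S (\<lambda>x. \<Sum>j<n. g' j (f x) * f' j x)"
          using fk f' g' Suc.IH by (intro Ck_sum Ck_mult) auto
        fix x assume x: "x \<in> S"
        have "eventually (\<lambda>t. f (x(i := t)) \<in> topspace (Euclidean_space n)) (nhds (x i))"
          using eventually_fun_upd_in_open[OF S x i] by eventually_elim (use f(1) top in auto)
        then show "((\<lambda>t. g (f (x(i := t)))) has_real_derivative (\<Sum>j<n. g' j (f x) * f' j x)) (at (x i))"
          using partial_chain_rule[OF T, of "\<lambda>t. f (x(i := t))" "x i" g g' "\<lambda>j. f' j x"]
            funcset_mem[OF f(1) x] g'(2) Ck_imp_continuous_map[OF g'(1)] f'(2)[OF _ x] by simp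
      qed
    qed
  qed
qed

section \<open>Smooth maps between open subsets of Euclidean spaces\<close>

lemma euclid_smooth_cong:
  assumes "openin (Euclidean_space m) S" "\<And>x. x \<in> S \<Longrightarrow> f x = g x" "euclid_smooth m n S f"
  shows "euclid_smooth m n S g"
  unfolding euclid_smooth_def
proof (intro conjI allI impI)
  show "g \<in> S \<rightarrow> topspace (Euclidean_space n)"
    using assms(2,3) unfolding euclid_smooth_def Pi_iff by metis
  show "Ck m k S (\<lambda>x. g x j)" if "j < n" for j k
  proof (rule Ck_cong[OF assms(1)])
    show "f x j = g x j" if "x \<in> S" for x using assms(2)[OF that] by simp
    show "Ck m k S (\<lambda>x. f x j)" using assms(3) that by (simp add: euclid_smooth_def)
  qed
qed

lemma euclid_smooth_subset: "euclid_smooth m n S f \<Longrightarrow> T \<subseteq> S \<Longrightarrow> euclid_smooth m n T f"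
  unfolding euclid_smooth_def by (blast intro: Ck_subset)

lemma euclid_smooth_id: "S \<subseteq> topspace (Euclidean_space n) \<Longrightarrow> euclid_smooth n n S (\<lambda>x. x)"
  by (auto simp: euclid_smooth_def Ck_coordinate)

lemma euclid_smooth_compose:
  assumes "openin (Euclidean_space l) S" "openin (Euclidean_space m) T" "f \<in> S \<rightarrow> T"
    "euclid_smooth l m S f" "euclid_smooth m n T g"
  shows "euclid_smooth l n S (g \<circ> f)"
  unfolding euclid_smooth_def
proof (intro conjI allI impI)
  show "g \<circ> f \<in> S \<rightarrow> topspace (Euclidean_space n)"
    using assms(3,5) by (auto simp: euclid_smooth_def)
  show "Ck l k S (\<lambda>x. (g \<circ> f) x j)" if "j < n" for j k
    unfolding o_def
    by (rule Ck_compose[OF assms(1-3)]) (use assms(4,5) that in \<open>auto simp: euclid_smooth_def\<close>)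
qed

lemma euclid_smooth_continuous_map:
  assumes "euclid_smooth m n S f"
  shows "continuous_map (subtopology (Euclidean_space m) S) (Euclidean_space n) f"
proof (rule continuous_map_into_Euclidean_space)
  fix j assume "j < n"
  then have "Ck m 0 S (\<lambda>x. f x j)" using assms unfolding euclid_smooth_def by blast
  then show "continuous_map (subtopology (Euclidean_space m) S) euclideanreal (\<lambda>x. f x j)" by simp
qed (use assms in \<open>auto simp: euclid_smooth_def\<close>)

lemma euclid_smooth_openin_preimage:
  assumes "openin (Euclidean_space m) S" "euclid_smooth m n S f" "openin (Euclidean_space n) T"
  shows "openin (Euclidean_space m) {x \<in> S. f x \<in> T}"
proof -
  have "topspace (subtopology (Euclidean_space m) S) = S"
    using openin_subset[OF assms(1)] by auto
  then show ?thesis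
    using openin_continuous_map_preimage[OF euclid_smooth_continuous_map[OF assms(2)] assms(3)] assms(1)
    by (simp add: openin_open_subtopology)
qed

section \<open>Manifolds and cartesian spaces\<close>

lemma matlas_chartD:
  assumes "smooth_manifold M" "(D, \<phi>) \<in> matlas M"
  shows "D \<subseteq> mcarrier M" "inj_on \<phi> D" "openin (Euclidean_space (mdim M)) (\<phi> ` D)"
  using assms by (auto simp: smooth_manifold_def chart_on_def)

lemma matlas_cover:
  assumes "smooth_manifold M" "x \<in> mcarrier M"
  obtains D \<phi> where "(D, \<phi>) \<in> matlas M" "x \<in> D"
proof -
  have "x \<in> \<Union> (fst ` matlas M)" using assms unfolding smooth_manifold_def by simp
  then show thesis using that by auto
qed

lemma matlas_transitionD:
  assumes "smooth_manifold M" "(D, \<phi>) \<in> matlas M" "(E, \<psi>) \<in> matlas M"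
  shows "openin (Euclidean_space (mdim M)) (\<phi> ` (D \<inter> E))"
    "euclid_smooth (mdim M) (mdim M) (\<phi> ` (D \<inter> E)) (\<psi> \<circ> inv_into D \<phi>)"
proof -
  have "compatible_charts (mdim M) (D, \<phi>) (E, \<psi>)"
    using assms unfolding smooth_manifold_def by blast
  then show "openin (Euclidean_space (mdim M)) (\<phi> ` (D \<inter> E))"
    "euclid_smooth (mdim M) (mdim M) (\<phi> ` (D \<inter> E)) (\<psi> \<circ> inv_into D \<phi>)"
    by (auto simp: compatible_charts_def smooth_transition_def)
qed

text \<open>Maximality of the atlas puts the restricted chart into it once compatibility with every
  chart is checked, and transition maps of the restriction are restrictions of the old ones.\<close>

lemma matlas_restrict:
  assumes M: "smooth_manifold M" and c: "(D, \<phi>) \<in> matlas M" and D': "D' \<subseteq> D"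
    and op: "openin (Euclidean_space (mdim M)) (\<phi> ` D')"
  shows "(D', \<phi>) \<in> matlas M"
proof -
  let ?n = "mdim M"
  note D = matlas_chartD[OF M c]
  have inv: "inv_into D' \<phi> y = inv_into D \<phi> y" if y: "y \<in> \<phi> ` D'" for y
  proof -
    obtain x where "x \<in> D'" "y = \<phi> x" using y by blast
    then show ?thesis using D(2) D' by (metis inj_on_subset inv_into_f_f subsetD)
  qed
  have "chart_on (mcarrier M) ?n (D', \<phi>)"
    using D D' op by (auto simp: chart_on_def intro: inj_on_subset)
  moreover have "compatible_charts ?n (D', \<phi>) (E, \<psi>)" if e: "(E, \<psi>) \<in> matlas M" for E \<psi>
    unfolding compatible_charts_def
  proof
    note E = matlas_chartD[OF M e]
    note DE = matlas_transitionD[OF M c e] and ED = matlas_transitionD[OF M e c]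
    have "\<phi> ` (D' \<inter> E) = \<phi> ` D' \<inter> \<phi> ` (D \<inter> E)"
      using inj_on_image_Int[OF D(2), of D' "D \<inter> E"] D' by (auto simp: Int_absorb1 Int_assoc[symmetric])
    then have op': "openin (Euclidean_space ?n) (\<phi> ` (D' \<inter> E))" using op DE(1) by auto
    moreover have "euclid_smooth ?n ?n (\<phi> ` (D' \<inter> E)) (\<psi> \<circ> inv_into D' \<phi>)"
    proof (rule euclid_smooth_cong[OF op'])
      show "euclid_smooth ?n ?n (\<phi> ` (D' \<inter> E)) (\<psi> \<circ> inv_into D \<phi>)"
        using D' by (intro euclid_smooth_subset[OF DE(2)]) auto
      show "(\<psi> \<circ> inv_into D \<phi>) x = (\<psi> \<circ> inv_into D' \<phi>) x" if "x \<in> \<phi> ` (D' \<inter> E)" for x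
        using inv[of x] that by auto
    qed
    ultimately show "smooth_transition ?n (D', \<phi>) (E, \<psi>)" by (simp add: smooth_transition_def)
    \<comment> \<open>Seen from the other chart, the overlap is the preimage of the open image of
      \<open>D'\<close> under the transition map, hence open.\<close>
    have "\<psi> ` (E \<inter> D') = {y \<in> \<psi> ` (E \<inter> D). (\<phi> \<circ> inv_into E \<psi>) y \<in> \<phi> ` D'}"
    proof (intro equalityI subsetI)
      fix y assume "y \<in> \<psi> ` (E \<inter> D')"
      then show "y \<in> {y \<in> \<psi> ` (E \<inter> D). (\<phi> \<circ> inv_into E \<psi>) y \<in> \<phi> ` D'}"
        using D' E(2) by auto
    next
      fix y assume "y \<in> {y \<in> \<psi> ` (E \<inter> D). (\<phi> \<circ> inv_into E \<psi>) y \<in> \<phi> ` D'}"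
      then obtain x where x: "x \<in> E" "x \<in> D" "y = \<psi> x" "\<phi> x \<in> \<phi> ` D'" using E(2) by auto
      then have "x \<in> D'" using inj_on_image_mem_iff[OF D(2) _ D', of x] by simp
      then show "y \<in> \<psi> ` (E \<inter> D')" using x by blast
    qed
    then have "openin (Euclidean_space ?n) (\<psi> ` (E \<inter> D'))"
      using euclid_smooth_openin_preimage[OF ED op] by simp
    moreover have "euclid_smooth ?n ?n (\<psi> ` (E \<inter> D')) (\<phi> \<circ> inv_into E \<psi>)"
      using D' by (intro euclid_smooth_subset[OF ED(2)]) auto
    ultimately show "smooth_transition ?n (E, \<psi>) (D', \<phi>)" by (simp add: smooth_transition_def)
  qed
  ultimately show ?thesis using M unfolding smooth_manifold_def by (metis surj_pair)
qed

section \<open>Smooth maps between manifolds\<close>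

lemma openin_mfd_topology_chart: "(D, \<phi>) \<in> matlas M \<Longrightarrow> openin (mfd_topology M) D"
  unfolding mfd_topology_def by (rule topology_generated_by_Basis) force

lemma topspace_mfd_topology: "smooth_manifold M \<Longrightarrow> topspace (mfd_topology M) = mcarrier M"
  by (simp add: mfd_topology_def smooth_manifold_def)

lemma mfd_smooth_funcset: "mfd_smooth M N f \<Longrightarrow> f \<in> mcarrier M \<rightarrow> mcarrier N"
  by (simp add: mfd_smooth_def)

lemma mfd_smooth_at:
  assumes "mfd_smooth M N f" "x \<in> mcarrier M"
  obtains D \<phi> E \<psi> where "(D, \<phi>) \<in> matlas M" "(E, \<psi>) \<in> matlas N" "x \<in> D" "f ` D \<subseteq> E"
    "euclid_smooth (mdim M) (mdim N) (\<phi> ` D) (\<psi> \<circ> f \<circ> inv_into D \<phi>)"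
  using assms unfolding mfd_smooth_def by fast

text \<open>The definition of smoothness offers some chart of the target; here the chart is
  prescribed. Shrink the source chart to the points sent into \<open>E'\<close> and follow the old
  chart expression by the transition map. Continuity and composition of smooth maps both rest on
  this freedom.\<close>

lemma mfd_smooth_at_chart:
  assumes M: "smooth_manifold M" and N: "smooth_manifold N" and f: "mfd_smooth M N f"
    and x: "x \<in> mcarrier M" and c: "(E', \<psi>') \<in> matlas N" and fx: "f x \<in> E'"
  obtains D \<phi> where "(D, \<phi>) \<in> matlas M" "x \<in> D" "f ` D \<subseteq> E'"
    "euclid_smooth (mdim M) (mdim N) (\<phi> ` D) (\<psi>' \<circ> f \<circ> inv_into D \<phi>)"
proof -
  obtain D \<phi> E \<psi> where d: "(D, \<phi>) \<in> matlas M" and e: "(E, \<psi>) \<in> matlas N" and xD: "x \<in> D"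
    and fD: "f ` D \<subseteq> E" and sm: "euclid_smooth (mdim M) (mdim N) (\<phi> ` D) (\<psi> \<circ> f \<circ> inv_into D \<phi>)"
    using mfd_smooth_at[OF f x] .
  note D = matlas_chartD[OF M d] and E = matlas_chartD[OF N e]
  note tr = matlas_transitionD[OF N e c]
  define D' where "D' = {x \<in> D. f x \<in> E'}"
  have inv: "inv_into D' \<phi> (\<phi> z) = z" "inv_into D \<phi> (\<phi> z) = z" if "z \<in> D'" for z
    using that inv_into_f_f[of \<phi> D' z] inv_into_f_f[OF D(2)] inj_on_subset[OF D(2), of D']
    by (auto simp: D'_def)
  have "\<phi> ` D' = {y \<in> \<phi> ` D. (\<psi> \<circ> f \<circ> inv_into D \<phi>) y \<in> \<psi> ` (E \<inter> E')}"
  proof (intro equalityI subsetI)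
    fix y assume "y \<in> \<phi> ` D'"
    then show "y \<in> {y \<in> \<phi> ` D. (\<psi> \<circ> f \<circ> inv_into D \<phi>) y \<in> \<psi> ` (E \<inter> E')}"
      using fD D(2) by (auto simp: D'_def)
  next
    fix y assume "y \<in> {y \<in> \<phi> ` D. (\<psi> \<circ> f \<circ> inv_into D \<phi>) y \<in> \<psi> ` (E \<inter> E')}"
    then obtain z where z: "z \<in> D" "y = \<phi> z" "\<psi> (f z) \<in> \<psi> ` (E \<inter> E')" using D(2) by auto
    moreover have "f z \<in> E" using z(1) fD by blast
    ultimately have "f z \<in> E \<inter> E'" using inj_on_image_mem_iff[OF E(2), of "f z" "E \<inter> E'"] by simp
    then show "y \<in> \<phi> ` D'" using z by (auto simp: D'_def)
  qed
  then have op: "openin (Euclidean_space (mdim M)) (\<phi> ` D')"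
    using euclid_smooth_openin_preimage[OF D(3) sm tr(1)] by simp
  show thesis
  proof
    show "(D', \<phi>) \<in> matlas M" using matlas_restrict[OF M d _ op] by (auto simp: D'_def)
    show "x \<in> D'" "f ` D' \<subseteq> E'" using xD fx by (auto simp: D'_def)
    show "euclid_smooth (mdim M) (mdim N) (\<phi> ` D') (\<psi>' \<circ> f \<circ> inv_into D' \<phi>)"
    proof (rule euclid_smooth_cong[OF op])
      show "euclid_smooth (mdim M) (mdim N) (\<phi> ` D')
          ((\<psi>' \<circ> inv_into E \<psi>) \<circ> (\<psi> \<circ> f \<circ> inv_into D \<phi>))"
      proof (rule euclid_smooth_compose[OF op tr(1) _ _ tr(2)])
        show "\<psi> \<circ> f \<circ> inv_into D \<phi> \<in> \<phi> ` D' \<rightarrow> \<psi> ` (E \<inter> E')"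
          using fD inv by (auto simp: D'_def)
        show "euclid_smooth (mdim M) (mdim N) (\<phi> ` D') (\<psi> \<circ> f \<circ> inv_into D \<phi>)"
          by (rule euclid_smooth_subset[OF sm]) (auto simp: D'_def)
      qed
      fix y assume "y \<in> \<phi> ` D'"
      then obtain z where z: "z \<in> D'" "y = \<phi> z" by blast
      then have "f z \<in> E" using fD by (auto simp: D'_def)
      then show "((\<psi>' \<circ> inv_into E \<psi>) \<circ> (\<psi> \<circ> f \<circ> inv_into D \<phi>)) y = (\<psi>' \<circ> f \<circ> inv_into D' \<phi>) y"
        using z inv E(2) by simp
    qed
  qed
qed

lemma mfd_smooth_continuous_map:
  assumes M: "smooth_manifold M" and N: "smooth_manifold N" and f: "mfd_smooth M N f"
  shows "continuous_map (mfd_topology M) (mfd_topology N) f"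
  unfolding mfd_topology_def[of N]
proof (rule continuous_on_generated_topo)
  fix E assume "E \<in> fst ` matlas N"
  then obtain \<psi> where e: "(E, \<psi>) \<in> matlas N" by auto
  show "openin (mfd_topology M) (f -` E \<inter> topspace (mfd_topology M))"
  proof (subst openin_subopen, intro ballI)
    fix x assume "x \<in> f -` E \<inter> topspace (mfd_topology M)"
    then have x: "x \<in> mcarrier M" "f x \<in> E" using topspace_mfd_topology[OF M] by auto
    obtain D \<phi> where d: "(D, \<phi>) \<in> matlas M" "x \<in> D" "f ` D \<subseteq> E"
      using mfd_smooth_at_chart[OF M N f x(1) e x(2)] .
    moreover have "D \<subseteq> mcarrier M" using matlas_chartD[OF M d(1)] by simp
    ultimately show "\<exists>T. openin (mfd_topology M) T \<and> x \<in> T \<and> T \<subseteq> f -` E \<inter> topspace (mfd_topology M)"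
      using openin_mfd_topology_chart[OF d(1)] topspace_mfd_topology[OF M] by (intro exI[of _ D]) auto
  qed
next
  show "f ` topspace (mfd_topology M) \<subseteq> \<Union> (fst ` matlas N)"
    using f N topspace_mfd_topology[OF M] by (auto simp: mfd_smooth_def smooth_manifold_def)
qed

text \<open>The smoothness of \<open>g\<close> at \<open>f x\<close> fixes the middle chart, and
  \<open>mfd_smooth_at_chart\<close> adapts the source chart to it; the two chart expressions can
  then be composed.\<close>

lemma mfd_smooth_compose:
  assumes M: "smooth_manifold M" and N: "smooth_manifold N" and P: "smooth_manifold P"
    and f: "mfd_smooth M N f" and g: "mfd_smooth N P g"
  shows "mfd_smooth M P (g \<circ> f)"
  unfolding mfd_smooth_def
proof (intro conjI ballI)
  show "g \<circ> f \<in> mcarrier M \<rightarrow> mcarrier P" using f g by (auto simp: mfd_smooth_def)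
  fix x assume x: "x \<in> mcarrier M"
  then have "f x \<in> mcarrier N" using f by (auto simp: mfd_smooth_def)
  then obtain E \<psi> F \<theta> where e: "(E, \<psi>) \<in> matlas N" and h: "(F, \<theta>) \<in> matlas P" "f x \<in> E" "g ` E \<subseteq> F"
    "euclid_smooth (mdim N) (mdim P) (\<psi> ` E) (\<theta> \<circ> g \<circ> inv_into E \<psi>)"
    using mfd_smooth_at[OF g] by metis
  obtain D \<phi> where d: "(D, \<phi>) \<in> matlas M" "x \<in> D" "f ` D \<subseteq> E"
    "euclid_smooth (mdim M) (mdim N) (\<phi> ` D) (\<psi> \<circ> f \<circ> inv_into D \<phi>)"
    using mfd_smooth_at_chart[OF M N f x e h(2)] .
  note D = matlas_chartD[OF M d(1)] and E = matlas_chartD[OF N e]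
  have "euclid_smooth (mdim M) (mdim P) (\<phi> ` D) (\<theta> \<circ> (g \<circ> f) \<circ> inv_into D \<phi>)"
  proof (rule euclid_smooth_cong[OF D(3)])
    show "euclid_smooth (mdim M) (mdim P) (\<phi> ` D) ((\<theta> \<circ> g \<circ> inv_into E \<psi>) \<circ> (\<psi> \<circ> f \<circ> inv_into D \<phi>))"
      by (rule euclid_smooth_compose[OF D(3) E(3) _ d(4) h(4)]) (use d(3) D(2) in auto)
    fix y assume "y \<in> \<phi> ` D"
    then show "((\<theta> \<circ> g \<circ> inv_into E \<psi>) \<circ> (\<psi> \<circ> f \<circ> inv_into D \<phi>)) y = (\<theta> \<circ> (g \<circ> f) \<circ> inv_into D \<phi>) y"
      using D(2) d(3) E(2) by (auto simp: image_subset_iff)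
  qed
  moreover have "(g \<circ> f) ` D \<subseteq> F" using d(3) h(3) by auto
  ultimately show "\<exists>(D, \<phi>)\<in>matlas M. \<exists>(F, \<theta>)\<in>matlas P. x \<in> D \<and> (g \<circ> f) ` D \<subseteq> F \<and>
      euclid_smooth (mdim M) (mdim P) (\<phi> ` D) (\<theta> \<circ> (g \<circ> f) \<circ> inv_into D \<phi>)"
    using d(1,2) h(1) by blast
qed

lemma mfd_smooth_cong_at:
  assumes M: "smooth_manifold M" and d: "(D, \<phi>) \<in> matlas M" "\<And>z. z \<in> D \<Longrightarrow> f z = g z"
    and sm: "euclid_smooth (mdim M) n (\<phi> ` D) (\<psi> \<circ> f \<circ> inv_into D \<phi>)"
  shows "euclid_smooth (mdim M) n (\<phi> ` D) (\<psi> \<circ> g \<circ> inv_into D \<phi>)"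
proof (rule euclid_smooth_cong[OF matlas_chartD(3)[OF M d(1)] _ sm])
  fix y assume "y \<in> \<phi> ` D"
  then show "(\<psi> \<circ> f \<circ> inv_into D \<phi>) y = (\<psi> \<circ> g \<circ> inv_into D \<phi>) y"
    using d(2)[of "inv_into D \<phi> y"] by (simp add: inv_into_into)
qed

text \<open>Charts of an open submanifold are charts of \<open>M\<close> that lie in
  \<open>W\<close>, so the witnesses of smoothness on \<open>W\<close> serve for \<open>M\<close>
  unchanged. This becomes the gluing axiom for the diffeology of a cartesian space.\<close>

lemma mfd_smooth_cover:
  assumes M: "smooth_manifold M" and f: "f \<in> mcarrier M \<rightarrow> mcarrier N" and W: "\<Union> \<W> = mcarrier M"
    and sm: "\<And>W. W \<in> \<W> \<Longrightarrow> mfd_smooth (open_submfd M W) N (restrict f W)"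
  shows "mfd_smooth M N f"
  unfolding mfd_smooth_def
proof (intro conjI f ballI)
  fix x assume "x \<in> mcarrier M"
  then obtain W where x: "W \<in> \<W>" "x \<in> W" using W by blast
  then have "x \<in> mcarrier (open_submfd M W)" by (simp add: open_submfd_def)
  from mfd_smooth_at[OF sm[OF x(1)] this]
  obtain D \<phi> E \<psi> where d: "(D, \<phi>) \<in> matlas (open_submfd M W)" "(E, \<psi>) \<in> matlas N" "x \<in> D"
    "restrict f W ` D \<subseteq> E"
    "euclid_smooth (mdim (open_submfd M W)) (mdim N) (\<phi> ` D) (\<psi> \<circ> restrict f W \<circ> inv_into D \<phi>)" .
  have "(D, \<phi>) \<in> matlas M" "D \<subseteq> W" "mdim (open_submfd M W) = mdim M"
    using d(1) by (auto simp: open_submfd_def)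
  note * = this(1,2) d(2-4) d(5)[unfolded this(3)]
  have "f ` D \<subseteq> E" using * by (auto simp: subset_iff)
  moreover have "euclid_smooth (mdim M) (mdim N) (\<phi> ` D) (\<psi> \<circ> f \<circ> inv_into D \<phi>)"
    by (rule mfd_smooth_cong_at[OF M *(1) _ *(6)]) (use *(2) in auto)
  ultimately show "\<exists>(D, \<phi>)\<in>matlas M. \<exists>(E, \<psi>)\<in>matlas N. x \<in> D \<and> f ` D \<subseteq> E \<and>
      euclid_smooth (mdim M) (mdim N) (\<phi> ` D) (\<psi> \<circ> f \<circ> inv_into D \<phi>)"
    using * by blast
qed

lemma open_submfd_self: "smooth_manifold M \<Longrightarrow> open_submfd M (mcarrier M) = M"
  using matlas_chartD(1) by (auto simp: open_submfd_def intro!: mfd.equality)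

lemma mfd_smooth_cong:
  assumes M: "smooth_manifold M" and f: "mfd_smooth M N f" and eq: "\<And>x. x \<in> mcarrier M \<Longrightarrow> f x = g x"
  shows "mfd_smooth M N g"
  unfolding mfd_smooth_def
proof (intro conjI ballI)
  show "g \<in> mcarrier M \<rightarrow> mcarrier N"
    using mfd_smooth_funcset[OF f] eq unfolding Pi_iff by metis
  fix x assume "x \<in> mcarrier M"
  from mfd_smooth_at[OF f this] obtain D \<phi> E \<psi> where *: "(D, \<phi>) \<in> matlas M" "(E, \<psi>) \<in> matlas N" "x \<in> D"
    "f ` D \<subseteq> E" "euclid_smooth (mdim M) (mdim N) (\<phi> ` D) (\<psi> \<circ> f \<circ> inv_into D \<phi>)" .
  have eqD: "f z = g z" if "z \<in> D" for z
    using that eq matlas_chartD(1)[OF M *(1)] by blast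
  then have "g ` D \<subseteq> E" using *(4) by (metis image_cong)
  then show "\<exists>(D, \<phi>)\<in>matlas M. \<exists>(E, \<psi>)\<in>matlas N. x \<in> D \<and> g ` D \<subseteq> E \<and>
    euclid_smooth (mdim M) (mdim N) (\<phi> ` D) (\<psi> \<circ> g \<circ> inv_into D \<phi>)"
    using mfd_smooth_cong_at[OF M *(1) eqD *(5)] * by blast
qed

lemma mfd_smooth_id:
  assumes "smooth_manifold M"
  shows "mfd_smooth M M (\<lambda>x. x)"
  unfolding mfd_smooth_def
proof (intro conjI ballI)
  fix x assume "x \<in> mcarrier M"
  then obtain D \<phi> where d: "(D, \<phi>) \<in> matlas M" "x \<in> D"
    using matlas_cover[OF assms] by blast
  moreover have "euclid_smooth (mdim M) (mdim M) (\<phi> ` D) (\<phi> \<circ> (\<lambda>x. x) \<circ> inv_into D \<phi>)"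
    using matlas_transitionD(2)[OF assms d(1) d(1)] by (simp add: o_def)
  ultimately show "\<exists>(D, \<phi>)\<in>matlas M. \<exists>(E, \<psi>)\<in>matlas M. x \<in> D \<and> (\<lambda>x. x) ` D \<subseteq> E \<and>
      euclid_smooth (mdim M) (mdim M) (\<phi> ` D) (\<psi> \<circ> (\<lambda>x. x) \<circ> inv_into D \<phi>)"
    by blast
qed auto

section \<open>Euclidean space as a manifold\<close>

lemma euclidean_chart_iff:
  "(D, \<phi>) \<in> matlas (euclidean_mfd n) \<longleftrightarrow>
     openin (Euclidean_space n) D \<and> inj_on \<phi> D \<and> openin (Euclidean_space n) (\<phi> ` D) \<and>
     euclid_smooth n n D \<phi> \<and> euclid_smooth n n (\<phi> ` D) (inv_into D \<phi>)"
proof -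
  let ?R = "topspace (Euclidean_space n)"
  have inv: "inv_into ?R (\<lambda>x. x) y = y" if "y \<in> ?R" for y
    using inv_into_f_f[of "\<lambda>x. x" ?R y] that by simp
  have "euclid_smooth n n D (\<phi> \<circ> inv_into ?R (\<lambda>x. x)) \<longleftrightarrow> euclid_smooth n n D \<phi>"
    if "openin (Euclidean_space n) D"
  proof -
    have "(\<phi> \<circ> inv_into ?R (\<lambda>x. x)) x = \<phi> x" if "x \<in> D" for x
      using inv[of x] openin_subset[OF \<open>openin (Euclidean_space n) D\<close>] that by auto
    then show ?thesis using euclid_smooth_cong[OF that] by metis
  qed
  moreover have "D \<inter> ?R = D \<and> ?R \<inter> D = D" if "D \<subseteq> ?R" using that by blast
  ultimately show ?thesis
    using openin_subset[of "Euclidean_space n" D]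
    by (auto simp: euclidean_mfd_def chart_on_def compatible_charts_def smooth_transition_def
        o_def[of "\<lambda>x. x"])
qed

lemma euclidean_chart_id:
  assumes "openin (Euclidean_space n) S"
  shows "(S, \<lambda>x. x) \<in> matlas (euclidean_mfd n)"
proof -
  have S: "S \<subseteq> topspace (Euclidean_space n)" using openin_subset[OF assms] .
  have "euclid_smooth n n S (inv_into S (\<lambda>x. x))"
  proof (rule euclid_smooth_cong[OF assms _ euclid_smooth_id[OF S]])
    show "x = inv_into S (\<lambda>x. x) x" if "x \<in> S" for x
      using inv_into_f_f[of "\<lambda>x. x" S x] that by simp
  qed
  then show ?thesis
    using assms S by (simp add: euclidean_chart_iff euclid_smooth_id)
qed

text \<open>Compatibility with the identity chart suffices for mutual compatibility, because the
  transition map factors through Euclidean space itself as the inverse of \<open>\<phi>\<close>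
  followed by \<open>\<psi>\<close>.\<close>

lemma euclidean_charts_compatible:
  assumes c: "(D, \<phi>) \<in> matlas (euclidean_mfd n)" and e: "(E, \<psi>) \<in> matlas (euclidean_mfd n)"
  shows "smooth_transition n (D, \<phi>) (E, \<psi>)"
proof -
  note D = c[unfolded euclidean_chart_iff] and E = e[unfolded euclidean_chart_iff]
  have "\<phi> ` (D \<inter> E) = {y \<in> \<phi> ` D. inv_into D \<phi> y \<in> E}" using D by auto
  then have op: "openin (Euclidean_space n) (\<phi> ` (D \<inter> E))"
    using euclid_smooth_openin_preimage[of n "\<phi> ` D" n "inv_into D \<phi>" E] D E by simp
  moreover have "euclid_smooth n n (\<phi> ` (D \<inter> E)) (\<psi> \<circ> inv_into D \<phi>)"
  proof (rule euclid_smooth_compose[OF op])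
    show "openin (Euclidean_space n) E" "euclid_smooth n n E \<psi>" using E by auto
    show "inv_into D \<phi> \<in> \<phi> ` (D \<inter> E) \<rightarrow> E" using D by auto
    show "euclid_smooth n n (\<phi> ` (D \<inter> E)) (inv_into D \<phi>)"
      using D by (blast intro: euclid_smooth_subset)
  qed
  ultimately show ?thesis by (simp add: smooth_transition_def)
qed

lemma mfd_topology_euclidean: "mfd_topology (euclidean_mfd n) = Euclidean_space n"
proof (rule topology_eq[THEN iffD2], intro allI iffI)
  fix S
  assume "openin (mfd_topology (euclidean_mfd n)) S"
  then have "generate_topology_on (fst ` matlas (euclidean_mfd n)) S"
    by (simp add: mfd_topology_def openin_topology_generated_by_iff)
  moreover have "openin (Euclidean_space n) D" if "D \<in> fst ` matlas (euclidean_mfd n)" for D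
    using that by (auto simp: euclidean_chart_iff)
  ultimately show "openin (Euclidean_space n) S"
    using generate_topology_on_coarsest[OF istopology_openin, of "fst ` matlas (euclidean_mfd n)" "Euclidean_space n" S]
    by blast
next
  show "openin (mfd_topology (euclidean_mfd n)) S" if "openin (Euclidean_space n) S" for S
    using openin_mfd_topology_chart[OF euclidean_chart_id[OF that]] .
qed

lemma smooth_manifold_euclidean: "smooth_manifold (euclidean_mfd n)"
  unfolding smooth_manifold_def
proof (intro conjI ballI allI impI)
  let ?E = "euclidean_mfd n" and ?R = "topspace (Euclidean_space n)"
  have dim: "mdim ?E = n" "mcarrier ?E = ?R" by (auto simp: euclidean_mfd_def)
  fix c assume c: "c \<in> matlas ?E"
  show "chart_on (mcarrier ?E) (mdim ?E) c" using c by (simp add: euclidean_mfd_def)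
  show "compatible_charts (mdim ?E) c c'" if "c' \<in> matlas ?E" for c'
    using euclidean_charts_compatible[of "fst c" "snd c" n "fst c'" "snd c'"]
      euclidean_charts_compatible[of "fst c'" "snd c'" n "fst c" "snd c"] c that
    by (simp add: compatible_charts_def dim)
next
  let ?E = "euclidean_mfd n" and ?R = "topspace (Euclidean_space n)"
  have top: "(?R, \<lambda>x. x) \<in> matlas ?E" by (rule euclidean_chart_id) simp
  have "\<And>c. c \<in> matlas ?E \<Longrightarrow> fst c \<subseteq> ?R" by (auto simp: euclidean_mfd_def chart_on_def)
  moreover have "?R \<in> fst ` matlas ?E" using image_eqI[OF _ top, of ?R fst] by simp
  moreover have "mcarrier ?E = ?R" by (simp add: euclidean_mfd_def)
  ultimately show "\<Union> (fst ` matlas ?E) = mcarrier ?E" by blast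
  fix c assume "chart_on (mcarrier ?E) (mdim ?E) c \<and> (\<forall>c'\<in>matlas ?E. compatible_charts (mdim ?E) c c')"
  then show "c \<in> matlas ?E" using top by (simp add: euclidean_mfd_def)
next
  \<comment> \<open>As a subspace of the topology of the type \<open>rvec\<close>, the space
    inherits separation and countability from the type.\<close>
  have eq: "Euclidean_space n = top_of_set {x. \<forall>i\<ge>n. x i = 0}"
    by (simp add: Euclidean_space_def euclidean_product_topology)
  show "Hausdorff_space (mfd_topology (euclidean_mfd n))"
    unfolding mfd_topology_euclidean eq by (intro Hausdorff_space_subtopology Hausdorff_space_euclidean)
  have "second_countable (euclidean :: rvec topology)"
    using ex_countable_basis[where 'a = rvec] unfolding second_countable_def
    by (metis open_openin topological_basisE topological_basis_open)
  then show "second_countable (mfd_topology (euclidean_mfd n))"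
    unfolding mfd_topology_euclidean eq by (rule second_countable_subtopology)
qed

section \<open>Topology of cartesian spaces, covers and the category of smooth maps\<close>

lemma cartesian_space_smooth_manifold: "cartesian_space U \<Longrightarrow> smooth_manifold U"
  by (simp add: cartesian_space_def)

lemma cartesian_space_euclidean: "cartesian_space (euclidean_mfd n)"
proof -
  let ?E = "euclidean_mfd n"
  have "mfd_smooth ?E ?E (inv_into (mcarrier ?E) (\<lambda>x. x))"
  proof (rule mfd_smooth_cong[OF smooth_manifold_euclidean mfd_smooth_id[OF smooth_manifold_euclidean]])
    show "x = inv_into (mcarrier ?E) (\<lambda>x. x) x" if "x \<in> mcarrier ?E" for x
      using inv_into_f_f[of "\<lambda>x. x" "mcarrier ?E" x] that by simp
  qed
  then have "mfd_diffeomorphism ?E ?E (\<lambda>x. x)"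
    using mfd_smooth_id[OF smooth_manifold_euclidean]
    by (simp add: mfd_diffeomorphism_def bij_betw_def)
  then show ?thesis using smooth_manifold_euclidean unfolding cartesian_space_def by blast
qed

text \<open>Provides the base points at which the summand or the chain of a plot is read
  off.\<close>

lemma cartesian_space_nonempty:
  assumes "cartesian_space U"
  shows "mcarrier U \<noteq> {}"
proof -
  obtain n f where "bij_betw f (mcarrier U) (mcarrier (euclidean_mfd n))"
    using assms unfolding cartesian_space_def mfd_diffeomorphism_def by blast
  moreover have "(\<lambda>i. 0) \<in> mcarrier (euclidean_mfd n)"
    by (simp add: euclidean_mfd_def topspace_Euclidean_space)
  ultimately show ?thesis by (metis bij_betw_empty1 empty_iff)
qed

lemma cartesian_space_connected:
  assumes "cartesian_space U"
  shows "connected_space (mfd_topology U)"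
proof -
  obtain n f where f: "bij_betw f (mcarrier U) (mcarrier (euclidean_mfd n))"
    "mfd_smooth (euclidean_mfd n) U (inv_into (mcarrier U) f)"
    using assms unfolding cartesian_space_def mfd_diffeomorphism_def by blast
  note U = cartesian_space_smooth_manifold[OF assms]
  let ?g = "inv_into (mcarrier U) f"
  have "connectedin (Euclidean_space n) (topspace (Euclidean_space n))"
    using connected_Euclidean_space by (simp add: connectedin_topspace)
  moreover have "continuous_map (Euclidean_space n) (mfd_topology U) ?g"
    using mfd_smooth_continuous_map[OF smooth_manifold_euclidean U f(2)]
    by (simp add: mfd_topology_euclidean)
  ultimately have "connectedin (mfd_topology U) (?g ` topspace (Euclidean_space n))"
    using connectedin_continuous_map_image by blast
  moreover have "?g ` topspace (Euclidean_space n) = mcarrier U"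
    using bij_betw_inv_into[OF f(1)] by (simp add: bij_betw_def euclidean_mfd_def)
  ultimately show ?thesis
    using topspace_mfd_topology[OF U] by (metis connectedin_topspace)
qed

text \<open>The cover members on which \<open>h\<close> has the value \<open>h x\<close> and those
  on which it has another value form two disjoint open unions that exhaust the space.\<close>

lemma connected_space_locally_constant:
  assumes X: "connected_space X" and op: "\<And>W. W \<in> \<W> \<Longrightarrow> openin X W" and cov: "\<Union> \<W> = topspace X"
    and const: "\<And>W. W \<in> \<W> \<Longrightarrow> h constant_on W" and x: "x \<in> topspace X" "y \<in> topspace X"
  shows "h x = h y"
proof (rule ccontr)
  assume ne: "h x \<noteq> h y"
  define A where "A = \<Union> {W \<in> \<W>. \<exists>z\<in>W. h z = h x}"
  define B where "B = \<Union> {W \<in> \<W>. \<exists>z\<in>W. h z \<noteq> h x}"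
  have "openin X A" "openin X B" using op by (auto simp: A_def B_def)
  moreover have hA: "h z = h x" if "z \<in> A" for z
    using that const by (force simp: A_def constant_on_def)
  moreover have hB: "h z \<noteq> h x" if "z \<in> B" for z
    using that const by (force simp: B_def constant_on_def)
  moreover have sub: "topspace X \<subseteq> A \<union> B" unfolding cov[symmetric] A_def B_def by blast
  moreover have "x \<in> A" "y \<in> B" using sub x ne hA[of y] hB[of x] by auto
  ultimately show False using X unfolding connected_space_def by blast
qed

text \<open>The trivial cover shows that a plot of one summand is a plot of the coproduct.\<close>

lemma good_open_cover_self:
  assumes "cartesian_space U"
  shows "good_open_cover U {mcarrier U}"
proof -
  note U = cartesian_space_smooth_manifold[OF assms]
  have "openin (mfd_topology U) (mcarrier U)"
    using topspace_mfd_topology[OF U] openin_topspace by metis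
  moreover have "\<Inter> \<F> = mcarrier U" if "\<F> \<noteq> {}" "\<F> \<subseteq> {mcarrier U}" for \<F>
    using that by (auto simp: subset_singleton_iff)
  ultimately show ?thesis
    using assms open_submfd_self[OF U] by (auto simp: good_open_cover_def)
qed

lemma good_open_coverD:
  assumes "good_open_cover U \<W>"
  shows "\<And>W. W \<in> \<W> \<Longrightarrow> openin (mfd_topology U) W"
    "\<And>W. W \<in> \<W> \<Longrightarrow> cartesian_space (open_submfd U W)" "\<Union> \<W> = mcarrier U"
  using assms by (auto simp: good_open_cover_def)

lemma mcarrier_open_submfd [simp]: "mcarrier (open_submfd U W) = W"
  by (simp add: open_submfd_def)

lemma cart_hom_compose:
  assumes "cartesian_space U" "cartesian_space V" "cartesian_space W"
    and f: "f \<in> cart_hom U V" and g: "g \<in> cart_hom V W"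
  shows "compose (mcarrier U) g f \<in> cart_hom U W"
proof -
  note mfds = assms(1-3)[THEN cartesian_space_smooth_manifold]
  have sm: "mfd_smooth U V f" "mfd_smooth V W g" using f g by (auto simp: cart_hom_def)
  have "mfd_smooth U W (compose (mcarrier U) g f)"
    by (rule mfd_smooth_cong[OF mfds(1) mfd_smooth_compose[OF mfds sm]]) (simp add: compose_eq)
  moreover have "compose (mcarrier U) g f \<in> mcarrier U \<rightarrow>\<^sub>E mcarrier W"
    using f g by (auto simp: cart_hom_def compose_def)
  ultimately show ?thesis by (simp add: cart_hom_def)
qed

lemma cart_hom_id:
  assumes "cartesian_space U"
  shows "(\<lambda>x\<in>mcarrier U. x) \<in> cart_hom U U"
proof -
  note U = cartesian_space_smooth_manifold[OF assms]
  have "mfd_smooth U U (\<lambda>x\<in>mcarrier U. x)"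
    by (rule mfd_smooth_cong[OF U mfd_smooth_id[OF U]]) simp
  then show ?thesis by (auto simp: cart_hom_def)
qed

section \<open>Coproducts of diffeological spaces\<close>

lemma plotsD:
  assumes "diffeological_space X" "(U, p) \<in> plots X"
  shows "cartesian_space U" "p \<in> mcarrier U \<rightarrow>\<^sub>E points X"
  using assms by (auto simp: diffeological_space_def)

lemma plots_point:
  assumes "diffeological_space X" "p \<in> mcarrier (euclidean_mfd 0) \<rightarrow>\<^sub>E points X"
  shows "(euclidean_mfd 0, p) \<in> plots X"
  using assms by (simp add: diffeological_space_def)

lemma plots_compose:
  assumes "diffeological_space X" "(U, p) \<in> plots X" "cartesian_space V" "f \<in> cart_hom V U"
  shows "(V, compose (mcarrier V) p f) \<in> plots X"
  using assms unfolding diffeological_space_def by blast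

lemma plots_local:
  assumes "diffeological_space X" "cartesian_space U" "p \<in> mcarrier U \<rightarrow>\<^sub>E points X" "good_open_cover U \<W>"
    "\<And>W. W \<in> \<W> \<Longrightarrow> (open_submfd U W, restrict p W) \<in> plots X"
  shows "(U, p) \<in> plots X"
  using assms unfolding diffeological_space_def by blast

lemma dsmooth_plot: "dsmooth X Y f \<Longrightarrow> (U, p) \<in> plots X \<Longrightarrow> (U, compose (mcarrier U) f p) \<in> plots Y"
  by (auto simp: dsmooth_def)

lemma mcarrier_euclidean_0: "mcarrier (euclidean_mfd 0) = {\<lambda>i. 0}"
  by (auto simp: euclidean_mfd_def topspace_Euclidean_space)

text \<open>The one point of the zero-dimensional space is a chart domain on which any map has a
  constant chart expression. This is the point axiom for the diffeology of a cartesian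
  space.\<close>

lemma mfd_smooth_from_point:
  assumes N: "smooth_manifold N" and p: "p \<in> mcarrier (euclidean_mfd 0) \<rightarrow> mcarrier N"
  shows "mfd_smooth (euclidean_mfd 0) N p"
  unfolding mfd_smooth_def
proof (intro conjI p ballI)
  fix x assume x: "x \<in> mcarrier (euclidean_mfd 0)"
  then have "p x \<in> mcarrier N" using p by auto
  then obtain E \<psi> where e: "(E, \<psi>) \<in> matlas N" "p x \<in> E" by (rule matlas_cover[OF N])
  have S: "{x} = topspace (Euclidean_space 0)" using x by (auto simp: euclidean_mfd_def topspace_Euclidean_space)
  then have op: "openin (Euclidean_space 0) {x}" by simp
  have "euclid_smooth 0 (mdim N) {x} (\<lambda>_. \<psi> (p x))"
    using openin_subset[OF matlas_chartD(3)[OF N e(1)]] e(2)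
    by (auto simp: euclid_smooth_def Ck_const)
  then have "euclid_smooth 0 (mdim N) {x} (\<psi> \<circ> p \<circ> inv_into {x} (\<lambda>x. x))"
    by (rule euclid_smooth_cong[OF op, rotated]) (use inv_into_f_f[of "\<lambda>x. x" "{x}" x] in auto)
  moreover have "mdim (euclidean_mfd 0) = 0" by (simp add: euclidean_mfd_def)
  moreover have "p ` {x} \<subseteq> E" "x \<in> {x}" "(\<lambda>x. x) ` {x} = {x}" using e by auto
  ultimately show "\<exists>(D, \<phi>)\<in>matlas (euclidean_mfd 0). \<exists>(E, \<psi>)\<in>matlas N. x \<in> D \<and> p ` D \<subseteq> E \<and>
      euclid_smooth (mdim (euclidean_mfd 0)) (mdim N) (\<phi> ` D) (\<psi> \<circ> p \<circ> inv_into D \<phi>)"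
    using euclidean_chart_id[OF op] e(1) by (metis (mono_tags, lifting) case_prodI)
qed

lemma cart_diffsp_plot_iff:
  "(V, f) \<in> plots (cart_diffsp U) \<longleftrightarrow> cartesian_space V \<and> f \<in> cart_hom V U"
  by (simp add: cart_diffsp_def)

lemma points_cart_diffsp [simp]: "points (cart_diffsp U) = mcarrier U"
  by (simp add: cart_diffsp_def)

lemma diffeological_space_cart_diffsp:
  assumes U: "cartesian_space U"
  shows "diffeological_space (cart_diffsp U)"
  unfolding diffeological_space_def points_cart_diffsp
proof (intro conjI ballI allI impI; (elim conjE)?)
  note mU = cartesian_space_smooth_manifold[OF U]
  fix p assume "p \<in> mcarrier (euclidean_mfd 0) \<rightarrow>\<^sub>E mcarrier U"
  then show "(euclidean_mfd 0, p) \<in> plots (cart_diffsp U)"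
    using mfd_smooth_from_point[OF mU, of p]
    by (auto simp: cart_diffsp_plot_iff cart_hom_def cartesian_space_euclidean PiE_def)
next
  fix c assume "c \<in> plots (cart_diffsp U)"
  then show "case c of (V, p) \<Rightarrow> cartesian_space V \<and> p \<in> mcarrier V \<rightarrow>\<^sub>E mcarrier U"
    by (cases c) (auto simp: cart_diffsp_plot_iff cart_hom_def)
next
  fix V p W f assume "(V, p) \<in> plots (cart_diffsp U)" "cartesian_space W" "f \<in> cart_hom W V"
  then show "(W, compose (mcarrier W) p f) \<in> plots (cart_diffsp U)"
    using cart_hom_compose U by (auto simp: cart_diffsp_plot_iff)
next
  fix V p \<W>
  assume *: "cartesian_space V" "p \<in> mcarrier V \<rightarrow>\<^sub>E mcarrier U" "good_open_cover V \<W>"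
    "\<forall>W\<in>\<W>. (open_submfd V W, restrict p W) \<in> plots (cart_diffsp U)"
  have "mfd_smooth V U p"
  proof (rule mfd_smooth_cover[OF cartesian_space_smooth_manifold[OF *(1)] _ good_open_coverD(3)[OF *(3)]])
    show "p \<in> mcarrier V \<rightarrow> mcarrier U" using *(2) by auto
    show "mfd_smooth (open_submfd V W) U (restrict p W)" if "W \<in> \<W>" for W
      using *(4) that by (auto simp: cart_diffsp_plot_iff cart_hom_def)
  qed
  then show "(V, p) \<in> plots (cart_diffsp U)" using * by (simp add: cart_diffsp_plot_iff cart_hom_def)
qed

lemma points_dcoproduct: "points (dcoproduct I F) = {(x, i). i \<in> I \<and> x \<in> points (F i)}"
  by (simp add: dcoproduct_def Let_def)

text \<open>Cartesian spaces are connected, so a plot of a coproduct lies in a single summand.\<close>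

lemma dcoproduct_plot_iff:
  assumes F: "\<And>i. i \<in> I \<Longrightarrow> diffeological_space (F i)"
  shows "(U, p) \<in> plots (dcoproduct I F) \<longleftrightarrow>
     (\<exists>i\<in>I. \<exists>q. (U, q) \<in> plots (F i) \<and> p = (\<lambda>x\<in>mcarrier U. (q x, i)))"
proof
  assume "(U, p) \<in> plots (dcoproduct I F)"
  then obtain \<W> where U: "cartesian_space U" and p: "p \<in> mcarrier U \<rightarrow>\<^sub>E points (dcoproduct I F)"
    and \<W>: "good_open_cover U \<W>"
    and loc: "\<And>W. W \<in> \<W> \<Longrightarrow> \<exists>i\<in>I. \<exists>q. (open_submfd U W, q) \<in> plots (F i) \<and> (\<forall>x\<in>W. p x = (q x, i))"
    by (auto simp: dcoproduct_def Let_def)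
  note mU = cartesian_space_smooth_manifold[OF U]
  note \<W>' = good_open_coverD[OF \<W>]
  obtain x0 where x0: "x0 \<in> mcarrier U" using cartesian_space_nonempty[OF U] by blast
  define i where "i = snd (p x0)"
  have const: "snd (p x) = i" if "x \<in> mcarrier U" for x
    unfolding i_def
  proof (rule connected_space_locally_constant[OF cartesian_space_connected[OF U]])
    show "\<And>W. W \<in> \<W> \<Longrightarrow> openin (mfd_topology U) W" "\<Union> \<W> = topspace (mfd_topology U)"
      using \<W>' topspace_mfd_topology[OF mU] by auto
    show "(\<lambda>x. snd (p x)) constant_on W" if "W \<in> \<W>" for W
      using loc[OF that] unfolding constant_on_def by fastforce
  qed (use that x0 topspace_mfd_topology[OF mU] in auto)
  have mem: "snd (p x) \<in> I" "fst (p x) \<in> points (F (snd (p x)))" if "x \<in> mcarrier U" for x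
    using PiE_mem[OF p that] by (auto simp: points_dcoproduct)
  have i: "i \<in> I" using mem x0 by (simp add: i_def)
  define q where "q = (\<lambda>x\<in>mcarrier U. fst (p x))"
  have "(U, q) \<in> plots (F i)"
  proof (rule plots_local[OF F[OF i] U _ \<W>])
    show "q \<in> mcarrier U \<rightarrow>\<^sub>E points (F i)"
      using mem(2) const by (auto simp: q_def)
    fix W assume W: "W \<in> \<W>"
    \<comment> \<open>Members of a good cover are cartesian and hence non-empty; a point of
      \<open>W\<close> identifies the local summand \<open>i'\<close> with the global
      \<open>i\<close>.\<close>
    obtain x where x: "x \<in> W" using cartesian_space_nonempty[OF \<W>'(2)[OF W]] by auto
    obtain i' q' where *: "i' \<in> I" "(open_submfd U W, q') \<in> plots (F i')" "\<forall>x\<in>W. p x = (q' x, i')"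
      using loc[OF W] by blast
    have sub: "W \<subseteq> mcarrier U" using W \<W>'(3) by blast
    then have "i' = i" using const[of x] x *(3) by auto
    \<comment> \<open>Plots are extensional, so the equality holds off \<open>W\<close> too, where
      both sides are \<open>undefined\<close>.\<close>
    moreover have "restrict q W = q'"
    proof
      fix x
      show "restrict q W x = q' x"
      proof (cases "x \<in> W")
        case True
        then show ?thesis using sub bspec[OF *(3) True] by (auto simp: q_def)
      next
        case False
        then show ?thesis using PiE_arb[OF plotsD(2)[OF F[OF *(1)] *(2)], of x] by simp
      qed
    qed
    ultimately show "(open_submfd U W, restrict q W) \<in> plots (F i)" using *(2) by simp
  qed
  moreover have "p = (\<lambda>x\<in>mcarrier U. (q x, i))"
  proof
    show "p x = (\<lambda>x\<in>mcarrier U. (q x, i)) x" for x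
      using const[of x] PiE_arb[OF p, of x]
      by (cases "x \<in> mcarrier U") (simp_all add: q_def prod_eq_iff)
  qed
  ultimately show "\<exists>i\<in>I. \<exists>q. (U, q) \<in> plots (F i) \<and> p = (\<lambda>x\<in>mcarrier U. (q x, i))" using i by blast
next
  assume "\<exists>i\<in>I. \<exists>q. (U, q) \<in> plots (F i) \<and> p = (\<lambda>x\<in>mcarrier U. (q x, i))"
  then obtain i q where *: "i \<in> I" "(U, q) \<in> plots (F i)" "p = (\<lambda>x\<in>mcarrier U. (q x, i))" by blast
  note q = plotsD[OF F[OF *(1)] *(2)]
  have "(open_submfd U (mcarrier U), q) \<in> plots (F i)"
    using * open_submfd_self[OF cartesian_space_smooth_manifold[OF q(1)]] by simp
  then have "\<exists>\<W>. good_open_cover U \<W> \<and>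
     (\<forall>W\<in>\<W>. \<exists>i\<in>I. \<exists>q. (open_submfd U W, q) \<in> plots (F i) \<and> (\<forall>x\<in>W. p x = (q x, i)))"
    using good_open_cover_self[OF q(1)] * by (intro exI[of _ "{mcarrier U}"]) auto
  then show "(U, p) \<in> plots (dcoproduct I F)"
    using * q by (auto simp: dcoproduct_def Let_def)
qed

lemma dcoproduct_plotI:
  assumes "\<And>i. i \<in> I \<Longrightarrow> diffeological_space (F i)" "i \<in> I" "(U, q) \<in> plots (F i)"
    "p = (\<lambda>x\<in>mcarrier U. (q x, i))"
  shows "(U, p) \<in> plots (dcoproduct I F)"
proof (rule dcoproduct_plot_iff[THEN iffD2])
  show "\<exists>i\<in>I. \<exists>q. (U, q) \<in> plots (F i) \<and> p = (\<lambda>x\<in>mcarrier U. (q x, i))"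
    using assms(2-4) by (intro bexI[of _ i] exI[of _ q] conjI)
qed (rule assms(1))

lemma dcoproduct_plotE:
  assumes "(U, p) \<in> plots (dcoproduct I F)" "\<And>i. i \<in> I \<Longrightarrow> diffeological_space (F i)"
  obtains i q where "i \<in> I" "(U, q) \<in> plots (F i)" "p = (\<lambda>x\<in>mcarrier U. (q x, i))"
proof -
  have "\<exists>i\<in>I. \<exists>q. (U, q) \<in> plots (F i) \<and> p = (\<lambda>x\<in>mcarrier U. (q x, i))"
    using assms(1) by (rule dcoproduct_plot_iff[THEN iffD1, rotated]) (rule assms(2))
  then show thesis using that by blast
qed

lemma diffeological_space_dcoproduct:
  assumes F: "\<And>i. i \<in> I \<Longrightarrow> diffeological_space (F i)"
  shows "diffeological_space (dcoproduct I F)"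
  unfolding diffeological_space_def
proof (intro conjI ballI allI impI; (elim conjE)?)
  fix c assume "c \<in> plots (dcoproduct I F)"
  then show "case c of (U, p) \<Rightarrow> cartesian_space U \<and> p \<in> mcarrier U \<rightarrow>\<^sub>E points (dcoproduct I F)"
    by (auto simp: dcoproduct_def Let_def)
next
  fix p assume p: "p \<in> mcarrier (euclidean_mfd 0) \<rightarrow>\<^sub>E points (dcoproduct I F)"
  let ?o = "\<lambda>i::nat. 0::real"
  obtain y i where y: "p ?o = (y, i)" by fastforce
  then have i: "i \<in> I" "y \<in> points (F i)"
    using p by (auto simp: points_dcoproduct mcarrier_euclidean_0 PiE_iff)
  have pl: "(euclidean_mfd 0, \<lambda>x\<in>mcarrier (euclidean_mfd 0). y) \<in> plots (F i)"
    by (rule plots_point[OF F[OF i(1)]]) (use i in auto)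
  show "(euclidean_mfd 0, p) \<in> plots (dcoproduct I F)"
  proof (rule dcoproduct_plotI[where F = F, OF _ i(1) pl])
    show "p = (\<lambda>x\<in>mcarrier (euclidean_mfd 0). ((\<lambda>x\<in>mcarrier (euclidean_mfd 0). y) x, i))"
    proof
      show "p x = (\<lambda>x\<in>mcarrier (euclidean_mfd 0). ((\<lambda>x\<in>mcarrier (euclidean_mfd 0). y) x, i)) x" for x
        using PiE_arb[OF p, of x] y
        by (cases "x \<in> mcarrier (euclidean_mfd 0)") (simp_all add: mcarrier_euclidean_0)
    qed
  qed (rule F)
next
  fix U p V f assume *: "(U, p) \<in> plots (dcoproduct I F)" "cartesian_space V" "f \<in> cart_hom V U"
  from *(1) obtain i q where q: "i \<in> I" "(U, q) \<in> plots (F i)" "p = (\<lambda>x\<in>mcarrier U. (q x, i))"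
    by (rule dcoproduct_plotE) (rule F)
  have "compose (mcarrier V) p f = (\<lambda>x\<in>mcarrier V. (compose (mcarrier V) q f x, i))"
    using *(3) unfolding q(3) compose_def cart_hom_def by (intro restrict_ext) auto
  then show "(V, compose (mcarrier V) p f) \<in> plots (dcoproduct I F)"
    by (rule dcoproduct_plotI[where F = F, OF _ q(1) plots_compose[OF F[OF q(1)] q(2) *(2,3)], rotated])
      (rule F)
next
  fix U p \<W>
  assume *: "cartesian_space U" "p \<in> mcarrier U \<rightarrow>\<^sub>E points (dcoproduct I F)" "good_open_cover U \<W>"
    "\<forall>W\<in>\<W>. (open_submfd U W, restrict p W) \<in> plots (dcoproduct I F)"
  \<comment> \<open>Each restriction already lies in a single summand, so \<open>\<W>\<close> itself
    witnesses that \<open>p\<close> is a plot and no common refinement of covers has to be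
    built.\<close>
  have "\<exists>i\<in>I. \<exists>q. (open_submfd U W, q) \<in> plots (F i) \<and> (\<forall>x\<in>W. p x = (q x, i))" if "W \<in> \<W>" for W
  proof -
    have "(open_submfd U W, restrict p W) \<in> plots (dcoproduct I F)" using *(4) that by blast
    then obtain i q where q: "i \<in> I" "(open_submfd U W, q) \<in> plots (F i)"
      "restrict p W = (\<lambda>x\<in>mcarrier (open_submfd U W). (q x, i))"
      by (rule dcoproduct_plotE) (rule F)
    have "p x = (q x, i)" if "x \<in> W" for x using fun_cong[OF q(3), of x] that by simp
    then show ?thesis using q by blast
  qed
  then show "(U, p) \<in> plots (dcoproduct I F)"
    using * by (auto simp: dcoproduct_def Let_def)
qed

section \<open>The nerve of a small category\<close>

text \<open>One entrywise formula for outer and inner faces, which turns identities between faces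
  into comparisons at an index. The vertex \<open>i\<close> lies between the arrows
  \<open>i - 1\<close> and \<open>i\<close>, so the composite sits at entry \<open>i - 1\<close>;
  for \<open>i = 0\<close> the formula gives the tail, for \<open>i = length as\<close> all but the
  last arrow.\<close>

definition face_path :: "('a \<Rightarrow> 'a \<Rightarrow> 'a) \<Rightarrow> nat \<Rightarrow> 'a list \<Rightarrow> 'a list" where
  "face_path cmp i as = map (\<lambda>j. if Suc j < i then as ! j
     else if Suc j = i then cmp (as ! j) (as ! Suc j) else as ! Suc j) [0..<length as - 1]"

text \<open>A path of length \<open>k\<close> visits \<open>k + 1\<close> objects: all but the last
  are sources of its arrows.\<close>

definition path_vertex :: "('a \<Rightarrow> 'o) \<Rightarrow> ('a \<Rightarrow> 'o) \<Rightarrow> nat \<Rightarrow> 'a list \<Rightarrow> 'o" where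
  "path_vertex src tgt i as = (if i < length as then src (as ! i) else tgt (last as))"

definition degen_path :: "('a \<Rightarrow> 'o) \<Rightarrow> ('a \<Rightarrow> 'o) \<Rightarrow> ('o \<Rightarrow> 'a) \<Rightarrow> nat \<Rightarrow> 'a list \<Rightarrow> 'a list" where
  "degen_path src tgt unit i as = map (\<lambda>j. if j < i then as ! j
     else if j = i then unit (path_vertex src tgt i as) else as ! (j - 1)) [0..<Suc (length as)]"

lemma length_face_path [simp]: "length (face_path cmp i as) = length as - 1"
  by (simp add: face_path_def)

lemma length_degen_path [simp]: "length (degen_path src tgt unit i as) = Suc (length as)"
  by (simp add: degen_path_def)

lemma nth_face_path: "Suc j < length as \<Longrightarrow> face_path cmp i as ! j =
    (if Suc j < i then as ! j else if Suc j = i then cmp (as ! j) (as ! Suc j) else as ! Suc j)"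
  by (simp add: face_path_def)

lemma nth_degen_path: "j < Suc (length as) \<Longrightarrow> degen_path src tgt unit i as ! j =
    (if j < i then as ! j else if j = i then unit (path_vertex src tgt i as) else as ! (j - 1))"
  unfolding degen_path_def by (subst nth_map) (simp_all del: upt_Suc)

lemma nerve_face_1:
  "nerve_face src tgt cmp (Suc 0) i (Path as) = Vertex (if i = 0 then tgt (as ! 0) else src (as ! 0))"
  by (simp add: nerve_face_def)

lemma nerve_face_Path:
  assumes "k = length as" "k \<ge> 2" "i \<le> k"
  shows "nerve_face src tgt cmp k i (Path as) = Path (face_path cmp i as)"
proof -
  have "tl as = face_path cmp 0 as"
    using assms by (intro nth_equalityI) (auto simp: nth_face_path nth_tl)
  moreover have "butlast as = face_path cmp k as"
    using assms by (intro nth_equalityI) (auto simp: nth_face_path nth_butlast)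
  moreover have "take (i - 1) as @ [cmp (as ! (i - 1)) (as ! i)] @ drop (i + 1) as = face_path cmp i as"
    if "i \<noteq> 0" "i \<noteq> k"
    using assms that by (intro nth_equalityI) (auto simp: nth_face_path nth_append nth_Cons
        intro!: arg_cong[where f = "(!) as"] split: nat.split)
  ultimately show ?thesis using assms by (auto simp: nerve_face_def)
qed

lemma nerve_degen_Path:
  assumes "k = length as" "k \<ge> 1" "i \<le> k"
  shows "nerve_degen src tgt unit k i (Path as) = Path (degen_path src tgt unit i as)"
proof -
  have "take i as @ [unit (path_vertex src tgt i as)] @ drop i as = degen_path src tgt unit i as"
  proof (rule nth_equalityI)
    fix j assume "j < length (take i as @ [unit (path_vertex src tgt i as)] @ drop i as)"
    then have j: "j < Suc (length as)" using assms by auto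
    show "(take i as @ [unit (path_vertex src tgt i as)] @ drop i as) ! j = degen_path src tgt unit i as ! j"
      using assms j by (auto simp: nth_degen_path nth_append nth_Cons min_def
        intro!: arg_cong[where f = "(!) as"] split: nat.split)
  qed (use assms in auto)
  moreover have "k \<noteq> 0" using assms by linarith
  ultimately show ?thesis using assms(1) by (simp add: nerve_degen_def path_vertex_def)
qed

section \<open>Paths of arrows and identities between their faces and degeneracies\<close>

locale small_cat =
  fixes Ob :: "'o set" and Ar :: "'a set" and src tgt unit cmp
  assumes category: "small_category Ob Ar src tgt unit cmp"
begin

lemma src_Ob: "a \<in> Ar \<Longrightarrow> src a \<in> Ob" and tgt_Ob: "a \<in> Ar \<Longrightarrow> tgt a \<in> Ob"
  and unit_Ar: "x \<in> Ob \<Longrightarrow> unit x \<in> Ar"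
  and comp_Ar: "a \<in> Ar \<Longrightarrow> b \<in> Ar \<Longrightarrow> tgt a = src b \<Longrightarrow> cmp a b \<in> Ar"
  and src_comp: "a \<in> Ar \<Longrightarrow> b \<in> Ar \<Longrightarrow> tgt a = src b \<Longrightarrow> src (cmp a b) = src a"
  and tgt_comp: "a \<in> Ar \<Longrightarrow> b \<in> Ar \<Longrightarrow> tgt a = src b \<Longrightarrow> tgt (cmp a b) = tgt b"
  and src_unit: "x \<in> Ob \<Longrightarrow> src (unit x) = x" and tgt_unit: "x \<in> Ob \<Longrightarrow> tgt (unit x) = x"
  and comp_unit_left: "a \<in> Ar \<Longrightarrow> cmp (unit (src a)) a = a"
  and comp_unit_right: "a \<in> Ar \<Longrightarrow> cmp a (unit (tgt a)) = a"
  and comp_assoc: "a \<in> Ar \<Longrightarrow> b \<in> Ar \<Longrightarrow> c \<in> Ar \<Longrightarrow> tgt a = src b \<Longrightarrow> tgt b = src c \<Longrightarrow>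
    cmp (cmp a b) c = cmp a (cmp b c)"
  using category unfolding small_category_def by blast+

definition arrow_path :: "nat \<Rightarrow> 'a list \<Rightarrow> bool" where
  "arrow_path k as \<longleftrightarrow> length as = k \<and> (\<forall>j<k. as ! j \<in> Ar) \<and> (\<forall>j. Suc j < k \<longrightarrow> tgt (as ! j) = src (as ! Suc j))"

lemma nerve_set_0: "nerve_set Ob Ar src tgt 0 = Vertex ` Ob"
  by (simp add: nerve_set_def)

lemma nerve_set_Suc: "nerve_set Ob Ar src tgt (Suc k) = Path ` {as. arrow_path (Suc k) as}"
  unfolding nerve_set_def arrow_path_def subset_code(1) all_set_conv_all_nth by (simp cong: conj_cong)

abbreviation "vertex \<equiv> path_vertex src tgt"
abbreviation "degen \<equiv> degen_path src tgt unit"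
abbreviation "face \<equiv> face_path cmp"

lemma path_length: "arrow_path k as \<Longrightarrow> length as = k"
  and path_Ar: "arrow_path k as \<Longrightarrow> j < k \<Longrightarrow> as ! j \<in> Ar"
  and path_tgt: "arrow_path k as \<Longrightarrow> Suc j < k \<Longrightarrow> tgt (as ! j) = src (as ! Suc j)"
  by (auto simp: arrow_path_def)

lemma path_last: "arrow_path (Suc k) as \<Longrightarrow> last as = as ! k"
  by (cases as rule: rev_cases) (auto simp: arrow_path_def)

lemma src_path_nth: "arrow_path k as \<Longrightarrow> j < k \<Longrightarrow> src (as ! j) = vertex j as"
  by (simp add: path_vertex_def path_length)

lemma tgt_path_nth: "arrow_path k as \<Longrightarrow> j < k \<Longrightarrow> tgt (as ! j) = vertex (Suc j) as"
  by (cases "Suc j = k") (auto simp: path_vertex_def path_length path_tgt path_last)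

lemma vertex_Ob: "arrow_path k as \<Longrightarrow> 0 < k \<Longrightarrow> vertex j as \<in> Ob"
  by (cases k) (auto simp: path_vertex_def path_length path_last intro!: src_Ob tgt_Ob path_Ar)

text \<open>Prescribing the sequence \<open>v\<close> of visited objects yields composability and
  the values of \<open>vertex\<close> at once; it is applied to faces, to degeneracies and to the
  arrows of a chain.\<close>

lemma path_intro:
  assumes "length as = k" "\<And>j. j < k \<Longrightarrow> as ! j \<in> Ar" "\<And>j. j < k \<Longrightarrow> src (as ! j) = v j"
    "\<And>j. j < k \<Longrightarrow> tgt (as ! j) = v (Suc j)"
  shows "arrow_path k as" "j \<le> k \<Longrightarrow> 0 < k \<Longrightarrow> vertex j as = v j"
  using assms by (auto simp: arrow_path_def path_vertex_def last_conv_nth)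

text \<open>The \<open>i\<close>-th face omits the \<open>i\<close>-th vertex, so all later vertices
  move down by one.\<close>

lemma face_path_facts:
  assumes as: "arrow_path (Suc k) as" and k: "0 < k" and i: "i \<le> Suc k"
  shows path_face: "arrow_path k (face i as)"
    and vertex_face: "j \<le> k \<Longrightarrow> vertex j (face i as) = (if j < i then vertex j as else vertex (Suc j) as)"
proof -
  have *: "length (face i as) = k" "\<And>j. j < k \<Longrightarrow> face i as ! j \<in> Ar"
    "\<And>j. j < k \<Longrightarrow> src (face i as ! j) = (if j < i then vertex j as else vertex (Suc j) as)"
    "\<And>j. j < k \<Longrightarrow> tgt (face i as ! j) = (if Suc j < i then vertex (Suc j) as else vertex (Suc (Suc j)) as)"
    using path_length[OF as]
    by (auto simp: nth_face_path path_Ar[OF as] comp_Ar src_comp tgt_comp path_tgt[OF as]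
        src_path_nth[OF as] tgt_path_nth[OF as])
  show "arrow_path k (face i as)" by (rule path_intro(1)[OF * ])
  show "vertex j (face i as) = (if j < i then vertex j as else vertex (Suc j) as)" if "j \<le> k"
    by (rule path_intro(2)[OF * that k])
qed

text \<open>The \<open>i\<close>-th degeneracy stays at the \<open>i\<close>-th vertex for one more
  step, so that vertex occurs twice.\<close>

lemma degen_path_facts:
  assumes as: "arrow_path k as" and k: "0 < k" and i: "i \<le> k"
  shows path_degen: "arrow_path (Suc k) (degen i as)"
    and vertex_degen: "j \<le> Suc k \<Longrightarrow> vertex j (degen i as) = (if j \<le> i then vertex j as else vertex (j - 1) as)"
proof -
  have "Suc (j - Suc 0) = j" if "\<not> j < i" "j \<noteq> i" for j using that by auto
  then have *: "length (degen i as) = Suc k" "\<And>j. j < Suc k \<Longrightarrow> degen i as ! j \<in> Ar"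
    "\<And>j. j < Suc k \<Longrightarrow> src (degen i as ! j) = (if j \<le> i then vertex j as else vertex (j - 1) as)"
    "\<And>j. j < Suc k \<Longrightarrow> tgt (degen i as ! j) = (if Suc j \<le> i then vertex (Suc j) as else vertex (Suc j - 1) as)"
    using path_length[OF as] i
    by (auto simp: nth_degen_path path_Ar[OF as] unit_Ar src_unit tgt_unit vertex_Ob[OF as k]
        src_path_nth[OF as] tgt_path_nth[OF as])
  show "arrow_path (Suc k) (degen i as)" by (rule path_intro(1)[OF *])
  show "vertex j (degen i as) = (if j \<le> i then vertex j as else vertex (j - 1) as)" if "j \<le> Suc k"
    by (rule path_intro(2)[OF * that zero_less_Suc])
qed

text \<open>Most entries agree by index arithmetic. Associativity enters for
  \<open>j = Suc i\<close>, where the two omitted vertices are adjacent and three consecutive arrows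
  are composed into one.\<close>

lemma face_face:
  assumes as: "arrow_path (k + 2) as" and ij: "i < j" "j \<le> k + 2"
  shows "face i (face j as) = face (j - 1) (face i as)"
proof (rule nth_equalityI)
  fix l assume "l < length (face i (face j as))"
  then have l: "Suc (Suc l) < k + 2" using path_length[OF as] by simp
  have "cmp (cmp (as ! l) (as ! Suc l)) (as ! Suc (Suc l)) = cmp (as ! l) (cmp (as ! Suc l) (as ! Suc (Suc l)))"
    using l as by (intro comp_assoc) (auto simp: path_Ar path_tgt)
  then show "face i (face j as) ! l = face (j - 1) (face i as) ! l"
    using l ij path_length[OF as] by (auto simp: nth_face_path)
qed simp

text \<open>The inserted units agree because \<open>vertex_degen\<close> computes the objects at
  which they sit; the remaining entries are index arithmetic.\<close>

lemma degen_degen: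
  assumes as: "arrow_path k as" and k: "0 < k" and ij: "i \<le> j" "j \<le> k"
  shows "degen i (degen j as) = degen (Suc j) (degen i as)"
proof (rule nth_equalityI)
  fix l assume "l < length (degen i (degen j as))"
  then have l: "l < Suc (Suc k)" using path_length[OF as] by simp
  show "degen i (degen j as) ! l = degen (Suc j) (degen i as) ! l"
    using l ij path_length[OF as] vertex_degen[OF as k, of j i] vertex_degen[OF as k, of i "Suc j"]
    by (auto simp: nth_degen_path)
qed simp

lemma face_degen_less:
  assumes as: "arrow_path (Suc k) as" and k: "0 < k" and ij: "i < j" "j \<le> Suc k"
  shows "face i (degen j as) = degen (j - 1) (face i as)"
proof (rule nth_equalityI)
  fix l assume "l < length (face i (degen j as))"
  then have l: "l < Suc k" using path_length[OF as] by simp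
  show "face i (degen j as) ! l = degen (j - 1) (face i as) ! l"
    using l ij k path_length[OF as] vertex_face[OF as k, of i "j - 1"]
    by (auto simp: nth_degen_path nth_face_path)
qed (use path_length[OF as] in simp)

lemma face_degen_greater:
  assumes as: "arrow_path (Suc k) as" and k: "0 < k" and ij: "Suc j < i" "i \<le> Suc (Suc k)"
  shows "face i (degen j as) = degen j (face (i - 1) as)"
proof (rule nth_equalityI)
  fix l assume "l < length (face i (degen j as))"
  then have l: "l < Suc k" using path_length[OF as] by simp
  show "face i (degen j as) ! l = degen j (face (i - 1) as) ! l"
    using l ij k path_length[OF as] vertex_face[OF as k, of "i - 1" j]
    by (auto simp: nth_degen_path nth_face_path)
qed (use path_length[OF as] in simp)

text \<open>The inserted unit is absorbed by a neighbouring arrow through a unit law or, at an end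
  of the path, dropped by an outer face.\<close>

lemma face_degen_same:
  assumes as: "arrow_path k as" and k: "0 < k" and j: "j \<le> k" "i = j \<or> i = Suc j"
  shows "face i (degen j as) = as"
proof (rule nth_equalityI)
  fix l assume "l < length (face i (degen j as))"
  then have l: "l < k" using path_length[OF as] by simp
  have "cmp (unit (vertex l as)) (as ! l) = as ! l" "cmp (as ! l) (unit (vertex (Suc l) as)) = as ! l"
    using comp_unit_left[OF path_Ar[OF as l]] comp_unit_right[OF path_Ar[OF as l]]
    by (simp_all add: src_path_nth[OF as l] tgt_path_nth[OF as l])
  then show "face i (degen j as) ! l = as ! l"
    using l j k path_length[OF as] by (auto simp: nth_degen_path nth_face_path)
qed simp

section \<open>Simplicial identities of the nerve\<close>

abbreviation "N \<equiv> nerve_set Ob Ar src tgt"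
abbreviation "d \<equiv> nerve_face src tgt cmp"
abbreviation "s \<equiv> nerve_degen src tgt unit"

lemma nerve_SucE:
  assumes "x \<in> N (Suc k)"
  obtains as where "x = Path as" "arrow_path (Suc k) as"
  using assms by (auto simp: nerve_set_Suc)

lemma Path_in_nerve: "arrow_path (Suc k) as \<Longrightarrow> Path as \<in> N (Suc k)"
  by (simp add: nerve_set_Suc)

text \<open>Omitting one end of an edge leaves the opposite end, hence the index
  \<open>1 - i\<close>.\<close>

lemma face_1: "arrow_path (Suc 0) as \<Longrightarrow> i \<le> 1 \<Longrightarrow> d (Suc 0) i (Path as) = Vertex (vertex (1 - i) as)"
  by (simp add: nerve_face_1 src_path_nth tgt_path_nth)

lemma face_Path: "arrow_path (Suc (Suc k)) as \<Longrightarrow> i \<le> Suc (Suc k) \<Longrightarrow> d (Suc (Suc k)) i (Path as) = Path (face i as)"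
  by (simp add: nerve_face_Path path_length)

lemma degen_0: "s 0 i (Vertex v) = Path [unit v]"
  by (simp add: nerve_degen_def)

lemma degen_Path: "arrow_path (Suc k) as \<Longrightarrow> i \<le> Suc k \<Longrightarrow> s (Suc k) i (Path as) = Path (degen i as)"
  by (simp add: nerve_degen_Path path_length)

lemma arrow_path_unit: "v \<in> Ob \<Longrightarrow> arrow_path (Suc 0) [unit v]"
  by (simp add: arrow_path_def unit_Ar)

lemma vertex_unit: "v \<in> Ob \<Longrightarrow> vertex i [unit v] = v"
  by (simp add: path_vertex_def src_unit tgt_unit)

text \<open>The path identities apply as long as all simplices involved are paths; the case splits
  on the level single out those identities in which a \<open>Vertex\<close> occurs.\<close>

theorem simplicial_set_nerve: "simplicial_set N d s"
  unfolding simplicial_set_def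
proof (intro conjI allI ballI impI)
  fix k i assume i: "i \<le> Suc k"
  show "d (Suc k) i \<in> N (Suc k) \<rightarrow> N k"
  proof
    fix x assume "x \<in> N (Suc k)"
    then obtain as where as: "x = Path as" "arrow_path (Suc k) as" by (rule nerve_SucE)
    show "d (Suc k) i x \<in> N k"
    proof (cases k)
      case 0
      then show ?thesis using as i vertex_Ob[of 1 as] by (simp add: face_1 nerve_set_0)
    next
      case (Suc m)
      then show ?thesis using as i path_face[of k as i] by (simp add: face_Path Path_in_nerve)
    qed
  qed
next
  fix k i assume i: "i \<le> (k::nat)"
  show "s k i \<in> N k \<rightarrow> N (Suc k)"
  proof
    fix x assume x: "x \<in> N k"
    show "s k i x \<in> N (Suc k)"
    proof (cases k)
      case 0
      then show ?thesis using x by (auto simp: nerve_set_0 degen_0 intro!: Path_in_nerve arrow_path_unit)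
    next
      case (Suc m)
      with x obtain as where as: "x = Path as" "arrow_path k as" using nerve_SucE by metis
      then show ?thesis using Suc i path_degen[of k as i] by (simp add: degen_Path Path_in_nerve)
    qed
  qed
next
  fix k i j :: nat and x
  assume "x \<in> N (k + 2)" and "i < j \<and> j \<le> k + 2"
  note ij = conjunct1[OF this(2)] conjunct2[OF this(2)]
  from \<open>x \<in> N (k + 2)\<close> obtain as where as: "x = Path as" "arrow_path (Suc (Suc k)) as" using nerve_SucE[of x "Suc k"] by auto
  have fs: "arrow_path (Suc k) (face j as)" "arrow_path (Suc k) (face i as)"
    using path_face[OF as(2)] ij by auto
  have ds: "d (k + 2) j x = Path (face j as)" "d (k + 2) i x = Path (face i as)"
    using as ij by (simp_all add: face_Path)
  show "d (k + 1) i (d (k + 2) j x) = d (k + 1) (j - 1) (d (k + 2) i x)"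
  proof (cases k)
    case 0
    have "vertex (1 - i) (face j as) = vertex (1 - (j - 1)) (face i as)"
      using ij 0 as(2) vertex_face[of 1 as j "1 - i"] vertex_face[of 1 as i "1 - (j - 1)"]
      by (auto simp: less_Suc_eq le_Suc_eq)
    moreover have "i \<le> 1" "j - 1 \<le> 1" using ij 0 by auto
    ultimately show ?thesis
      using face_1[OF fs(1)[unfolded 0], of i] face_1[OF fs(2)[unfolded 0], of "j - 1"]
      unfolding ds by (simp add: 0)
  next
    case (Suc m)
    then show ?thesis using fs ij as(2) unfolding ds by (simp add: face_Path face_face[of k])
  qed
next
  fix k i j :: nat and x
  assume x: "x \<in> N k" and ij: "i \<le> j \<and> j \<le> k"
  note ij = conjunct1[OF ij] conjunct2[OF ij]
  show "s (k + 1) i (s k j x) = s (k + 1) (j + 1) (s k i x)"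
  proof (cases k)
    case 0
    then obtain v where v: "x = Vertex v" "v \<in> Ob" using x by (auto simp: nerve_set_0)
    have "degen 0 [unit v] = degen (Suc 0) [unit v]"
      using v by (simp add: degen_path_def vertex_unit)
    then show ?thesis using ij v arrow_path_unit[OF v(2)] by (simp add: 0 degen_0 degen_Path)
  next
    case (Suc m)
    then obtain as where as: "x = Path as" "arrow_path (Suc m) as" using x nerve_SucE by metis
    then show ?thesis using ij Suc path_degen[OF as(2), of i] path_degen[OF as(2), of j]
        degen_degen[OF as(2), of i j] by (simp add: degen_Path)
  qed
next
  fix k i j :: nat and x
  assume x: "x \<in> N k" and ij: "i < j \<and> j \<le> k"
  note ij = conjunct1[OF ij] conjunct2[OF ij]
  from ij obtain m where m: "k = Suc m" by (cases k) auto
  then obtain as where as: "x = Path as" "arrow_path (Suc m) as" using x nerve_SucE by metis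
  have l: "d (k + 1) i (s k j x) = Path (face i (degen j as))"
    using ij m as path_degen[OF as(2), of j] by (simp add: degen_Path face_Path)
  show "d (k + 1) i (s k j x) = s (k - 1) (j - 1) (d k i x)"
  proof (cases m)
    case 0
    then have "i = 0" "j = 1" using ij m by auto
    moreover have "face 0 (degen 1 as) = [unit (vertex 1 as)]"
      using path_length[OF as(2)] 0 by (intro nth_equalityI) (auto simp: nth_face_path nth_degen_path)
    ultimately show ?thesis using l as by (simp add: 0 m face_1 degen_0)
  next
    case (Suc n)
    then show ?thesis
      using l as ij m path_face[of m as i] face_degen_less[of m as i j] by (simp add: face_Path degen_Path)
  qed
next
  fix k j :: nat and x
  assume x: "x \<in> N k" and j: "j \<le> k"
  have "d (k + 1) i (s k j x) = x" if i: "i = j \<or> i = Suc j" for i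
  proof (cases k)
    case 0
    then obtain v where v: "x = Vertex v" "v \<in> Ob" using x by (auto simp: nerve_set_0)
    then show ?thesis using i j arrow_path_unit[OF v(2)] by (auto simp: 0 degen_0 face_1 vertex_unit)
  next
    case (Suc m)
    then obtain as where as: "x = Path as" "arrow_path (Suc m) as" using x nerve_SucE by metis
    then show ?thesis using i j Suc path_degen[OF as(2), of j] face_degen_same[OF as(2), of j i]
      by (auto simp: degen_Path face_Path)
  qed
  then show "d (k + 1) j (s k j x) = x" "d (k + 1) (j + 1) (s k j x) = x" by simp_all
next
  fix k i j :: nat and x
  assume x: "x \<in> N k" and ij: "j + 1 < i \<and> i \<le> k + 1"
  note ij = conjunct1[OF ij] conjunct2[OF ij]
  from ij obtain m where m: "k = Suc m" by (cases k) auto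
  then obtain as where as: "x = Path as" "arrow_path (Suc m) as" using x nerve_SucE by metis
  have l: "d (k + 1) i (s k j x) = Path (face i (degen j as))"
    using ij m as path_degen[OF as(2), of j] by (simp add: degen_Path face_Path)
  show "d (k + 1) i (s k j x) = s (k - 1) j (d k (i - 1) x)"
  proof (cases m)
    case 0
    then have "i = 2" "j = 0" using ij m by auto
    moreover have "face 2 (degen 0 as) = [unit (vertex 0 as)]"
      using path_length[OF as(2)] 0 by (intro nth_equalityI) (auto simp: nth_face_path nth_degen_path)
    ultimately show ?thesis using l as by (simp add: 0 m face_1 degen_0)
  next
    case (Suc n)
    then show ?thesis
      using l as ij m path_face[of m as "i - 1"] face_degen_greater[of m as j i]
      by (simp add: face_Path degen_Path)
  qed
qed

end

text \<open>Both sides of an identity are pushed along \<open>\<Phi>\<close> to \<open>N\<close>,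
  where they agree, and injectivity of \<open>\<Phi>\<close> brings the equality back.\<close>

lemma simplicial_set_transfer:
  assumes N: "simplicial_set N d' s'"
    and bij: "\<And>k. bij_betw (\<Phi> k) (S k) (N k)"
    and d: "\<And>k i. i \<le> Suc k \<Longrightarrow> d (Suc k) i \<in> S (Suc k) \<rightarrow> S k"
    and s: "\<And>k i. i \<le> k \<Longrightarrow> s k i \<in> S k \<rightarrow> S (Suc k)"
    and \<Phi>d: "\<And>k i x. i \<le> Suc k \<Longrightarrow> x \<in> S (Suc k) \<Longrightarrow> \<Phi> k (d (Suc k) i x) = d' (Suc k) i (\<Phi> (Suc k) x)"
    and \<Phi>s: "\<And>k i x. i \<le> k \<Longrightarrow> x \<in> S k \<Longrightarrow> \<Phi> (Suc k) (s k i x) = s' k i (\<Phi> k x)"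
  shows "simplicial_set S d s"
proof -
  have eqI: "u = v" if "u \<in> S k" "v \<in> S k" "\<Phi> k u = \<Phi> k v" for k u v
    using bij[of k] that by (auto simp: bij_betw_def inj_on_def)
  have mem: "\<Phi> k x \<in> N k" if "x \<in> S k" for k x
    using bij[of k] that by (auto simp: bij_betw_def)
  have d_mem: "d (Suc k) i x \<in> S k" if "i \<le> Suc k" "x \<in> S (Suc k)" for k i x
    using d that by blast
  have s_mem: "s k i x \<in> S (Suc k)" if "i \<le> k" "x \<in> S k" for k i x
    using s that by blast
  note [simp] = \<Phi>d \<Phi>s d_mem s_mem
  show ?thesis
    unfolding simplicial_set_def
  proof (intro conjI allI ballI impI)
    fix k i j x assume x: "x \<in> S (k + 2)" and ij: "i < j \<and> j \<le> k + 2"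
    note ij = conjunct1[OF ij] conjunct2[OF ij]
    have "d' (Suc k) i (d' (Suc (Suc k)) j (\<Phi> (Suc (Suc k)) x)) =
        d' (Suc k) (j - 1) (d' (Suc (Suc k)) i (\<Phi> (Suc (Suc k)) x))"
      using N mem[OF x] ij unfolding simplicial_set_def by simp
    then show "d (k + 1) i (d (k + 2) j x) = d (k + 1) (j - 1) (d (k + 2) i x)"
      using x ij by (intro eqI[of _ k]) auto
  next
    fix k i j x assume x: "x \<in> S k" and ij: "i \<le> j \<and> j \<le> k"
    note ij = conjunct1[OF ij] conjunct2[OF ij]
    have "s' (Suc k) i (s' k j (\<Phi> k x)) = s' (Suc k) (j + 1) (s' k i (\<Phi> k x))"
      using N mem[OF x] ij unfolding simplicial_set_def by simp
    then show "s (k + 1) i (s k j x) = s (k + 1) (j + 1) (s k i x)"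
      using x ij by (intro eqI[of _ "Suc (Suc k)"]) auto
  next
    fix k i j x assume x: "x \<in> S k" and ij: "i < j \<and> j \<le> k"
    note ij = conjunct1[OF ij] conjunct2[OF ij]
    from ij obtain m where m: "k = Suc m" by (cases k) auto
    have "d' (Suc k) i (s' k j (\<Phi> k x)) = s' (k - 1) (j - 1) (d' k i (\<Phi> k x))"
      using N mem[OF x] ij unfolding simplicial_set_def by simp
    then show "d (k + 1) i (s k j x) = s (k - 1) (j - 1) (d k i x)"
      using x ij m by (intro eqI[of _ k]) auto
  next
    fix k j x assume x: "x \<in> S k" and j: "j \<le> k"
    have "d' (Suc k) j (s' k j (\<Phi> k x)) = \<Phi> k x" "d' (Suc k) (Suc j) (s' k j (\<Phi> k x)) = \<Phi> k x"
      using N mem[OF x] j unfolding simplicial_set_def by simp_all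
    then show "d (k + 1) j (s k j x) = x" "d (k + 1) (j + 1) (s k j x) = x"
      using x j by (intro eqI[of _ k]; auto)+
  next
    fix k i j x assume x: "x \<in> S k" and ij: "j + 1 < i \<and> i \<le> k + 1"
    note ij = conjunct1[OF ij] conjunct2[OF ij]
    from ij obtain m where m: "k = Suc m" by (cases k) auto
    have "d' (Suc k) i (s' k j (\<Phi> k x)) = s' (k - 1) j (d' k (i - 1) (\<Phi> k x))"
      using N mem[OF x] ij unfolding simplicial_set_def by simp
    then show "d (k + 1) i (s k j x) = s (k - 1) j (d k (i - 1) x)"
      using x ij m by (intro eqI[of _ k]) auto
  qed (use d s in auto)
qed

section \<open>The resolution as a nerve, on bare sets\<close>

lemma plot_map_id:
  assumes "diffeological_space X" "p \<in> plots X"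
  shows "plot_map p p (\<lambda>x\<in>mcarrier (fst p). x)"
proof -
  obtain U q where p: "p = (U, q)" by (cases p)
  note U = plotsD[OF assms(1) assms(2)[unfolded p]]
  have "compose (mcarrier U) q (\<lambda>x\<in>mcarrier U. x) = q"
    using U(2) by (auto simp: compose_Id PiE_def)
  then show ?thesis using cart_hom_id[OF U(1)] by (simp add: plot_map_def p)
qed

lemma plot_map_compose:
  assumes X: "diffeological_space X" "p2 \<in> plots X" "p1 \<in> plots X" "p0 \<in> plots X"
    and f: "plot_map p2 p1 f" and g: "plot_map p1 p0 g"
  shows "plot_map p2 p0 (compose (mcarrier (fst p2)) g f)"
proof -
  have U: "cartesian_space (fst p2)" "cartesian_space (fst p1)" "cartesian_space (fst p0)"
    using plotsD(1)[OF X(1)] X(2-4) by (metis prod.collapse)+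
  have f': "f \<in> cart_hom (fst p2) (fst p1)" "f \<in> mcarrier (fst p2) \<rightarrow> mcarrier (fst p1)"
    using f by (auto simp: plot_map_def cart_hom_def)
  have "compose (mcarrier (fst p2)) (snd p0) (compose (mcarrier (fst p2)) g f) =
      compose (mcarrier (fst p2)) (compose (mcarrier (fst p1)) (snd p0) g) f"
    by (rule compose_assoc[OF f'(2)])
  then show ?thesis using f g cart_hom_compose[OF U f'(1)] by (simp add: plot_map_def)
qed

lemma plot_chains_iff:
  "(ps, fs) \<in> plot_chains X k \<longleftrightarrow> length ps = Suc k \<and> length fs = k \<and>
     (\<forall>j\<le>k. ps ! j \<in> plots X) \<and> (\<forall>j<k. plot_map (ps ! j) (ps ! Suc j) (fs ! j))"
proof -
  have "set ps \<subseteq> plots X \<longleftrightarrow> (\<forall>j\<le>k. ps ! j \<in> plots X)" if "length ps = Suc k"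
    using that unfolding subset_code(1) all_set_conv_all_nth by (simp add: less_Suc_eq_le)
  then show ?thesis unfolding plot_chains_def by auto
qed

text \<open>The three cases of \<open>chain_face\<close> become one entrywise description, with the
  same index pattern as \<open>nth_face_path\<close>; the plot at \<open>i\<close> disappears and
  its two adjacent maps merge.\<close>

lemma chain_face_nth:
  assumes "length ps = Suc k" "length fs = k" "0 < k" "i \<le> k" "chain_face k i (ps, fs) = (ps', fs')"
  shows "length ps' = k" "length fs' = k - 1"
    "\<And>j. j < k \<Longrightarrow> ps' ! j = (if j < i then ps ! j else ps ! Suc j)"
    "\<And>j. Suc j < k \<Longrightarrow> fs' ! j = (if Suc j < i then fs ! j
       else if Suc j = i then compose (mcarrier (fst (ps ! j))) (fs ! Suc j) (fs ! j) else fs ! Suc j)"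
proof -
  consider "i = 0" | "i = k" "i \<noteq> 0" | "0 < i" "i < k" using assms(4) by linarith
  then have "length ps' = k \<and> length fs' = k - 1 \<and>
    (\<forall>j<k. ps' ! j = (if j < i then ps ! j else ps ! Suc j)) \<and>
    (\<forall>j. Suc j < k \<longrightarrow> fs' ! j = (if Suc j < i then fs ! j
       else if Suc j = i then compose (mcarrier (fst (ps ! j))) (fs ! Suc j) (fs ! j) else fs ! Suc j))"
  proof cases
    case 1
    then have "ps' = tl ps" "fs' = tl fs" using assms(5) by (auto simp: chain_face_def)
    then show ?thesis using assms 1 by (auto simp: nth_tl)
  next
    case 2
    then have "ps' = butlast ps" "fs' = butlast fs" using assms(5) by (auto simp: chain_face_def)
    then show ?thesis using assms 2 by (auto simp: nth_butlast)
  next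
    case 3
    then have *: "ps' = take i ps @ drop (i + 1) ps"
      "fs' = take (i - 1) fs @ [compose (mcarrier (fst (ps ! (i - 1)))) (fs ! i) (fs ! (i - 1))] @ drop (i + 1) fs"
      using assms(5) by (auto simp: chain_face_def)
    show ?thesis
    proof (intro conjI allI impI)
      show "length ps' = k" "length fs' = k - 1" using assms(1,2) 3 by (auto simp: *)
      show "ps' ! j = (if j < i then ps ! j else ps ! Suc j)" if "j < k" for j
        using assms(1) 3 that by (auto simp: * nth_append)
      show "fs' ! j = (if Suc j < i then fs ! j
         else if Suc j = i then compose (mcarrier (fst (ps ! j))) (fs ! Suc j) (fs ! j) else fs ! Suc j)"
        if "Suc j < k" for j
        using assms(2) 3 that
        by (auto simp: * nth_append nth_Cons intro!: arg_cong[where f = "(!) fs"] split: nat.split)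
    qed
  qed
  then show "length ps' = k" "length fs' = k - 1"
    "\<And>j. j < k \<Longrightarrow> ps' ! j = (if j < i then ps ! j else ps ! Suc j)"
    "\<And>j. Suc j < k \<Longrightarrow> fs' ! j = (if Suc j < i then fs ! j
       else if Suc j = i then compose (mcarrier (fst (ps ! j))) (fs ! Suc j) (fs ! j) else fs ! Suc j)"
    by blast+
qed

lemma chain_degen_nth:
  assumes "length ps = Suc k" "length fs = k" "i \<le> k" "chain_degen i (ps, fs) = (ps', fs')"
  shows "length ps' = Suc (Suc k)" "length fs' = Suc k"
    "\<And>j. j \<le> Suc k \<Longrightarrow> ps' ! j = (if j \<le> i then ps ! j else ps ! (j - 1))"
    "\<And>j. j \<le> k \<Longrightarrow> fs' ! j = (if j < i then fs ! j
       else if j = i then (\<lambda>x\<in>mcarrier (fst (ps ! i)). x) else fs ! (j - 1))"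
proof -
  have *: "ps' = take (i + 1) ps @ drop i ps"
    "fs' = take i fs @ [\<lambda>x\<in>mcarrier (fst (ps ! i)). x] @ drop i fs"
    using assms(4) by (auto simp: chain_degen_def)
  show "length ps' = Suc (Suc k)" "length fs' = Suc k" using assms(1-3) by (auto simp: *)
  show "ps' ! j = (if j \<le> i then ps ! j else ps ! (j - 1))" if "j \<le> Suc k" for j
    using assms(1,3) that
    by (auto simp: * nth_append min_def intro!: arg_cong[where f = "(!) ps"])
  show "fs' ! j = (if j < i then fs ! j
       else if j = i then (\<lambda>x\<in>mcarrier (fst (ps ! i)). x) else fs ! (j - 1))" if "j \<le> k" for j
    using assms(2,3) that
    by (auto simp: * nth_append nth_Cons min_def intro!: arg_cong[where f = "(!) fs"] split: nat.split)
qed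

lemma plot_chains_face:
  assumes X: "diffeological_space X" and c: "c \<in> plot_chains X (Suc k)" and i: "i \<le> Suc k"
  shows "chain_face (Suc k) i c \<in> plot_chains X k"
proof -
  obtain ps fs where ps: "c = (ps, fs)" by (cases c)
  obtain ps' fs' where ps': "chain_face (Suc k) i (ps, fs) = (ps', fs')" by fastforce
  note c = c[unfolded ps plot_chains_iff]
  have len: "length ps = Suc (Suc k)" "length fs = Suc k" using c by auto
  note nth = chain_face_nth[OF len zero_less_Suc i ps']
  have "plot_map (ps' ! j) (ps' ! Suc j) (fs' ! j)" if j: "j < k" for j
  proof (cases "Suc j = i")
    case True
    then show ?thesis using nth(3)[of j] nth(3)[of "Suc j"] nth(4)[of j] j c
      by (auto intro!: plot_map_compose[OF X(1), of _ "ps ! Suc j"])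
  next
    case False
    then show ?thesis using nth(3)[of j] nth(3)[of "Suc j"] nth(4)[of j] j c by auto
  qed
  then show ?thesis using nth(1-3) c by (auto simp: ps ps' plot_chains_iff)
qed

lemma plot_chains_degen:
  assumes X: "diffeological_space X" and c: "c \<in> plot_chains X k" and i: "i \<le> k"
  shows "chain_degen i c \<in> plot_chains X (Suc k)"
proof -
  obtain ps fs where ps: "c = (ps, fs)" by (cases c)
  obtain ps' fs' where ps': "chain_degen i (ps, fs) = (ps', fs')" by fastforce
  note c = c[unfolded ps plot_chains_iff]
  have len: "length ps = Suc k" "length fs = k" using c by auto
  note nth = chain_degen_nth[OF len i ps']
  have "plot_map (ps' ! j) (ps' ! Suc j) (fs' ! j)" if j: "j < Suc k" for j
  proof -
    consider "j < i" | "j = i" | "i < j" by linarith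
    then show ?thesis
    proof cases
      case 3
      then obtain l where l: "j = Suc l" by (cases j) auto
      then have "plot_map (ps ! l) (ps ! Suc l) (fs ! l)" using c j by auto
      then show ?thesis using 3 l nth(3)[of j] nth(3)[of "Suc j"] nth(4)[of j] j by simp
    qed (use nth(3)[of j] nth(3)[of "Suc j"] nth(4)[of j] j c plot_map_id[OF X] i in auto)
  qed
  moreover have "ps' ! j \<in> plots X" if "j \<le> Suc k" for j
    using nth(3)[OF that] c i that by auto
  ultimately show ?thesis using nth(1,2) by (simp add: ps ps' plot_chains_iff)
qed

text \<open>
  Points and smooth maps \<open>V \<rightarrow> U\<close> are both covariant functors of the cartesian space \<open>U\<close>; this
  functoriality is all that the combinatorics of the resolution needs.
\<close>

locale plot_action =
  fixes X :: "'x diffsp" and Y :: "mfd \<Rightarrow> 'y set" and act :: "(rvec \<Rightarrow> rvec) \<Rightarrow> 'y \<Rightarrow> 'y"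
  assumes X: "diffeological_space X"
    and act_mem: "\<And>U V f y. cartesian_space U \<Longrightarrow> cartesian_space V \<Longrightarrow> f \<in> cart_hom U V \<Longrightarrow> y \<in> Y U \<Longrightarrow>
      act f y \<in> Y V"
    and act_compose: "\<And>U V W f g y. cartesian_space U \<Longrightarrow> cartesian_space V \<Longrightarrow> cartesian_space W \<Longrightarrow>
      f \<in> cart_hom U V \<Longrightarrow> g \<in> cart_hom V W \<Longrightarrow> y \<in> Y U \<Longrightarrow> act (compose (mcarrier U) g f) y = act g (act f y)"
    and act_id: "\<And>U y. cartesian_space U \<Longrightarrow> y \<in> Y U \<Longrightarrow> act (\<lambda>x\<in>mcarrier U. x) y = y"
begin

section \<open>The category of one-simplices of the resolution\<close>

definition Q :: "nat \<Rightarrow> ('y \<times> 'x plot_chain) set" where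
  "Q k = {(y, c). c \<in> plot_chains X k \<and> y \<in> Y (chain_dom c)}"

lemma Q_iff: "(y, (ps, fs)) \<in> Q k \<longleftrightarrow> y \<in> Y (fst (ps ! 0)) \<and> length ps = Suc k \<and> length fs = k \<and>
     (\<forall>j\<le>k. ps ! j \<in> plots X) \<and> (\<forall>j<k. plot_map (ps ! j) (ps ! Suc j) (fs ! j))"
  unfolding Q_def chain_dom_def using plot_chains_iff[of ps fs X k] by (cases ps) auto

lemma plot_cartesian: "p \<in> plots X \<Longrightarrow> cartesian_space (fst p)"
  using plotsD(1)[OF X] by (metis prod.collapse)

lemma plot_map_act_mem:
  "plot_map p p' f \<Longrightarrow> p \<in> plots X \<Longrightarrow> p' \<in> plots X \<Longrightarrow> y \<in> Y (fst p) \<Longrightarrow> act f y \<in> Y (fst p')"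
  using act_mem plot_cartesian unfolding plot_map_def by blast

lemma plot_map_act_compose:
  "plot_map p p' f \<Longrightarrow> plot_map p' p'' g \<Longrightarrow> p \<in> plots X \<Longrightarrow> p' \<in> plots X \<Longrightarrow> p'' \<in> plots X \<Longrightarrow>
    y \<in> Y (fst p) \<Longrightarrow> act (compose (mcarrier (fst p)) g f) y = act g (act f y)"
  using act_compose plot_cartesian unfolding plot_map_def by blast

lemma Q_0E:
  assumes "x \<in> Q 0"
  obtains y p where "x = (y, ([p], []))" "p \<in> plots X" "y \<in> Y (fst p)"
proof -
  obtain y ps fs where x: "x = (y, (ps, fs))" by (metis prod.collapse)
  note q = assms[unfolded x Q_iff]
  then obtain p where "ps = [p]" by (auto simp: length_Suc_conv)
  then show thesis using that[of y p] q x by auto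
qed

lemma Q_1E:
  assumes "x \<in> Q 1"
  obtains y p p' f where "x = (y, ([p, p'], [f]))" "p \<in> plots X" "p' \<in> plots X" "y \<in> Y (fst p)" "plot_map p p' f"
proof -
  obtain y ps fs where x: "x = (y, (ps, fs))" by (metis prod.collapse)
  note q = assms[unfolded x Q_iff]
  then obtain p p' f where "ps = [p, p']" "fs = [f]" by (auto simp: length_Suc_conv)
  moreover have "ps ! 0 \<in> plots X" "ps ! 1 \<in> plots X" "plot_map (ps ! 0) (ps ! 1) (fs ! 0)" using q by auto
  ultimately show thesis using that[of y p p' f] q x by auto
qed

lemma Q_0_iff: "(y, ([p], [])) \<in> Q 0 \<longleftrightarrow> p \<in> plots X \<and> y \<in> Y (fst p)"
  by (auto simp: Q_iff)

lemma Q_1_iff: "(y, ([p, p'], [f])) \<in> Q 1 \<longleftrightarrow>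
    p \<in> plots X \<and> p' \<in> plots X \<and> y \<in> Y (fst p) \<and> plot_map p p' f"
  by (auto simp: Q_iff less_Suc_eq_le le_Suc_eq)

lemmas Q_simps = Q_src_def Q_tgt_def Q_unit_def Q_comp_def

text \<open>Composability forces the middle plot to agree and the second element to be the image of
  the first, so a composite may keep the first element alone. The laws \<open>act_id\<close> and
  \<open>act_compose\<close> are what makes the targets of units and composites correct.\<close>

lemma small_category_Q: "small_category (Q 0) (Q 1) Q_src (Q_tgt act) Q_unit Q_comp"
  unfolding small_category_def
proof (intro conjI ballI impI)
  show "Q_src \<in> Q 1 \<rightarrow> Q 0" by (auto elim!: Q_1E simp: Q_src_def Q_0_iff simp del: One_nat_def)
  show "Q_tgt act \<in> Q 1 \<rightarrow> Q 0"
  proof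
    fix a assume "a \<in> Q 1"
    then show "Q_tgt act a \<in> Q 0"
      by (rule Q_1E) (simp add: Q_tgt_def Q_0_iff plot_map_act_mem)
  qed
  show "Q_unit \<in> Q 0 \<rightarrow> Q 1"
  proof
    fix x assume "x \<in> Q 0"
    then show "Q_unit x \<in> Q 1"
      by (rule Q_0E) (simp add: Q_unit_def Q_1_iff plot_map_id[OF X] del: One_nat_def)
  qed
next
  fix a b assume ab: "a \<in> Q 1" "b \<in> Q 1" "Q_tgt act a = Q_src b"
  obtain y p p' f where a: "a = (y, ([p, p'], [f]))" "p \<in> plots X" "p' \<in> plots X" "y \<in> Y (fst p)" "plot_map p p' f"
    using ab(1) by (rule Q_1E)
  obtain z q q' g where b: "b = (z, ([q, q'], [g]))" "q \<in> plots X" "q' \<in> plots X" "z \<in> Y (fst q)" "plot_map q q' g"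
    using ab(2) by (rule Q_1E)
  have "p' = q" "z = act f y" using ab(3) by (auto simp: a(1) b(1) Q_simps)
  then show "Q_comp a b \<in> Q 1" "Q_src (Q_comp a b) = Q_src a" "Q_tgt act (Q_comp a b) = Q_tgt act b"
    using a b plot_map_compose[OF X, of p q q' f g] plot_map_act_compose[of p q f q' g y]
    by (auto simp: Q_simps Q_1_iff simp del: One_nat_def)
next
  fix x assume "x \<in> Q 0"
  then obtain y p where "x = (y, ([p], []))" "p \<in> plots X" "y \<in> Y (fst p)" by (rule Q_0E)
  then show "Q_src (Q_unit x) = x" "Q_tgt act (Q_unit x) = x"
    by (simp_all add: Q_simps act_id[OF plot_cartesian])
next
  fix a assume "a \<in> Q 1"
  then obtain y p p' f where a: "a = (y, ([p, p'], [f]))" "p \<in> plots X" "p' \<in> plots X" "plot_map p p' f"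
    by (rule Q_1E)
  have "compose (mcarrier (fst p)) f (\<lambda>x\<in>mcarrier (fst p). x) = f"
    "compose (mcarrier (fst p)) (\<lambda>x\<in>mcarrier (fst p'). x) f = f"
    using a(4) compose_Id[of f "mcarrier (fst p)"] Id_compose[of f "mcarrier (fst p)" "mcarrier (fst p')"]
    by (auto simp: plot_map_def cart_hom_def PiE_def)
  then show "Q_comp (Q_unit (Q_src a)) a = a" "Q_comp a (Q_unit (Q_tgt act a)) = a"
    by (simp_all add: a(1) Q_simps)
next
  fix a b c assume abc: "a \<in> Q 1" "b \<in> Q 1" "c \<in> Q 1" "Q_tgt act a = Q_src b \<and> Q_tgt act b = Q_src c"
  obtain y p p' f where a: "a = (y, ([p, p'], [f]))" "plot_map p p' f"
    using abc(1) by (rule Q_1E)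
  obtain y' q q' g where b: "b = (y', ([q, q'], [g]))"
    using abc(2) by (rule Q_1E)
  obtain y'' r r' h where c: "c = (y'', ([r, r'], [h]))"
    using abc(3) by (rule Q_1E)
  have "p' = q" using abc(4) by (auto simp: a b Q_simps)
  then have "f \<in> mcarrier (fst p) \<rightarrow> mcarrier (fst q)" using a(2) by (auto simp: plot_map_def cart_hom_def)
  then show "Q_comp (Q_comp a b) c = Q_comp a (Q_comp b c)"
    using compose_assoc[of f "mcarrier (fst p)" "mcarrier (fst q)" h g] by (simp add: a b c Q_simps)
qed

sublocale small_cat "Q 0" "Q 1" Q_src "Q_tgt act" Q_unit Q_comp
  by unfold_locales (rule small_category_Q)

section \<open>The comparison bijection between the resolution and the nerve\<close>

primrec transport :: "(rvec \<Rightarrow> rvec) list \<Rightarrow> 'y \<Rightarrow> nat \<Rightarrow> 'y" where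
  "transport fs y 0 = y"
| "transport fs y (Suc j) = act (fs ! j) (transport fs y j)"

definition arrows :: "'y \<times> 'x plot_chain \<Rightarrow> ('y \<times> 'x plot_chain) list" where
  "arrows = (\<lambda>(y, (ps, fs)).
     map (\<lambda>j. (transport fs y j, ([ps ! j, ps ! Suc j], [fs ! j]))) [0..<length fs])"

definition \<Phi> :: "nat \<Rightarrow> 'y \<times> 'x plot_chain \<Rightarrow> ('y \<times> 'x plot_chain, 'y \<times> 'x plot_chain) nsimplex" where
  "\<Phi> k x = (if k = 0 then Vertex x else Path (arrows x))"

lemma transport_mem:
  assumes "(y, (ps, fs)) \<in> Q k" "j \<le> k"
  shows "transport fs y j \<in> Y (fst (ps ! j))"
  using assms(2)
proof (induction j)
  case (Suc j)
  then show ?case using assms(1) plot_map_act_mem[of "ps ! j" "ps ! Suc j" "fs ! j"] by (auto simp: Q_iff)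
qed (use assms(1) in \<open>auto simp: Q_iff\<close>)

lemma length_arrows: "length (arrows (y, (ps, fs))) = length fs"
  by (simp add: arrows_def)

lemma nth_arrows: "j < length fs \<Longrightarrow>
    arrows (y, (ps, fs)) ! j = (transport fs y j, ([ps ! j, ps ! Suc j], [fs ! j]))"
  by (simp add: arrows_def)

lemma arrow_path_arrows:
  assumes "(y, (ps, fs)) \<in> Q k"
  shows "arrow_path k (arrows (y, (ps, fs)))"
    "j \<le> k \<Longrightarrow> 0 < k \<Longrightarrow> vertex j (arrows (y, (ps, fs))) = (transport fs y j, ([ps ! j], []))"
proof -
  have len: "length fs = k" using assms by (simp add: Q_iff)
  have *: "length (arrows (y, (ps, fs))) = k"
    "\<And>j. j < k \<Longrightarrow> arrows (y, (ps, fs)) ! j \<in> Q 1"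
    "\<And>j. j < k \<Longrightarrow> Q_src (arrows (y, (ps, fs)) ! j) = (transport fs y j, ([ps ! j], []))"
    "\<And>j. j < k \<Longrightarrow> Q_tgt act (arrows (y, (ps, fs)) ! j) = (transport fs y (Suc j), ([ps ! Suc j], []))"
    using len assms transport_mem[OF assms]
    by (auto simp: length_arrows nth_arrows Q_1_iff Q_iff[of y ps fs] Q_src_def Q_tgt_def simp del: One_nat_def)
  show "arrow_path k (arrows (y, (ps, fs)))" by (rule path_intro(1)[OF *])
  show "j \<le> k \<Longrightarrow> 0 < k \<Longrightarrow> vertex j (arrows (y, (ps, fs))) = (transport fs y j, ([ps ! j], []))"
    by (rule path_intro(2)[OF *])
qed

text \<open>Reading off the vertices gives plots \<open>p j\<close> and elements \<open>z j\<close>.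
  Matching sources and targets makes the maps \<open>f j\<close> a chain through these plots and
  forces \<open>z j\<close> to be the transport of \<open>z 0\<close>, so the path comes from the
  simplex with element \<open>z 0\<close>.\<close>

lemma arrow_path_arrowsE:
  assumes as: "arrow_path k as" and k: "0 < k"
  obtains x where "x \<in> Q k" "as = arrows x"
proof -
  have "\<exists>z p. vertex j as = (z, ([p], [])) \<and> p \<in> plots X \<and> z \<in> Y (fst p)" for j
    using vertex_Ob[OF as k, of j] Q_0E by metis
  then obtain z p where v: "\<And>j. vertex j as = (z j, ([p j], []))" "\<And>j. p j \<in> plots X" "\<And>j. z j \<in> Y (fst (p j))"
    by metis
  have "\<exists>f. as ! j = (z j, ([p j, p (Suc j)], [f])) \<and> plot_map (p j) (p (Suc j)) f \<and> z (Suc j) = act f (z j)"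
    if j: "j < k" for j
  proof -
    obtain y q q' f where a: "as ! j = (y, ([q, q'], [f]))" "plot_map q q' f"
      using path_Ar[OF as j] by (rule Q_1E)
    have "(y, ([q], [])) = (z j, ([p j], [] :: (rvec \<Rightarrow> rvec) list))"
      using src_path_nth[OF as j] unfolding v a by (simp add: Q_src_def)
    moreover have "(act f y, ([q'], [])) = (z (Suc j), ([p (Suc j)], [] :: (rvec \<Rightarrow> rvec) list))"
      using tgt_path_nth[OF as j] unfolding v a by (simp add: Q_tgt_def)
    ultimately show ?thesis using a by simp
  qed
  then obtain f where f: "\<And>j. j < k \<Longrightarrow> as ! j = (z j, ([p j, p (Suc j)], [f j]))"
    "\<And>j. j < k \<Longrightarrow> plot_map (p j) (p (Suc j)) (f j)" "\<And>j. j < k \<Longrightarrow> z (Suc j) = act (f j) (z j)"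
    by metis
  define ps fs where "ps = map p [0..<Suc k]" and "fs = map f [0..<k]"
  have ps: "length ps = Suc k" "length fs = k" "\<And>j. j \<le> k \<Longrightarrow> ps ! j = p j" "\<And>j. j < k \<Longrightarrow> fs ! j = f j"
    by (auto simp: ps_def fs_def nth_append less_Suc_eq_le simp del: upt_Suc)
  have tr: "transport fs (z 0) j = z j" if "j \<le> k" for j
    using that by (induction j) (auto simp: ps f)
  show thesis
  proof
    show "(z 0, (ps, fs)) \<in> Q k" using v f by (simp add: Q_iff ps)
    show "as = arrows (z 0, (ps, fs))"
      using path_length[OF as] by (intro nth_equalityI) (auto simp: length_arrows nth_arrows ps f tr)
  qed
qed

text \<open>The vertices of the path recover the element and all plots, the arrows recover the maps.
  For \<open>k = 0\<close> the list is empty and determines nothing, which is why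
  \<open>\<Phi> 0\<close> is defined separately.\<close>

lemma arrows_inj:
  assumes "(y, (ps, fs)) \<in> Q k" "(y', (ps', fs')) \<in> Q k" "arrows (y, (ps, fs)) = arrows (y', (ps', fs'))" "0 < k"
  shows "(y, (ps, fs)) = (y', (ps', fs'))"
proof -
  have len: "length ps = Suc k" "length fs = k" "length ps' = Suc k" "length fs' = k"
    using assms(1,2) by (simp_all add: Q_iff)
  have v: "(transport fs y j, ([ps ! j], [] :: (rvec \<Rightarrow> rvec) list)) = (transport fs' y' j, ([ps' ! j], []))" if "j \<le> k" for j
    using arrow_path_arrows(2)[OF assms(1) that assms(4)] arrow_path_arrows(2)[OF assms(2) that assms(4)]
      assms(3) by metis
  have "fs ! j = fs' ! j" if "j < k" for j
    using arg_cong[OF assms(3), of "\<lambda>as. as ! j"] that len by (simp add: nth_arrows)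
  then show ?thesis using v v[of 0] len by (auto intro!: nth_equalityI simp: less_Suc_eq_le)
qed

lemma \<Phi>_bij: "bij_betw (\<Phi> k) (Q k) (N k)"
proof (cases k)
  case 0
  show ?thesis unfolding 0 nerve_set_0 by (auto simp: bij_betw_def inj_on_def \<Phi>_def)
next
  case (Suc m)
  have "inj_on (\<Phi> k) (Q k)"
  proof (rule inj_onI)
    fix x x' assume "x \<in> Q k" "x' \<in> Q k" "\<Phi> k x = \<Phi> k x'"
    then show "x = x'"
      using arrows_inj[of "fst x" "fst (snd x)" "snd (snd x)" k "fst x'" "fst (snd x')" "snd (snd x')"] Suc
      by (simp add: \<Phi>_def)
  qed
  moreover have "\<Phi> k ` Q k = N k"
  proof (intro equalityI subsetI)
    fix z assume "z \<in> \<Phi> k ` Q k"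
    then show "z \<in> N k" unfolding Suc nerve_set_Suc using arrow_path_arrows(1) by (auto simp: \<Phi>_def)
  next
    fix z assume "z \<in> N k"
    then obtain as where as: "z = Path as" "arrow_path k as" using Suc nerve_SucE by metis
    then obtain x where "x \<in> Q k" "as = arrows x" using arrow_path_arrowsE[OF as(2)] Suc by auto
    then show "z \<in> \<Phi> k ` Q k" using as Suc by (auto simp: \<Phi>_def)
  qed
  ultimately show ?thesis by (simp add: bij_betw_def)
qed

section \<open>Compatibility of the comparison with faces and degeneracies\<close>

lemma Q_face_mem:
  assumes "i \<le> Suc k"
  shows "Q_face act (Suc k) i \<in> Q (Suc k) \<rightarrow> Q k"
proof
  fix x assume x: "x \<in> Q (Suc k)"
  obtain y ps fs where xe: "x = (y, (ps, fs))" by (metis prod.collapse)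
  obtain ps' fs' where ps': "chain_face (Suc k) i (ps, fs) = (ps', fs')" by fastforce
  note q = x[unfolded xe Q_iff]
  have len: "length ps = Suc (Suc k)" "length fs = Suc k" using q by auto
  note nth = chain_face_nth[OF len zero_less_Suc assms ps']
  have c: "(ps', fs') \<in> plot_chains X k"
    using plot_chains_face[OF X, of "(ps, fs)" k i] x assms ps' by (simp add: Q_def xe)
  moreover have "(if i = 0 then act (hd fs) y else y) \<in> Y (fst (ps' ! 0))"
    using nth(3)[of 0] q plot_map_act_mem[of "ps ! 0" "ps ! 1" "fs ! 0" y] by (cases fs) auto
  ultimately have "(if i = 0 then act (hd fs) y else y, (ps', fs')) \<in> Q k"
    unfolding Q_iff plot_chains_iff by blast
  moreover have "Q_face act (Suc k) i x = (if i = 0 then act (hd fs) y else y, (ps', fs'))"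
    by (simp add: xe Q_face_def ps')
  ultimately show "Q_face act (Suc k) i x \<in> Q k" by metis
qed

lemma Q_degen_mem:
  assumes "i \<le> k"
  shows "Q_degen i \<in> Q k \<rightarrow> Q (Suc k)"
proof
  fix x assume x: "x \<in> Q k"
  obtain y ps fs where xe: "x = (y, (ps, fs))" by (metis prod.collapse)
  obtain ps' fs' where ps': "chain_degen i (ps, fs) = (ps', fs')" by fastforce
  note q = x[unfolded xe Q_iff]
  have len: "length ps = Suc k" "length fs = k" using q by auto
  note nth = chain_degen_nth[OF len assms ps']
  have c: "(ps', fs') \<in> plot_chains X (Suc k)"
    using plot_chains_degen[OF X, of "(ps, fs)" k i] x assms ps' by (simp add: Q_def xe)
  then show "Q_degen i x \<in> Q (Suc k)"
    using nth(3)[of 0] q by (simp add: xe Q_degen_def ps' Q_iff plot_chains_iff)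
qed

text \<open>Transporting along the face skips one intermediate element and changes no other, so the
  arrows of the face are the old arrows with a neighbouring pair composed or an end removed.\<close>

lemma \<Phi>_face:
  assumes i: "i \<le> Suc k" and x: "x \<in> Q (Suc k)"
  shows "\<Phi> k (Q_face act (Suc k) i x) = d (Suc k) i (\<Phi> (Suc k) x)"
proof -
  obtain y ps fs where xe: "x = (y, (ps, fs))" by (metis prod.collapse)
  obtain ps' fs' where ps': "chain_face (Suc k) i (ps, fs) = (ps', fs')" by fastforce
  note x = x[unfolded xe] and q = x[unfolded xe Q_iff]
  have len: "length ps = Suc (Suc k)" "length fs = Suc k" using q by auto
  note nth = chain_face_nth[OF len zero_less_Suc i ps']
  note path = arrow_path_arrows[OF x]
  define y' where "y' = (if i = 0 then act (hd fs) y else y)"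
  have face: "Q_face act (Suc k) i x = (y', (ps', fs'))" by (simp add: xe Q_face_def ps' y'_def)
  \<comment> \<open>The zeroth face starts the transport one step later; all other faces keep its
    start.\<close>
  have y': "y' = transport fs y (if i = 0 then 1 else 0)"
    using len by (cases fs) (auto simp: y'_def)
  show ?thesis
  proof (cases k)
    case 0
    then have "fs' = []" "ps' = [ps ! (if i = 0 then 1 else 0)]"
      using nth(1-3) by (auto simp: length_Suc_conv)
    then show ?thesis
      using i 0 path(1) path(2)[of "1 - i"] y' unfolding face
      by (auto simp: \<Phi>_def face_1 xe le_Suc_eq)
  next
    case (Suc m)
    have tr: "transport fs' y' j = (if j < i then transport fs y j else transport fs y (Suc j))" if "j \<le> k" for j
      using that
    proof (induction j)
      case 0
      then show ?case by (auto simp: y')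
    next
      case (Suc j)
      \<comment> \<open>Needed at \<open>Suc j = i\<close>, where one composite map of the face
        replaces two steps of the chain.\<close>
      have "act (compose (mcarrier (fst (ps ! j))) (fs ! Suc j) (fs ! j)) (transport fs y j) =
          act (fs ! Suc j) (act (fs ! j) (transport fs y j))"
        using Suc.prems q transport_mem[OF x, of j]
        by (intro plot_map_act_compose[of _ "ps ! Suc j" _ "ps ! Suc (Suc j)"]) auto
      then show ?case using Suc nth(4)[of j] by auto
    qed
    have "arrows (y', (ps', fs')) = face i (arrows (y, (ps, fs)))"
    proof (rule nth_equalityI)
      fix j assume "j < length (arrows (y', (ps', fs')))"
      then have j: "j < k" using nth(2) by (simp add: length_arrows)
      then show "arrows (y', (ps', fs')) ! j = face i (arrows (y, (ps, fs))) ! j"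
        using nth(2) nth(3)[of j] nth(3)[of "Suc j"] nth(4)[of j] len tr[of j]
        by (auto simp: nth_arrows nth_face_path length_arrows Q_comp_def)
    qed (use nth(2) len in \<open>simp add: length_arrows\<close>)
    then show ?thesis using i path(1) Suc unfolding face by (simp add: \<Phi>_def face_Path xe)
  qed
qed

lemma \<Phi>_degen:
  assumes i: "i \<le> k" and x: "x \<in> Q k"
  shows "\<Phi> (Suc k) (Q_degen i x) = s k i (\<Phi> k x)"
proof -
  obtain y ps fs where xe: "x = (y, (ps, fs))" by (metis prod.collapse)
  obtain ps' fs' where ps': "chain_degen i (ps, fs) = (ps', fs')" by fastforce
  note x = x[unfolded xe] and q = x[unfolded xe Q_iff]
  have len: "length ps = Suc k" "length fs = k" using q by auto
  note nth = chain_degen_nth[OF len i ps']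
  note path = arrow_path_arrows[OF x]
  have degen: "Q_degen i x = (y, (ps', fs'))" by (simp add: xe Q_degen_def ps')
  have tr: "transport fs' y j = (if j \<le> i then transport fs y j else transport fs y (j - 1))" if "j \<le> Suc k" for j
    using that
  proof (induction j)
    case (Suc j)
    consider "j < i" | "j = i" | "i < j" by linarith
    then show ?case
    proof cases
      \<comment> \<open>The inserted identity acts trivially, so the transported element is repeated
        here.\<close>
      case 2
      then show ?thesis
        using Suc nth(4)[of j] transport_mem[OF x, of i] q i by (auto simp: act_id plot_cartesian)
    next
      case 3
      then obtain l where "j = Suc l" by (cases j) auto
      then show ?thesis using 3 Suc nth(4)[of j] by auto
    qed (use Suc nth(4)[of j] in auto)
  qed simp
  show ?thesis
  proof (cases k)
    case 0
    then obtain p where p: "ps = [p]" "fs = []" using len by (auto simp: length_Suc_conv)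
    then show ?thesis using 0 i
      by (simp add: \<Phi>_def nerve_degen_def xe Q_degen_def chain_degen_def arrows_def Q_unit_def)
  next
    case (Suc m)
    have "arrows (y, (ps', fs')) = degen i (arrows (y, (ps, fs)))"
    proof (rule nth_equalityI)
      fix j assume "j < length (arrows (y, (ps', fs')))"
      then have j: "j \<le> k" using nth(2) by (simp add: length_arrows)
      then show "arrows (y, (ps', fs')) ! j = degen i (arrows (y, (ps, fs))) ! j"
        using nth(2) nth(3)[of j] nth(3)[of "Suc j"] nth(4)[of j] len tr[of j] path(2)[OF i] Suc i
        by (cases j i rule: linorder_cases) (auto simp: nth_arrows nth_degen_path length_arrows Q_unit_def)
    qed (use nth(2) len in \<open>simp add: length_arrows\<close>)
    then show ?thesis using i path(1) Suc unfolding degen by (simp add: \<Phi>_def degen_Path xe)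
  qed
qed

theorem simplicial_set_Q: "simplicial_set Q (Q_face act) (\<lambda>k. Q_degen)"
proof (rule simplicial_set_transfer[where \<Phi> = \<Phi> and N = N and d' = d and s' = s])
  show "simplicial_set N d s" by (rule simplicial_set_nerve)
  show "bij_betw (\<Phi> k) (Q k) (N k)" for k by (rule \<Phi>_bij)
  show "Q_face act (Suc k) i \<in> Q (Suc k) \<rightarrow> Q k" if "i \<le> Suc k" for k i
    using that by (rule Q_face_mem)
  show "Q_degen i \<in> Q k \<rightarrow> Q (Suc k)" if "i \<le> k" for k i
    using that by (rule Q_degen_mem)
  show "\<Phi> k (Q_face act (Suc k) i x) = d (Suc k) i (\<Phi> (Suc k) x)" if "i \<le> Suc k" "x \<in> Q (Suc k)" for k i x
    using that by (rule \<Phi>_face)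
  show "\<Phi> (Suc k) (Q_degen i x) = s k i (\<Phi> k x)" if "i \<le> k" "x \<in> Q k" for k i x
    using that by (rule \<Phi>_degen)
qed

end

section \<open>Transfer along isomorphisms\<close>

lemma dsmooth_compose:
  assumes "dsmooth X Y f" "dsmooth Y Z g" "diffeological_space X"
  shows "dsmooth X Z (g \<circ> f)"
  unfolding dsmooth_def
proof (intro conjI ballI)
  show "g \<circ> f \<in> points X \<rightarrow> points Z" using assms(1,2) by (auto simp: dsmooth_def)
  fix c assume c: "c \<in> plots X"
  obtain U p where p: "c = (U, p)" by (cases c)
  have "(U, compose (mcarrier U) g (compose (mcarrier U) f p)) \<in> plots Z"
    using dsmooth_plot[OF assms(2) dsmooth_plot[OF assms(1)]] c p by simp
  moreover have "compose (mcarrier U) g (compose (mcarrier U) f p) = compose (mcarrier U) (g \<circ> f) p"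
    unfolding compose_def by (intro restrict_ext) simp
  ultimately show "case c of (U, p) \<Rightarrow> (U, compose (mcarrier U) (g \<circ> f) p) \<in> plots Z" by (simp add: p)
qed

lemma dsmooth_cong:
  assumes "dsmooth X Y f" "diffeological_space X" "\<And>x. x \<in> points X \<Longrightarrow> f x = g x"
  shows "dsmooth X Y g"
  unfolding dsmooth_def
proof (intro conjI ballI)
  show "g \<in> points X \<rightarrow> points Y" using assms(1,3) unfolding dsmooth_def Pi_iff by metis
  fix c assume c: "c \<in> plots X"
  obtain U p where p: "c = (U, p)" by (cases c)
  have "p \<in> mcarrier U \<rightarrow>\<^sub>E points X" using plotsD(2)[OF assms(2)] c p by simp
  then have "compose (mcarrier U) f p = compose (mcarrier U) g p"
    unfolding compose_def using assms(3) by (intro restrict_ext) auto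
  then show "case c of (U, p) \<Rightarrow> (U, compose (mcarrier U) g p) \<in> plots Y"
    using dsmooth_plot[OF assms(1)] c p by fastforce
qed

text \<open>A function into \<open>B\<close> is a plot exactly if its lift along the inverse of
  \<open>\<Phi>\<close> is a plot of \<open>A\<close>, so the axioms carry over. Hypothesis
  \<open>B\<close> supplies extensionality of plots, which smoothness of the inverse cannot detect
  because \<open>compose\<close> restricts to the domain.\<close>

lemma diffeological_space_transfer:
  assumes A: "diffeological_space A" and \<Phi>: "ddiffeomorphism A B \<Phi>"
    and B: "\<And>U p. (U, p) \<in> plots B \<Longrightarrow> cartesian_space U \<and> p \<in> mcarrier U \<rightarrow>\<^sub>E points B"
  shows "diffeological_space B"
proof -
  let ?\<Psi> = "inv_into (points A) \<Phi>"
  have bij: "bij_betw \<Phi> (points A) (points B)" and sm: "dsmooth A B \<Phi>" "dsmooth B A ?\<Psi>"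
    using \<Phi> by (auto simp: ddiffeomorphism_def)
  have \<Psi>: "?\<Psi> y \<in> points A" "\<Phi> (?\<Psi> y) = y" if "y \<in> points B" for y
    using bij that bij_betw_inv_into_right[OF bij] bij_betwE[OF bij_betw_inv_into[OF bij]] by auto
  have lift: "compose (mcarrier U) ?\<Psi> p \<in> mcarrier U \<rightarrow>\<^sub>E points A" if "p \<in> mcarrier U \<rightarrow>\<^sub>E points B" for U p
    using that \<Psi>(1) by (auto simp: compose_def)
  have plotI: "(U, p) \<in> plots B" if p: "p \<in> mcarrier U \<rightarrow>\<^sub>E points B" "(U, compose (mcarrier U) ?\<Psi> p) \<in> plots A" for U p
  proof -
    \<comment> \<open>Outside \<open>mcarrier U\<close> both sides are \<open>undefined\<close>, as
      \<open>p\<close> is extensional.\<close>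
    have "compose (mcarrier U) \<Phi> (compose (mcarrier U) ?\<Psi> p) x = p x" for x
      using p(1) \<Psi>(2) PiE_arb[OF p(1), of x] by (cases "x \<in> mcarrier U") (auto simp: compose_def)
    then have "compose (mcarrier U) \<Phi> (compose (mcarrier U) ?\<Psi> p) = p" by (rule ext)
    then show ?thesis using dsmooth_plot[OF sm(1) p(2)] by simp
  qed
  show ?thesis
    unfolding diffeological_space_def
  proof (intro conjI ballI allI impI; (elim conjE)?)
    fix c assume "c \<in> plots B"
    then show "case c of (U, p) \<Rightarrow> cartesian_space U \<and> p \<in> mcarrier U \<rightarrow>\<^sub>E points B"
      using B by (cases c) simp
  next
    fix p assume p: "p \<in> mcarrier (euclidean_mfd 0) \<rightarrow>\<^sub>E points B"
    show "(euclidean_mfd 0, p) \<in> plots B" by (rule plotI[OF p plots_point[OF A lift[OF p]]])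
  next
    fix U p V f assume *: "(U, p) \<in> plots B" "cartesian_space V" "f \<in> cart_hom V U"
    have f: "f \<in> mcarrier V \<rightarrow> mcarrier U" using *(3) by (auto simp: cart_hom_def)
    have p: "p \<in> mcarrier U \<rightarrow>\<^sub>E points B" using B[OF *(1)] by simp
    show "(V, compose (mcarrier V) p f) \<in> plots B"
    proof (rule plotI)
      show "compose (mcarrier V) p f \<in> mcarrier V \<rightarrow>\<^sub>E points B" using p f by (auto simp: compose_def)
      show "(V, compose (mcarrier V) ?\<Psi> (compose (mcarrier V) p f)) \<in> plots A"
        using plots_compose[OF A dsmooth_plot[OF sm(2) *(1)] *(2,3)] compose_assoc[OF f, of ?\<Psi> p] by simp
    qed
  next
    fix U p \<W>
    assume *: "cartesian_space U" "p \<in> mcarrier U \<rightarrow>\<^sub>E points B" "good_open_cover U \<W>"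
      "\<forall>W\<in>\<W>. (open_submfd U W, restrict p W) \<in> plots B"
    show "(U, p) \<in> plots B"
    proof (rule plotI[OF *(2) plots_local[OF A *(1) lift[OF *(2)] *(3)]])
      fix W assume W: "W \<in> \<W>"
      then have "W \<subseteq> mcarrier U" using good_open_coverD(3)[OF *(3)] by blast
      then have "compose W ?\<Psi> (restrict p W) = restrict (compose (mcarrier U) ?\<Psi> p) W"
        unfolding compose_def by (intro ext) (auto simp: restrict_def)
      moreover have "(open_submfd U W, restrict p W) \<in> plots B" using *(4) W by blast
      ultimately show "(open_submfd U W, restrict (compose (mcarrier U) ?\<Psi> p) W) \<in> plots A"
        using dsmooth_plot[OF sm(2), of "open_submfd U W" "restrict p W"] by simp
    qed
  qed
qed

text \<open>On points \<open>G\<close> is the conjugate of \<open>F\<close> by the two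
  diffeomorphisms.\<close>

lemma dsmooth_transfer:
  assumes A: "diffeological_space A" "diffeological_space B" and sm: "dsmooth A A' F"
    and \<Phi>: "ddiffeomorphism A B \<Phi>" "ddiffeomorphism A' B' \<Phi>'"
    and eq: "\<And>x. x \<in> points A \<Longrightarrow> \<Phi>' (F x) = G (\<Phi> x)"
  shows "dsmooth B B' G"
proof (rule dsmooth_cong[OF _ A(2)])
  let ?\<Psi> = "inv_into (points A) \<Phi>"
  show "dsmooth B B' ((\<Phi>' \<circ> F) \<circ> ?\<Psi>)"
    using \<Phi> by (intro dsmooth_compose[OF _ dsmooth_compose[OF sm _ A(1)] A(2)]) (auto simp: ddiffeomorphism_def)
  fix y assume "y \<in> points B"
  then have "?\<Psi> y \<in> points A" "\<Phi> (?\<Psi> y) = y"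
    using \<Phi>(1) bij_betw_inv_into_right[of \<Phi> "points A" "points B"]
      bij_betwE[OF bij_betw_inv_into[of \<Phi> "points A" "points B"]] by (auto simp: ddiffeomorphism_def)
  then show "((\<Phi>' \<circ> F) \<circ> ?\<Psi>) y = G y" using eq by simp
qed

text \<open>Every section of \<open>B\<close> is the image of a section of \<open>A\<close>, and
  naturality carries the functor laws across.\<close>

lemma presheaf_transfer:
  assumes A: "presheaf A" and bij: "\<And>V. cartesian_space V \<Longrightarrow> bij_betw (\<eta> V) (ps_set A V) (ps_set B V)"
    and nat: "\<And>V W f x. cartesian_space V \<Longrightarrow> cartesian_space W \<Longrightarrow> f \<in> cart_hom W V \<Longrightarrow> x \<in> ps_set A V \<Longrightarrow>
      \<eta> W (ps_res A W V f x) = ps_res B W V f (\<eta> V x)"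
  shows "presheaf B"
proof -
  have img: "\<exists>x\<in>ps_set A V. y = \<eta> V x" if "cartesian_space V" "y \<in> ps_set B V" for V y
    using bij[OF that(1)] that(2) by (auto simp: bij_betw_def)
  have mem: "\<eta> V x \<in> ps_set B V" if "cartesian_space V" "x \<in> ps_set A V" for V x
    using bij[OF that(1)] that(2) by (auto simp: bij_betw_def)
  have res: "ps_res A W V f x \<in> ps_set A W"
    if "cartesian_space V" "cartesian_space W" "f \<in> cart_hom W V" "x \<in> ps_set A V" for V W f x
    using A that unfolding presheaf_def by blast
  show ?thesis
    unfolding presheaf_def
  proof (intro conjI allI impI ballI; (elim conjE)?)
    fix V W f assume *: "cartesian_space V" "cartesian_space W" "f \<in> cart_hom W V"
    show "ps_res B W V f \<in> ps_set B V \<rightarrow> ps_set B W"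
    proof
      fix y assume "y \<in> ps_set B V"
      then obtain x where x: "x \<in> ps_set A V" "y = \<eta> V x" using img[OF *(1)] by blast
      then show "ps_res B W V f y \<in> ps_set B W"
        using nat[OF * x(1)] mem[OF *(2) res[OF * x(1)]] by simp
    qed
  next
    fix V y assume *: "cartesian_space V" "y \<in> ps_set B V"
    then obtain x where x: "x \<in> ps_set A V" "y = \<eta> V x" using img by blast
    have "ps_res A V V (\<lambda>y\<in>mcarrier V. y) x = x" using A *(1) x(1) unfolding presheaf_def by blast
    then show "ps_res B V V (\<lambda>y\<in>mcarrier V. y) y = y"
      using nat[OF *(1,1) cart_hom_id[OF *(1)] x(1)] x(2) by simp
  next
    fix V W Z f g y
    assume *: "cartesian_space V" "cartesian_space W" "cartesian_space Z"
      "f \<in> cart_hom W V" "g \<in> cart_hom Z W" "y \<in> ps_set B V"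
    obtain x where x: "x \<in> ps_set A V" "y = \<eta> V x" using img *(1,6) by blast
    have "ps_res A Z V (compose (mcarrier Z) f g) x = ps_res A Z W g (ps_res A W V f x)"
      using A * x(1) unfolding presheaf_def by blast
    moreover have "compose (mcarrier Z) f g \<in> cart_hom Z V" using cart_hom_compose[OF *(3,2,1,5,4)] .
    ultimately show "ps_res B Z V (compose (mcarrier Z) f g) y = ps_res B Z W g (ps_res B W V f y)"
      using nat[OF *(1,3) _ x(1)] nat[OF *(1,2,4) x(1)] nat[OF *(2,3,5) res[OF *(1,2,4) x(1)]] x(2) by metis
  qed
qed

lemma psh_map_transfer:
  assumes F: "psh_map A A' F" and A: "presheaf A"
    and \<eta>: "psh_map A B \<eta>" "\<And>V. cartesian_space V \<Longrightarrow> bij_betw (\<eta> V) (ps_set A V) (ps_set B V)"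
    and \<eta>': "psh_map A' B' \<eta>'"
    and eq: "\<And>V x. cartesian_space V \<Longrightarrow> x \<in> ps_set A V \<Longrightarrow> \<eta>' V (F V x) = G V (\<eta> V x)"
  shows "psh_map B B' G"
proof -
  have img: "\<exists>x\<in>ps_set A V. y = \<eta> V x" if "cartesian_space V" "y \<in> ps_set B V" for V y
    using \<eta>(2)[OF that(1)] that(2) by (auto simp: bij_betw_def)
  show ?thesis
    unfolding psh_map_def
  proof (intro conjI allI impI ballI; (elim conjE)?)
    fix V assume V: "cartesian_space V"
    show "G V \<in> ps_set B V \<rightarrow> ps_set B' V"
    proof
      fix y assume "y \<in> ps_set B V"
      then obtain x where x: "x \<in> ps_set A V" "y = \<eta> V x" using img[OF V] by blast
      have "F V x \<in> ps_set A' V" using F V x(1) by (auto simp: psh_map_def)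
      then have "\<eta>' V (F V x) \<in> ps_set B' V" using \<eta>' V by (auto simp: psh_map_def)
      then show "G V y \<in> ps_set B' V" using eq[OF V x(1)] x(2) by simp
    qed
  next
    fix V W f y assume *: "cartesian_space V" "cartesian_space W" "f \<in> cart_hom W V" "y \<in> ps_set B V"
    obtain x where x: "x \<in> ps_set A V" "y = \<eta> V x" using img *(1,4) by blast
    have FV: "F V x \<in> ps_set A' V" using F *(1) x(1) by (auto simp: psh_map_def)
    have resx: "ps_res A W V f x \<in> ps_set A W" using A * x(1) unfolding presheaf_def by blast
    have "G W (ps_res B W V f y) = G W (\<eta> W (ps_res A W V f x))"
      using \<eta>(1) * x by (simp add: psh_map_def)
    also have "\<dots> = \<eta>' W (F W (ps_res A W V f x))" using eq[OF *(2) resx] by simp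
    also have "\<dots> = \<eta>' W (ps_res A' W V f (F V x))" using F * x(1) by (simp add: psh_map_def)
    also have "\<dots> = ps_res B' W V f (G V y)" using \<eta>' * FV eq[OF *(1) x(1)] x(2) by (simp add: psh_map_def)
    finally show "G W (ps_res B W V f y) = ps_res B' W V f (G V y)" .
  qed
qed

section \<open>Presheaves on cartesian spaces\<close>

lemma presheaf_yoneda:
  assumes "cartesian_space U"
  shows "presheaf (yoneda U)"
  unfolding presheaf_def
proof (intro conjI allI impI ballI; (elim conjE)?)
  fix V W f assume *: "cartesian_space V" "cartesian_space W" "f \<in> cart_hom W V"
  show "ps_res (yoneda U) W V f \<in> ps_set (yoneda U) V \<rightarrow> ps_set (yoneda U) W"
    using cart_hom_compose[OF *(2,1) assms *(3)] by (auto simp: yoneda_def)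
next
  fix V x assume "cartesian_space V" "x \<in> ps_set (yoneda U) V"
  then show "ps_res (yoneda U) V V (\<lambda>y\<in>mcarrier V. y) x = x"
    by (auto simp: yoneda_def cart_hom_def PiE_def compose_Id)
next
  fix V W Z f g x
  assume "g \<in> cart_hom Z W"
  then have "g \<in> mcarrier Z \<rightarrow> mcarrier W" by (auto simp: cart_hom_def)
  from compose_assoc[OF this, of x f]
  show "ps_res (yoneda U) Z V (compose (mcarrier Z) f g) x =
      ps_res (yoneda U) Z W g (ps_res (yoneda U) W V f x)"
    by (simp add: yoneda_def)
qed

lemma presheaf_psh_coproduct:
  assumes "\<And>i. i \<in> I \<Longrightarrow> presheaf (F i)"
  shows "presheaf (psh_coproduct I F)"
  unfolding presheaf_def
proof (intro conjI allI impI ballI; (elim conjE)?)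
  fix V W f assume *: "cartesian_space V" "cartesian_space W" "f \<in> cart_hom W V"
  have "ps_res (F i) W V f x \<in> ps_set (F i) W" if "i \<in> I" "x \<in> ps_set (F i) V" for i x
    using assms[OF that(1)] that(2) * unfolding presheaf_def by blast
  then show "ps_res (psh_coproduct I F) W V f \<in> ps_set (psh_coproduct I F) V \<rightarrow> ps_set (psh_coproduct I F) W"
    by (auto simp: psh_coproduct_def)
next
  fix V z assume *: "cartesian_space V" "z \<in> ps_set (psh_coproduct I F) V"
  have "ps_res (F i) V V (\<lambda>y\<in>mcarrier V. y) x = x" if "i \<in> I" "x \<in> ps_set (F i) V" for i x
    using assms[OF that(1)] that(2) *(1) unfolding presheaf_def by blast
  then show "ps_res (psh_coproduct I F) V V (\<lambda>y\<in>mcarrier V. y) z = z"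
    using *(2) by (auto simp: psh_coproduct_def)
next
  fix V W Z f g z
  assume *: "cartesian_space V" "cartesian_space W" "cartesian_space Z"
    "f \<in> cart_hom W V" "g \<in> cart_hom Z W" "z \<in> ps_set (psh_coproduct I F) V"
  have "ps_res (F i) Z V (compose (mcarrier Z) f g) x = ps_res (F i) Z W g (ps_res (F i) W V f x)"
    if "i \<in> I" "x \<in> ps_set (F i) V" for i x
    using assms[OF that(1)] that(2) *(1-5) unfolding presheaf_def by blast
  then show "ps_res (psh_coproduct I F) Z V (compose (mcarrier Z) f g) z =
      ps_res (psh_coproduct I F) Z W g (ps_res (psh_coproduct I F) W V f z)"
    using *(6) by (auto simp: psh_coproduct_def)
qed

section \<open>The resolution as a simplicial diffeological space\<close>

lemma plot_action_points: "diffeological_space X \<Longrightarrow> plot_action X mcarrier (\<lambda>f x. f x)"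
  by unfold_locales (auto simp: cart_hom_def compose_eq)

lemma plot_action_maps:
  assumes "diffeological_space X" "cartesian_space V"
  shows "plot_action X (cart_hom V) (compose (mcarrier V))"
proof
  show "compose (mcarrier V) f y \<in> cart_hom V W"
    if "cartesian_space U" "cartesian_space W" "f \<in> cart_hom U W" "y \<in> cart_hom V U" for U W f y
    using cart_hom_compose[OF assms(2) that(1,2,4,3)] .
  show "compose (mcarrier V) (compose (mcarrier U) g f) y = compose (mcarrier V) g (compose (mcarrier V) f y)"
    if "y \<in> cart_hom V U" for U f g y
    by (rule compose_assoc[symmetric]) (use that in \<open>auto simp: cart_hom_def\<close>)
  show "compose (mcarrier V) (\<lambda>x\<in>mcarrier U. x) y = y" if "y \<in> cart_hom V U" for U y
    using that by (auto simp: cart_hom_def PiE_def intro!: Id_compose)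
qed (use assms in auto)

lemma chain_dom_cartesian:
  assumes "diffeological_space X" "c \<in> plot_chains X k"
  shows "cartesian_space (chain_dom c)"
proof -
  obtain ps fs where c: "c = (ps, fs)" by (cases c)
  then have "hd ps \<in> plots X" using assms(2) by (cases ps) (auto simp: plot_chains_def)
  then show ?thesis using plotsD(1)[OF assms(1)] by (metis c chain_dom_def fst_conv prod.collapse)
qed

text \<open>The zeroth face alone can move the domain of a chain, and it does so along the head map.
  These facts provide the smooth maps between domains that induce the faces of the
  resolution.\<close>

lemma chain_face_dom:
  assumes "c \<in> plot_chains X (Suc k)" "i \<le> Suc k"
  shows "i \<noteq> 0 \<Longrightarrow> chain_dom (chain_face (Suc k) i c) = chain_dom c"
    "hd (snd c) \<in> cart_hom (chain_dom c) (chain_dom (chain_face (Suc k) 0 c))"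
proof -
  obtain ps fs where c: "c = (ps, fs)" by (cases c)
  note q = assms(1)[unfolded c plot_chains_iff]
  obtain p p' ps' where ps: "ps = p # p' # ps'" using q by (auto simp: length_Suc_conv)
  obtain f fs' where fs: "fs = f # fs'" using q by (auto simp: length_Suc_conv)
  show "chain_dom (chain_face (Suc k) i c) = chain_dom c" if "i \<noteq> 0"
    using that assms(2) by (cases i) (auto simp: c chain_dom_def chain_face_def ps fs)
  have "plot_map p p' f" using q by (auto simp: ps fs)
  then show "hd (snd c) \<in> cart_hom (chain_dom c) (chain_dom (chain_face (Suc k) 0 c))"
    by (simp add: c chain_dom_def chain_face_def ps fs plot_map_def)
qed

lemma chain_degen_dom:
  assumes "c \<in> plot_chains X k"
  shows "chain_dom (chain_degen i c) = chain_dom c"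
proof -
  obtain ps fs where c: "c = (ps, fs)" by (cases c)
  then obtain p ps' where "ps = p # ps'" using assms by (auto simp: plot_chains_iff length_Suc_conv)
  then show ?thesis by (simp add: c chain_dom_def chain_degen_def)
qed

context plot_action
begin

text \<open>Source, target and unit are the low-dimensional faces and degeneracy, so their
  smoothness and naturality are instances of those of the simplicial operators.\<close>

lemma Q_src_face: "x \<in> Q 1 \<Longrightarrow> Q_src x = Q_face act 1 1 x"
  by (erule Q_1E) (simp add: Q_src_def Q_face_def chain_face_def)

lemma Q_tgt_face: "x \<in> Q 1 \<Longrightarrow> Q_tgt act x = Q_face act 1 0 x"
  by (erule Q_1E) (simp add: Q_tgt_def Q_face_def chain_face_def)

lemma Q_unit_degen: "x \<in> Q 0 \<Longrightarrow> Q_unit x = Q_degen 0 x"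
  by (erule Q_0E) (simp add: Q_unit_def Q_degen_def chain_degen_def)

end

locale diffeology =
  fixes X :: "'x diffsp"
  assumes X: "diffeological_space X"

sublocale diffeology \<subseteq> pts: plot_action X mcarrier "\<lambda>f x. f x"
  by (rule plot_action_points[OF X])

context diffeology
begin

section \<open>Plots of the resolution and smoothness of its structure maps\<close>

lemma points_Q_diffsp: "points (Q_diffsp X k) = pts.Q k"
  by (auto simp: Q_diffsp_def points_dcoproduct pts.Q_def)

lemma diffeological_space_Q_diffsp: "diffeological_space (Q_diffsp X k)"
  unfolding Q_diffsp_def
  using diffeological_space_dcoproduct diffeological_space_cart_diffsp chain_dom_cartesian[OF X] by metis

lemma Q_plotI:
  assumes "cartesian_space U" "c \<in> plot_chains X k" "q \<in> cart_hom U (chain_dom c)"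
    "p = (\<lambda>x\<in>mcarrier U. (q x, c))"
  shows "(U, p) \<in> plots (Q_diffsp X k)"
  unfolding Q_diffsp_def
proof (rule dcoproduct_plotI[where i = c and q = q])
  show "\<And>c. c \<in> plot_chains X k \<Longrightarrow> diffeological_space (cart_diffsp (chain_dom c))"
    using diffeological_space_cart_diffsp chain_dom_cartesian[OF X] by blast
qed (use assms in \<open>auto simp: cart_diffsp_plot_iff\<close>)

lemma Q_plotE:
  assumes "(U, p) \<in> plots (Q_diffsp X k)"
  obtains c q where "cartesian_space U" "c \<in> plot_chains X k" "q \<in> cart_hom U (chain_dom c)"
    "p = (\<lambda>x\<in>mcarrier U. (q x, c))"
proof -
  have ds: "\<And>c. c \<in> plot_chains X k \<Longrightarrow> diffeological_space (cart_diffsp (chain_dom c))"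
    using diffeological_space_cart_diffsp chain_dom_cartesian[OF X] by blast
  obtain c q where c: "c \<in> plot_chains X k" "(U, q) \<in> plots (cart_diffsp (chain_dom c))"
    "p = (\<lambda>x\<in>mcarrier U. (q x, c))"
    using assms unfolding Q_diffsp_def by (rule dcoproduct_plotE) (rule ds)
  show thesis
    using c(2) by (intro that[OF _ c(1) _ c(3)]) (simp_all add: cart_diffsp_plot_iff)
qed

text \<open>A plot is a smooth \<open>q\<close> paired with one fixed chain \<open>c\<close>, so a
  map carrying the summand of \<open>c\<close> into that of \<open>c' c\<close> by a smooth
  \<open>g c\<close> turns it into \<open>g c\<close> after \<open>q\<close>, paired with
  \<open>c' c\<close>.\<close>

lemma dsmooth_QI:
  assumes "\<And>c. c \<in> plot_chains X k \<Longrightarrow> c' c \<in> plot_chains X l"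
    "\<And>c. c \<in> plot_chains X k \<Longrightarrow> g c \<in> cart_hom (chain_dom c) (chain_dom (c' c))"
    "\<And>c x. c \<in> plot_chains X k \<Longrightarrow> x \<in> mcarrier (chain_dom c) \<Longrightarrow> F (x, c) = (g c x, c' c)"
  shows "dsmooth (Q_diffsp X k) (Q_diffsp X l) F"
  unfolding dsmooth_def
proof (intro conjI ballI)
  have g: "g c x \<in> mcarrier (chain_dom (c' c))" if "c \<in> plot_chains X k" "x \<in> mcarrier (chain_dom c)" for c x
    using assms(2)[OF that(1)] that(2) by (auto simp: cart_hom_def)
  show "F \<in> points (Q_diffsp X k) \<rightarrow> points (Q_diffsp X l)"
  proof
    fix z assume "z \<in> points (Q_diffsp X k)"
    then obtain x c where z: "z = (x, c)" "c \<in> plot_chains X k" "x \<in> mcarrier (chain_dom c)"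
      unfolding points_Q_diffsp pts.Q_def by blast
    then show "F z \<in> points (Q_diffsp X l)"
      using assms(1)[OF z(2)] assms(3)[OF z(2,3)] g[OF z(2,3)] by (simp add: points_Q_diffsp pts.Q_def)
  qed
  fix z assume z: "z \<in> plots (Q_diffsp X k)"
  obtain U p where p: "z = (U, p)" by (cases z)
  from z[unfolded p] obtain c q where q: "cartesian_space U" "c \<in> plot_chains X k"
    "q \<in> cart_hom U (chain_dom c)" "p = (\<lambda>x\<in>mcarrier U. (q x, c))" by (rule Q_plotE)
  have "(U, compose (mcarrier U) F p) \<in> plots (Q_diffsp X l)"
  proof (rule Q_plotI[OF q(1) assms(1)[OF q(2)]])
    show "compose (mcarrier U) (g c) q \<in> cart_hom U (chain_dom (c' c))"
      using cart_hom_compose[OF q(1) chain_dom_cartesian[OF X q(2)] chain_dom_cartesian[OF X assms(1)[OF q(2)]] q(3) assms(2)[OF q(2)]] .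
    have "q x \<in> mcarrier (chain_dom c)" if "x \<in> mcarrier U" for x using q(3) that by (auto simp: cart_hom_def)
    then show "compose (mcarrier U) F p = (\<lambda>x\<in>mcarrier U. (compose (mcarrier U) (g c) q x, c' c))"
      unfolding q(4) compose_def using assms(3)[OF q(2)] by (intro restrict_ext) simp
  qed
  then show "case z of (U, p) \<Rightarrow> (U, compose (mcarrier U) F p) \<in> plots (Q_diffsp X l)" by (simp add: p)
qed

lemma dsmooth_Q_face:
  assumes "i \<le> Suc k"
  shows "dsmooth (Q_diffsp X (Suc k)) (Q_diffsp X k) (Q_face (\<lambda>f x. f x) (Suc k) i)"
proof (rule dsmooth_QI[where c' = "chain_face (Suc k) i"
      and g = "\<lambda>c. if i = 0 then hd (snd c) else (\<lambda>x\<in>mcarrier (chain_dom c). x)"])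
  fix c assume c: "c \<in> plot_chains X (Suc k)"
  show "chain_face (Suc k) i c \<in> plot_chains X k" by (rule plot_chains_face[OF X c assms])
  show "(if i = 0 then hd (snd c) else (\<lambda>x\<in>mcarrier (chain_dom c). x))
      \<in> cart_hom (chain_dom c) (chain_dom (chain_face (Suc k) i c))"
    using chain_face_dom[OF c assms] cart_hom_id[OF chain_dom_cartesian[OF X c]] by auto
qed (auto simp: Q_face_def)

lemma dsmooth_Q_degen:
  assumes "i \<le> k"
  shows "dsmooth (Q_diffsp X k) (Q_diffsp X (Suc k)) (Q_degen i)"
proof (rule dsmooth_QI[where c' = "chain_degen i" and g = "\<lambda>c. \<lambda>x\<in>mcarrier (chain_dom c). x"])
  fix c assume c: "c \<in> plot_chains X k"
  show "chain_degen i c \<in> plot_chains X (Suc k)" by (rule plot_chains_degen[OF X c assms])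
  show "(\<lambda>x\<in>mcarrier (chain_dom c). x) \<in> cart_hom (chain_dom c) (chain_dom (chain_degen i c))"
    using chain_degen_dom[OF c] cart_hom_id[OF chain_dom_cartesian[OF X c]] by simp
qed (auto simp: Q_degen_def)

lemma simplicial_diffsp_Q: "simplicial_diffsp (Q_sdiffsp X)"
  unfolding simplicial_diffsp_def Q_sdiffsp_def sdiffsp.simps points_Q_diffsp
  using diffeological_space_Q_diffsp pts.simplicial_set_Q dsmooth_Q_face dsmooth_Q_degen by blast

lemma diffeological_category_Q: "diffeological_category (Q_diffcat X)"
  unfolding diffeological_category_def Q_diffcat_def diffcat.simps points_Q_diffsp
proof (intro conjI)
  show "small_category (pts.Q 0) (pts.Q 1) Q_src (Q_tgt (\<lambda>f x. f x)) Q_unit Q_comp"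
    by (rule pts.small_category_Q)
  show "dsmooth (Q_diffsp X 1) (Q_diffsp X 0) Q_src"
    by (rule dsmooth_cong[OF dsmooth_Q_face[of 1 0, folded One_nat_def] diffeological_space_Q_diffsp])
      (simp_all add: points_Q_diffsp pts.Q_src_face del: One_nat_def)
  show "dsmooth (Q_diffsp X 1) (Q_diffsp X 0) (Q_tgt (\<lambda>f x. f x))"
    by (rule dsmooth_cong[OF dsmooth_Q_face[of 0 0, folded One_nat_def] diffeological_space_Q_diffsp])
      (simp_all add: points_Q_diffsp pts.Q_tgt_face del: One_nat_def)
  show "dsmooth (Q_diffsp X 0) (Q_diffsp X 1) Q_unit"
    by (rule dsmooth_cong[OF dsmooth_Q_degen[of 0 0, folded One_nat_def] diffeological_space_Q_diffsp])
      (simp_all add: points_Q_diffsp pts.Q_unit_degen del: One_nat_def)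
  let ?P = "dpullback (Q_diffsp X 1) (Q_diffsp X 1) (Q_tgt (\<lambda>f x. f x)) Q_src"
  show "dsmooth ?P (Q_diffsp X 1) (\<lambda>(a, b). Q_comp a b)"
    unfolding dsmooth_def
  proof (intro conjI ballI)
    have points: "points ?P = {(a, b). a \<in> pts.Q 1 \<and> b \<in> pts.Q 1 \<and> Q_tgt (\<lambda>f x. f x) a = Q_src b}"
      by (simp add: dpullback_def Let_def points_Q_diffsp)
    have comp_mem: "(\<lambda>(a, b). Q_comp a b) z \<in> pts.Q 1" if z: "z \<in> points ?P" for z
    proof -
      obtain a b where "z = (a, b)" by (cases z)
      then show ?thesis using z pts.comp_Ar[of a b] unfolding points by simp
    qed
    show "(\<lambda>(a, b). Q_comp a b) \<in> points ?P \<rightarrow> points (Q_diffsp X 1)"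
      unfolding points_Q_diffsp using comp_mem by blast
    fix z assume z: "z \<in> plots ?P"
    obtain U r where r: "z = (U, r)" by (cases z)
    have U: "cartesian_space U" "r \<in> mcarrier U \<rightarrow>\<^sub>E points ?P"
      "(U, compose (mcarrier U) fst r) \<in> plots (Q_diffsp X 1)"
      "(U, compose (mcarrier U) snd r) \<in> plots (Q_diffsp X 1)"
      using z by (auto simp: r dpullback_def Let_def)
    obtain ps fs q where a: "(ps, fs) \<in> plot_chains X 1" "q \<in> cart_hom U (chain_dom (ps, fs))"
      "compose (mcarrier U) fst r = (\<lambda>x\<in>mcarrier U. (q x, (ps, fs)))"
      using Q_plotE[OF U(3)] by (metis prod.collapse)
    obtain ps' fs' q' where b: "(ps', fs') \<in> plot_chains X 1"
      "compose (mcarrier U) snd r = (\<lambda>x\<in>mcarrier U. (q' x, (ps', fs')))"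
      using Q_plotE[OF U(4)] by (metis prod.collapse)
    \<comment> \<open>Both components of a plot of composable pairs have a fixed chain, hence so
      does the composite.\<close>
    let ?c = "([ps ! 0, ps' ! 1], [compose (mcarrier (fst (ps ! 0))) (fs' ! 0) (fs ! 0)])"
    have rx: "r x = ((q x, (ps, fs)), (q' x, (ps', fs')))" if "x \<in> mcarrier U" for x
      using fun_cong[OF a(3), of x] fun_cong[OF b(2), of x] that by (simp add: compose_def prod_eq_iff)
    have comp: "(\<lambda>(a, b). Q_comp a b) (r x) = (q x, ?c)" if "x \<in> mcarrier U" for x
      by (simp add: rx[OF that] Q_comp_def)
    \<comment> \<open>That \<open>?c\<close> is a chain is seen at one point of \<open>U\<close>,
      where the two arrows are composable.\<close>
    obtain x0 where x0: "x0 \<in> mcarrier U" using cartesian_space_nonempty[OF U(1)] by blast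
    then have "(\<lambda>(a, b). Q_comp a b) (r x0) \<in> pts.Q 1" using comp_mem U(2) by blast
    then have c: "?c \<in> plot_chains X 1" unfolding comp[OF x0] by (simp add: pts.Q_def)
    have dom: "chain_dom ?c = chain_dom (ps, fs)"
      using a(1) by (cases ps) (auto simp: chain_dom_def plot_chains_def)
    have "(U, compose (mcarrier U) (\<lambda>(a, b). Q_comp a b) r) \<in> plots (Q_diffsp X 1)"
    proof (rule Q_plotI[OF U(1) c])
      show "q \<in> cart_hom U (chain_dom ?c)" using a(2) unfolding dom .
      show "compose (mcarrier U) (\<lambda>(a, b). Q_comp a b) r = (\<lambda>x\<in>mcarrier U. (q x, ?c))"
        unfolding compose_def[of "mcarrier U"] by (rule restrict_ext) (erule comp)
    qed
    then show "case z of (U, p) \<Rightarrow> (U, compose (mcarrier U) (\<lambda>(a, b). Q_comp a b) p) \<in> plots (Q_diffsp X 1)"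
      by (simp add: r)
  qed
qed (rule diffeological_space_Q_diffsp)+

section \<open>The nerve as a simplicial diffeological space\<close>

lemma points_dnerve: "points (sd_level (dnerve (Q_diffcat X)) k) = pts.N k"
  by (simp add: dnerve_def Let_def Q_diffcat_def points_Q_diffsp)

lemma dnerve_plot_iff: "(U, p) \<in> plots (sd_level (dnerve (Q_diffcat X)) k) \<longleftrightarrow>
    cartesian_space U \<and> p \<in> mcarrier U \<rightarrow>\<^sub>E pts.N k \<and>
    (if k = 0 then (U, \<lambda>x\<in>mcarrier U. the_vertex (p x)) \<in> plots (Q_diffsp X 0)
     else \<forall>j<k. (U, \<lambda>x\<in>mcarrier U. the_path (p x) ! j) \<in> plots (Q_diffsp X 1))"
  by (simp add: dnerve_def Let_def Q_diffcat_def points_Q_diffsp)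

lemma sd_face_dnerve: "sd_face (dnerve (Q_diffcat X)) = pts.d"
  and sd_degen_dnerve: "sd_degen (dnerve (Q_diffcat X)) = pts.s"
  by (simp_all add: dnerve_def Let_def Q_diffcat_def)

lemma chain_edge:
  assumes "(ps, fs) \<in> plot_chains X k" "j < k"
  shows "([ps ! j, ps ! Suc j], [fs ! j]) \<in> plot_chains X 1"
  using assms by (auto simp: plot_chains_iff less_Suc_eq le_Suc_eq)

lemma transport_smooth:
  assumes c: "(ps, fs) \<in> plot_chains X k" and U: "cartesian_space U"
    and q: "q \<in> cart_hom U (fst (ps ! 0))" and j: "j \<le> k"
  shows "(\<lambda>x\<in>mcarrier U. pts.transport fs (q x) j) \<in> cart_hom U (fst (ps ! j))"
  using j
proof (induction j)
  case 0
  have "(\<lambda>x\<in>mcarrier U. q x) = q" using q by (auto simp: cart_hom_def PiE_def intro: extensional_restrict)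
  then show ?case using q by simp
next
  case (Suc j)
  have f: "fs ! j \<in> cart_hom (fst (ps ! j)) (fst (ps ! Suc j))"
    using c Suc.prems by (auto simp: plot_chains_iff plot_map_def)
  have "cartesian_space (fst (ps ! j))" "cartesian_space (fst (ps ! Suc j))"
    using c Suc.prems pts.plot_cartesian by (auto simp: plot_chains_iff)
  then have "compose (mcarrier U) (fs ! j) (\<lambda>x\<in>mcarrier U. pts.transport fs (q x) j) \<in> cart_hom U (fst (ps ! Suc j))"
    using Suc.prems by (intro cart_hom_compose[OF U _ _ Suc.IH f]) auto
  moreover have "compose (mcarrier U) (fs ! j) (\<lambda>x\<in>mcarrier U. pts.transport fs (q x) j) =
      (\<lambda>x\<in>mcarrier U. pts.transport fs (q x) (Suc j))"
    unfolding compose_def by (rule restrict_ext) simp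
  ultimately show ?case by metis
qed

text \<open>Over a fixed chain the \<open>j\<close>-th arrow has a fixed edge as its chain, and its
  element is a transport of \<open>q x\<close>, smooth as an iterated composite.\<close>

lemma dsmooth_\<Phi>: "dsmooth (Q_diffsp X k) (sd_level (dnerve (Q_diffcat X)) k) (pts.\<Phi> k)"
  unfolding dsmooth_def
proof (intro conjI ballI)
  have mem: "pts.\<Phi> k z \<in> pts.N k" if "z \<in> pts.Q k" for z
    using pts.\<Phi>_bij[of k] that by (rule bij_betwE[THEN bspec])
  then show "pts.\<Phi> k \<in> points (Q_diffsp X k) \<rightarrow> points (sd_level (dnerve (Q_diffcat X)) k)"
    by (simp add: points_dnerve points_Q_diffsp)
  fix z assume z: "z \<in> plots (Q_diffsp X k)"
  obtain U p where p: "z = (U, p)" by (cases z)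
  have pp: "p \<in> mcarrier U \<rightarrow>\<^sub>E pts.Q k"
    using plotsD(2)[OF diffeological_space_Q_diffsp] z by (simp add: p points_Q_diffsp)
  from z[unfolded p] obtain c q where q: "cartesian_space U" "c \<in> plot_chains X k"
    "q \<in> cart_hom U (chain_dom c)" "p = (\<lambda>x\<in>mcarrier U. (q x, c))" by (rule Q_plotE)
  obtain ps fs where c: "c = (ps, fs)" by (cases c)
  have len: "length fs = k" and dom: "chain_dom c = fst (ps ! 0)"
    using q(2) by (cases ps; auto simp: c plot_chains_def chain_dom_def)+
  have fn: "compose (mcarrier U) (pts.\<Phi> k) p \<in> mcarrier U \<rightarrow>\<^sub>E pts.N k"
    using mem[OF PiE_mem[OF pp]] unfolding compose_def by (rule restrict_PiE[THEN iffD2, OF funcsetI])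
  have "(U, compose (mcarrier U) (pts.\<Phi> k) p) \<in> plots (sd_level (dnerve (Q_diffcat X)) k)"
  proof (cases "k = 0")
    case True
    have "(\<lambda>x\<in>mcarrier U. the_vertex (compose (mcarrier U) (pts.\<Phi> k) p x)) = p"
      unfolding q(4) compose_def by (rule restrict_ext) (simp add: True pts.\<Phi>_def)
    then show ?thesis using z q(1) fn True by (simp add: dnerve_plot_iff p)
  next
    case False
    have "(U, \<lambda>x\<in>mcarrier U. the_path (compose (mcarrier U) (pts.\<Phi> k) p x) ! j) \<in> plots (Q_diffsp X 1)"
      if j: "j < k" for j
    proof (rule Q_plotI[OF q(1) chain_edge[OF q(2)[unfolded c] j]])
      show "(\<lambda>x\<in>mcarrier U. pts.transport fs (q x) j) \<in> cart_hom U (chain_dom ([ps ! j, ps ! Suc j], [fs ! j]))"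
        using transport_smooth[OF q(2)[unfolded c] q(1), of q j] q(3) j unfolding dom
        by (simp add: chain_dom_def)
      show "(\<lambda>x\<in>mcarrier U. the_path (compose (mcarrier U) (pts.\<Phi> k) p x) ! j) =
          (\<lambda>x\<in>mcarrier U. ((\<lambda>x\<in>mcarrier U. pts.transport fs (q x) j) x, ([ps ! j, ps ! Suc j], [fs ! j])))"
        using False j len unfolding q(4) compose_def
        by (intro restrict_ext) (simp add: pts.\<Phi>_def c pts.nth_arrows)
    qed
    then show ?thesis using q(1) fn False by (simp add: dnerve_plot_iff)
  qed
  then show "case z of (U, p) \<Rightarrow> (U, compose (mcarrier U) (pts.\<Phi> k) p) \<in> plots (sd_level (dnerve (Q_diffcat X)) k)"
    by (simp add: p)
qed

text \<open>Each component of a plot of the nerve has one edge \<open>c j\<close> for all points of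
  \<open>U\<close>. The edges determine the whole chain of the preimage, which is therefore the
  chain found at a base point; the element is the smooth \<open>q 0\<close>, because transport over
  zero steps is the identity.\<close>

lemma dsmooth_\<Phi>_inv:
  "dsmooth (sd_level (dnerve (Q_diffcat X)) k) (Q_diffsp X k) (inv_into (pts.Q k) (pts.\<Phi> k))"
  (is "dsmooth _ _ ?\<Psi>")
  unfolding dsmooth_def
proof (intro conjI ballI)
  have mem: "?\<Psi> z \<in> pts.Q k" if "z \<in> pts.N k" for z
    using bij_betw_inv_into[OF pts.\<Phi>_bij[of k]] that by (rule bij_betwE[THEN bspec])
  have inv: "pts.\<Phi> k (?\<Psi> z) = z" if "z \<in> pts.N k" for z
    using bij_betw_inv_into_right[OF pts.\<Phi>_bij that] .
  show "?\<Psi> \<in> points (sd_level (dnerve (Q_diffcat X)) k) \<rightarrow> points (Q_diffsp X k)"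
    using mem by (simp add: points_dnerve points_Q_diffsp)
  fix z assume z: "z \<in> plots (sd_level (dnerve (Q_diffcat X)) k)"
  obtain U p where p: "z = (U, p)" by (cases z)
  note pl = z[unfolded p dnerve_plot_iff]
  have U: "cartesian_space U" and pN: "\<And>x. x \<in> mcarrier U \<Longrightarrow> p x \<in> pts.N k" using pl by auto
  have "(U, compose (mcarrier U) ?\<Psi> p) \<in> plots (Q_diffsp X k)"
  proof (cases "k = 0")
    case True
    have "the_vertex (p x) = ?\<Psi> (p x)" if "x \<in> mcarrier U" for x
      using inv[OF pN[OF that]] True by (metis nsimplex.sel(1) pts.\<Phi>_def)
    then have "compose (mcarrier U) ?\<Psi> p = (\<lambda>x\<in>mcarrier U. the_vertex (p x))"
      unfolding compose_def by (intro restrict_ext) simp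
    then show ?thesis using pl True by simp
  next
    case False
    have "\<exists>c q. c \<in> plot_chains X 1 \<and> q \<in> cart_hom U (chain_dom c) \<and>
        (\<lambda>x\<in>mcarrier U. the_path (p x) ! j) = (\<lambda>x\<in>mcarrier U. (q x, c))" if "j < k" for j
    proof -
      have "(U, \<lambda>x\<in>mcarrier U. the_path (p x) ! j) \<in> plots (Q_diffsp X 1)" using pl False that by auto
      then show ?thesis by (rule Q_plotE) blast
    qed
    then obtain c q where c: "\<And>j. j < k \<Longrightarrow> q j \<in> cart_hom U (chain_dom (c j))"
      "\<And>j. j < k \<Longrightarrow> (\<lambda>x\<in>mcarrier U. the_path (p x) ! j) = (\<lambda>x\<in>mcarrier U. (q j x, c j))"
      by metis
    obtain y P G where r: "\<And>x. ?\<Psi> (p x) = (y x, (P x, G x))"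
      using that[of "\<lambda>x. fst (?\<Psi> (p x))" "\<lambda>x. fst (snd (?\<Psi> (p x)))" "\<lambda>x. snd (snd (?\<Psi> (p x)))"] by simp
    have rQ: "(y x, (P x, G x)) \<in> pts.Q k" if "x \<in> mcarrier U" for x
      using mem[OF pN[OF that]] by (simp add: r)
    then have len: "length (P x) = Suc k" "length (G x) = k" if "x \<in> mcarrier U" for x
      using that by (simp_all add: pts.Q_iff)
    have edge: "(pts.transport (G x) (y x) j, ([P x ! j, P x ! Suc j], [G x ! j])) = (q j x, c j)"
      if x: "x \<in> mcarrier U" and j: "j < k" for x j
    proof -
      have "Path (pts.arrows (y x, (P x, G x))) = p x"
        using inv[OF pN[OF x]] False by (simp add: pts.\<Phi>_def r)
      then have "pts.arrows (y x, (P x, G x)) ! j = the_path (p x) ! j" by (metis nsimplex.sel(2))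
      then show ?thesis
        using fun_cong[OF c(2)[OF j], of x] x j len(2)[OF x] pts.nth_arrows[of j "G x" "y x" "P x"] by simp
    qed
    obtain x0 where x0: "x0 \<in> mcarrier U" using cartesian_space_nonempty[OF U] by blast
    have edge_eq: "([P x ! j, P x ! Suc j], [G x ! j]) = ([P x0 ! j, P x0 ! Suc j], [G x0 ! j])"
      if "x \<in> mcarrier U" "j < k" for x j
      using edge[OF that] edge[OF x0 that(2)] by (metis prod.inject)
    have "P x = P x0" if x: "x \<in> mcarrier U" for x
    proof (rule nth_equalityI)
      \<comment> \<open>The plot at position 0 is the start of edge 0; a plot at a later position
        \<open>j\<close> is the end of edge \<open>j - 1\<close>.\<close>
      show "P x ! j = P x0 ! j" if "j < length (P x)" for j
        using edge_eq[OF x, of 0] edge_eq[OF x, of "j - 1"] that len(1)[OF x] False by (cases j) auto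
    qed (use len x x0 in simp)
    moreover have "G x = G x0" if x: "x \<in> mcarrier U" for x
      by (rule nth_equalityI) (use len[OF x] len[OF x0] edge_eq[OF x] in auto)
    ultimately have const: "?\<Psi> (p x) = (q 0 x, (P x0, G x0))" if "x \<in> mcarrier U" for x
      using edge[OF that, of 0] False that by (simp add: r)
    have c0: "c 0 = ([P x0 ! 0, P x0 ! 1], [G x0 ! 0])"
      using edge[OF x0, of 0] False by simp
    have chain: "(P x0, G x0) \<in> plot_chains X k" using rQ[OF x0] by (simp add: pts.Q_def)
    have dom: "chain_dom (P x0, G x0) = chain_dom (c 0)"
      using len(1)[OF x0] unfolding c0 by (cases "P x0") (auto simp: chain_dom_def)
    show ?thesis
    proof (rule Q_plotI[OF U chain])
      show "q 0 \<in> cart_hom U (chain_dom (P x0, G x0))" using c(1)[of 0] False unfolding dom by simp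
      show "compose (mcarrier U) ?\<Psi> p = (\<lambda>x\<in>mcarrier U. (q 0 x, (P x0, G x0)))"
        unfolding compose_def by (rule restrict_ext) (rule const)
    qed
  qed
  then show "case z of (U, p) \<Rightarrow> (U, compose (mcarrier U) ?\<Psi> p) \<in> plots (Q_diffsp X k)"
    by (simp add: p)
qed

lemma ddiffeomorphism_\<Phi>: "ddiffeomorphism (Q_diffsp X k) (sd_level (dnerve (Q_diffcat X)) k) (pts.\<Phi> k)"
  using pts.\<Phi>_bij dsmooth_\<Phi> dsmooth_\<Phi>_inv
  by (simp add: ddiffeomorphism_def points_dnerve points_Q_diffsp)

lemma diffeological_space_dnerve: "diffeological_space (sd_level (dnerve (Q_diffcat X)) k)"
proof (rule diffeological_space_transfer[OF diffeological_space_Q_diffsp ddiffeomorphism_\<Phi>])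
  fix U p assume "(U, p) \<in> plots (sd_level (dnerve (Q_diffcat X)) k)"
  then show "cartesian_space U \<and> p \<in> mcarrier U \<rightarrow>\<^sub>E points (sd_level (dnerve (Q_diffcat X)) k)"
    by (simp add: dnerve_plot_iff points_dnerve)
qed

lemma simplicial_diffsp_dnerve: "simplicial_diffsp (dnerve (Q_diffcat X))"
  unfolding simplicial_diffsp_def points_dnerve sd_face_dnerve sd_degen_dnerve
proof (intro conjI allI impI)
  show "dsmooth (sd_level (dnerve (Q_diffcat X)) (Suc k)) (sd_level (dnerve (Q_diffcat X)) k) (pts.d (Suc k) i)"
    if "i \<le> Suc k" for k i
    by (rule dsmooth_transfer[OF diffeological_space_Q_diffsp diffeological_space_dnerve
          dsmooth_Q_face[OF that] ddiffeomorphism_\<Phi> ddiffeomorphism_\<Phi>])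
      (use pts.\<Phi>_face[OF that] points_Q_diffsp in simp)
  show "dsmooth (sd_level (dnerve (Q_diffcat X)) k) (sd_level (dnerve (Q_diffcat X)) (Suc k)) (pts.s k i)"
    if "i \<le> k" for k i
    by (rule dsmooth_transfer[OF diffeological_space_Q_diffsp diffeological_space_dnerve
          dsmooth_Q_degen[OF that] ddiffeomorphism_\<Phi> ddiffeomorphism_\<Phi>])
      (use pts.\<Phi>_degen[OF that] points_Q_diffsp in simp)
qed (rule diffeological_space_dnerve pts.simplicial_set_nerve)+

theorem sdiffsp_isomorphic_Q: "sdiffsp_isomorphic (Q_sdiffsp X) (dnerve (Q_diffcat X))"
  unfolding sdiffsp_isomorphic_def
proof (intro conjI exI[of _ pts.\<Phi>] allI impI ballI)
  have level: "sd_level (Q_sdiffsp X) = Q_diffsp X" "sd_face (Q_sdiffsp X) = Q_face (\<lambda>f x. f x)"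
    "sd_degen (Q_sdiffsp X) = (\<lambda>k. Q_degen)"
    by (simp_all add: Q_sdiffsp_def)
  show "ddiffeomorphism (sd_level (Q_sdiffsp X) k) (sd_level (dnerve (Q_diffcat X)) k) (pts.\<Phi> k)" for k
    unfolding level by (rule ddiffeomorphism_\<Phi>)
  show "pts.\<Phi> k (sd_face (Q_sdiffsp X) (Suc k) i x) = sd_face (dnerve (Q_diffcat X)) (Suc k) i (pts.\<Phi> (Suc k) x)"
    if "i \<le> Suc k" "x \<in> points (sd_level (Q_sdiffsp X) (Suc k))" for k i x
    using that pts.\<Phi>_face unfolding level sd_face_dnerve points_Q_diffsp by blast
  show "pts.\<Phi> (Suc k) (sd_degen (Q_sdiffsp X) k i x) = sd_degen (dnerve (Q_diffcat X)) k i (pts.\<Phi> k x)"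
    if "i \<le> k" "x \<in> points (sd_level (Q_sdiffsp X) k)" for k i x
    using that pts.\<Phi>_degen unfolding level sd_degen_dnerve points_Q_diffsp by blast
qed (rule simplicial_diffsp_Q simplicial_diffsp_dnerve)+

end

section \<open>The resolution as a simplicial presheaf\<close>

lemma psh_map_cong:
  assumes "psh_map P R \<eta>" "presheaf P" "\<And>V x. cartesian_space V \<Longrightarrow> x \<in> ps_set P V \<Longrightarrow> \<eta> V x = \<theta> V x"
  shows "psh_map P R \<theta>"
  unfolding psh_map_def
proof (intro conjI allI impI ballI; (elim conjE)?)
  show "\<theta> V \<in> ps_set P V \<rightarrow> ps_set R V" if V: "cartesian_space V" for V
    using assms(1,3) V unfolding psh_map_def Pi_iff by metis
  fix V W f x assume *: "cartesian_space V" "cartesian_space W" "f \<in> cart_hom W V" "x \<in> ps_set P V"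
  have "ps_res P W V f x \<in> ps_set P W" using assms(2) * unfolding presheaf_def by blast
  moreover have "\<eta> W (ps_res P W V f x) = ps_res R W V f (\<eta> V x)"
    using assms(1) * unfolding psh_map_def by blast
  ultimately show "\<theta> W (ps_res P W V f x) = ps_res R W V f (\<theta> V x)"
    using assms(3)[OF *(1,4)] assms(3)[OF *(2)] by simp
qed

context diffeology
begin

text \<open>The cartesian space \<open>V\<close> varies and carries a hypothesis, so there is no
  single interpretation of the locale for smooth maps; its constants are applied to \<open>V\<close>
  explicitly and its theorems instantiated through \<open>maps\<close>.\<close>

abbreviation QV :: "mfd \<Rightarrow> nat \<Rightarrow> ((rvec \<Rightarrow> rvec) \<times> 'x plot_chain) set" where
  "QV V \<equiv> plot_action.Q X (cart_hom V)"

abbreviation \<Phi>V :: "mfd \<Rightarrow> nat \<Rightarrow> (rvec \<Rightarrow> rvec) \<times> 'x plot_chain \<Rightarrow>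
    ((rvec \<Rightarrow> rvec) \<times> 'x plot_chain, (rvec \<Rightarrow> rvec) \<times> 'x plot_chain) nsimplex" where
  "\<Phi>V V \<equiv> plot_action.\<Phi> (compose (mcarrier V))"

lemma maps: "cartesian_space V \<Longrightarrow> plot_action X (cart_hom V) (compose (mcarrier V))"
  by (rule plot_action_maps[OF X])

lemma ps_set_Q_psh:
  assumes "cartesian_space V"
  shows "ps_set (Q_psh X k) V = QV V k"
  using plot_action.Q_def[OF maps[OF assms]] by (simp add: Q_psh_def psh_coproduct_def yoneda_def)

lemma ps_res_Q_psh: "ps_res (Q_psh X k) W V f (g, c) = (compose (mcarrier W) g f, c)"
  by (simp add: Q_psh_def psh_coproduct_def yoneda_def)

lemma presheaf_Q_psh: "presheaf (Q_psh X k)"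
  unfolding Q_psh_def
  by (rule presheaf_psh_coproduct, rule presheaf_yoneda, rule chain_dom_cartesian[OF X])

lemma QVE:
  assumes "cartesian_space V" "x \<in> QV V k"
  obtains g ps fs where "x = (g, (ps, fs))" "(ps, fs) \<in> plot_chains X k" "g \<in> cart_hom V (chain_dom (ps, fs))"
  using assms(2) unfolding plot_action.Q_def[OF maps[OF assms(1)]] by auto

text \<open>Restriction precomposes and the action postcomposes, so naturality in \<open>V\<close>
  is associativity of composition.\<close>

lemma compose_res:
  assumes "f \<in> cart_hom W V"
  shows "compose (mcarrier W) (compose (mcarrier V) h g) f = compose (mcarrier W) h (compose (mcarrier W) g f)"
  by (rule compose_assoc[symmetric]) (use assms in \<open>auto simp: cart_hom_def\<close>)

lemma psh_map_Q_face:
  assumes "i \<le> Suc k"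
  shows "psh_map (Q_psh X (Suc k)) (Q_psh X k) (\<lambda>V. Q_face (compose (mcarrier V)) (Suc k) i)"
  unfolding psh_map_def
proof (intro conjI allI impI ballI; (elim conjE)?)
  fix V assume V: "cartesian_space V"
  show "Q_face (compose (mcarrier V)) (Suc k) i \<in> ps_set (Q_psh X (Suc k)) V \<rightarrow> ps_set (Q_psh X k) V"
    unfolding ps_set_Q_psh[OF V] by (rule plot_action.Q_face_mem[OF maps[OF V] assms])
next
  fix V W f x assume *: "cartesian_space V" "cartesian_space W" "f \<in> cart_hom W V" "x \<in> ps_set (Q_psh X (Suc k)) V"
  obtain g c where x: "x = (g, c)" by (cases x)
  show "Q_face (compose (mcarrier W)) (Suc k) i (ps_res (Q_psh X (Suc k)) W V f x) =
      ps_res (Q_psh X k) W V f (Q_face (compose (mcarrier V)) (Suc k) i x)"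
    by (simp add: x ps_res_Q_psh Q_face_def compose_res[OF *(3)])
qed

lemma psh_map_Q_degen:
  assumes "i \<le> k"
  shows "psh_map (Q_psh X k) (Q_psh X (Suc k)) (\<lambda>V. Q_degen i)"
  unfolding psh_map_def
proof (intro conjI allI impI ballI; (elim conjE)?)
  fix V assume V: "cartesian_space V"
  show "Q_degen i \<in> ps_set (Q_psh X k) V \<rightarrow> ps_set (Q_psh X (Suc k)) V"
    unfolding ps_set_Q_psh[OF V] by (rule plot_action.Q_degen_mem[OF maps[OF V] assms])
next
  fix V W f x assume *: "cartesian_space V" "cartesian_space W" "f \<in> cart_hom W V" "x \<in> ps_set (Q_psh X k) V"
  obtain g c where x: "x = (g, c)" by (cases x)
  show "Q_degen i (ps_res (Q_psh X k) W V f x) = ps_res (Q_psh X (Suc k)) W V f (Q_degen i x)"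
    by (simp add: x ps_res_Q_psh Q_degen_def)
qed

lemma Q_spsh_simps:
  "sp_level (Q_spsh X) = Q_psh X" "sp_face (Q_spsh X) k i = (\<lambda>V. Q_face (compose (mcarrier V)) k i)"
  "sp_degen (Q_spsh X) k i = (\<lambda>V. Q_degen i)"
  by (simp_all add: Q_spsh_def)

lemma simplicial_presheaf_Q: "simplicial_presheaf (Q_spsh X)"
  unfolding simplicial_presheaf_def Q_spsh_simps
proof (intro conjI allI impI)
  fix V assume V: "cartesian_space V"
  show "simplicial_set (\<lambda>k. ps_set (Q_psh X k) V) (\<lambda>k i. Q_face (compose (mcarrier V)) k i) (\<lambda>k. Q_degen)"
    using plot_action.simplicial_set_Q[OF maps[OF V]] by (simp add: ps_set_Q_psh[OF V])
qed (auto intro: presheaf_Q_psh psh_map_Q_face psh_map_Q_degen)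

lemma presheaf_of_categories_Q: "presheaf_of_categories (Q_pshcat X)"
  unfolding presheaf_of_categories_def Q_pshcat_def pshcat.simps
proof (intro conjI allI impI ballI; (elim conjE)?)
  fix V assume V: "cartesian_space V"
  show "small_category (ps_set (Q_psh X 0) V) (ps_set (Q_psh X 1) V) Q_src
      (Q_tgt (\<lambda>f g. compose (mcarrier V) f g)) Q_unit Q_comp"
    unfolding ps_set_Q_psh[OF V] by (rule plot_action.small_category_Q[OF maps[OF V]])
next
  show "psh_map (Q_psh X 1) (Q_psh X 0) (\<lambda>V. Q_src)"
    by (rule psh_map_cong[OF psh_map_Q_face[of 1 0, folded One_nat_def] presheaf_Q_psh])
      (simp_all add: ps_set_Q_psh plot_action.Q_src_face[OF maps] del: One_nat_def)
  show "psh_map (Q_psh X 1) (Q_psh X 0) (\<lambda>V. Q_tgt (\<lambda>f g. compose (mcarrier V) f g))"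
    by (rule psh_map_cong[OF psh_map_Q_face[of 0 0, folded One_nat_def] presheaf_Q_psh])
      (simp_all add: ps_set_Q_psh plot_action.Q_tgt_face[OF maps] del: One_nat_def)
  show "psh_map (Q_psh X 0) (Q_psh X 1) (\<lambda>V. Q_unit)"
    by (rule psh_map_cong[OF psh_map_Q_degen[of 0 0, folded One_nat_def] presheaf_Q_psh])
      (simp_all add: ps_set_Q_psh plot_action.Q_unit_degen[OF maps] del: One_nat_def)
next
  fix V W f a b
  show "ps_res (Q_psh X 1) W V f (Q_comp a b) = Q_comp (ps_res (Q_psh X 1) W V f a) (ps_res (Q_psh X 1) W V f b)"
    by (cases a; cases "snd a"; cases b; cases "snd b") (auto simp: Q_comp_def ps_res_Q_psh)
qed (rule presheaf_Q_psh)+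

section \<open>The comparison as an isomorphism of simplicial presheaves\<close>

lemma psh_nerve_simps:
  "ps_set (sp_level (psh_nerve (Q_pshcat X)) k) V =
     nerve_set (ps_set (Q_psh X 0) V) (ps_set (Q_psh X 1) V) Q_src (Q_tgt (compose (mcarrier V))) k"
  "ps_res (sp_level (psh_nerve (Q_pshcat X)) k) W V f =
     map_nsimplex (ps_res (Q_psh X 0) W V f) (ps_res (Q_psh X 1) W V f)"
  "sp_face (psh_nerve (Q_pshcat X)) k i V = nerve_face Q_src (Q_tgt (compose (mcarrier V))) Q_comp k i"
  "sp_degen (psh_nerve (Q_pshcat X)) k i V = nerve_degen Q_src (Q_tgt (compose (mcarrier V))) Q_unit k i"
  by (simp_all add: psh_nerve_def Q_pshcat_def)

lemma \<Phi>V_bij: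
  assumes "cartesian_space V"
  shows "bij_betw (\<Phi>V V k) (ps_set (Q_psh X k) V) (ps_set (sp_level (psh_nerve (Q_pshcat X)) k) V)"
  unfolding psh_nerve_simps ps_set_Q_psh[OF assms] by (rule plot_action.\<Phi>_bij[OF maps[OF assms]])

text \<open>Restriction leaves the chain alone, and transport, which postcomposes with its maps,
  commutes with precomposition by \<open>f\<close>.\<close>

lemma \<Phi>V_res:
  assumes V: "cartesian_space V" and W: "cartesian_space W" and f: "f \<in> cart_hom W V"
    and x: "x \<in> ps_set (Q_psh X k) V"
  shows "\<Phi>V W k (ps_res (Q_psh X k) W V f x) = ps_res (sp_level (psh_nerve (Q_pshcat X)) k) W V f (\<Phi>V V k x)"
proof -
  obtain g ps fs where xe: "x = (g, (ps, fs))" "(ps, fs) \<in> plot_chains X k"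
    using QVE[OF V] x unfolding ps_set_Q_psh[OF V] by metis
  note tr = plot_action.transport.simps[OF maps[OF V]] plot_action.transport.simps[OF maps[OF W]]
  have "plot_action.transport (compose (mcarrier W)) fs (compose (mcarrier W) g f) j =
      compose (mcarrier W) (plot_action.transport (compose (mcarrier V)) fs g j) f" for j
    by (induction j) (simp_all add: tr compose_res[OF f])
  then have "plot_action.arrows (compose (mcarrier W)) (compose (mcarrier W) g f, (ps, fs)) =
      map (ps_res (Q_psh X 1) W V f) (plot_action.arrows (compose (mcarrier V)) (g, (ps, fs)))"
    by (simp add: plot_action.arrows_def[OF maps[OF V]] plot_action.arrows_def[OF maps[OF W]] ps_res_Q_psh)
  then show ?thesis
    by (simp add: psh_nerve_simps ps_res_Q_psh xe
        plot_action.\<Phi>_def[OF maps[OF V]] plot_action.\<Phi>_def[OF maps[OF W]])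
qed

lemma psh_map_\<Phi>V: "psh_map (Q_psh X k) (sp_level (psh_nerve (Q_pshcat X)) k) (\<lambda>V. \<Phi>V V k)"
  unfolding psh_map_def
proof (intro conjI allI impI ballI; (elim conjE)?)
  show "\<Phi>V V k \<in> ps_set (Q_psh X k) V \<rightarrow> ps_set (sp_level (psh_nerve (Q_pshcat X)) k) V"
    if "cartesian_space V" for V
    using bij_betw_imp_funcset[OF \<Phi>V_bij[OF that]] .
qed (rule \<Phi>V_res)

lemma \<Phi>V_face:
  assumes "i \<le> Suc k" "cartesian_space V" "x \<in> ps_set (Q_psh X (Suc k)) V"
  shows "\<Phi>V V k (Q_face (compose (mcarrier V)) (Suc k) i x) =
      sp_face (psh_nerve (Q_pshcat X)) (Suc k) i V (\<Phi>V V (Suc k) x)"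
  using plot_action.\<Phi>_face[OF maps[OF assms(2)] assms(1)] assms(3)
  unfolding psh_nerve_simps ps_set_Q_psh[OF assms(2)] by blast

lemma \<Phi>V_degen:
  assumes "i \<le> k" "cartesian_space V" "x \<in> ps_set (Q_psh X k) V"
  shows "\<Phi>V V (Suc k) (Q_degen i x) = sp_degen (psh_nerve (Q_pshcat X)) k i V (\<Phi>V V k x)"
  using plot_action.\<Phi>_degen[OF maps[OF assms(2)] assms(1)] assms(3)
  unfolding psh_nerve_simps ps_set_Q_psh[OF assms(2)] by blast

lemma simplicial_presheaf_psh_nerve: "simplicial_presheaf (psh_nerve (Q_pshcat X))"
  unfolding simplicial_presheaf_def
proof (intro conjI allI impI)
  show "presheaf (sp_level (psh_nerve (Q_pshcat X)) k)" for k
    by (rule presheaf_transfer[where \<eta> = "\<lambda>V. \<Phi>V V k", OF presheaf_Q_psh \<Phi>V_bij \<Phi>V_res])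
  show "simplicial_set (\<lambda>k. ps_set (sp_level (psh_nerve (Q_pshcat X)) k) V)
      (\<lambda>k i. sp_face (psh_nerve (Q_pshcat X)) k i V) (\<lambda>k i. sp_degen (psh_nerve (Q_pshcat X)) k i V)"
    if V: "cartesian_space V" for V
  proof -
    interpret plot_action X "cart_hom V" "compose (mcarrier V)" by (rule maps[OF V])
    show ?thesis using simplicial_set_nerve unfolding psh_nerve_simps ps_set_Q_psh[OF V] .
  qed
  show "psh_map (sp_level (psh_nerve (Q_pshcat X)) (Suc k)) (sp_level (psh_nerve (Q_pshcat X)) k)
      (sp_face (psh_nerve (Q_pshcat X)) (Suc k) i)" if "i \<le> Suc k" for k i
    by (rule psh_map_transfer[where \<eta> = "\<lambda>V. \<Phi>V V (Suc k)" and \<eta>' = "\<lambda>V. \<Phi>V V k",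
          OF psh_map_Q_face[OF that] presheaf_Q_psh psh_map_\<Phi>V \<Phi>V_bij psh_map_\<Phi>V \<Phi>V_face[OF that]])
  show "psh_map (sp_level (psh_nerve (Q_pshcat X)) k) (sp_level (psh_nerve (Q_pshcat X)) (Suc k))
      (sp_degen (psh_nerve (Q_pshcat X)) k i)" if "i \<le> k" for k i
    by (rule psh_map_transfer[where \<eta> = "\<lambda>V. \<Phi>V V k" and \<eta>' = "\<lambda>V. \<Phi>V V (Suc k)",
          OF psh_map_Q_degen[OF that] presheaf_Q_psh psh_map_\<Phi>V \<Phi>V_bij psh_map_\<Phi>V \<Phi>V_degen[OF that]])
qed

theorem spsh_isomorphic_Q: "spsh_isomorphic (Q_spsh X) (psh_nerve (Q_pshcat X))"
  unfolding spsh_isomorphic_def Q_spsh_simps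
proof (intro conjI exI[of _ "\<lambda>k V. \<Phi>V V k"] allI impI ballI)
  show "psh_map (Q_psh X k) (sp_level (psh_nerve (Q_pshcat X)) k) (\<lambda>V. \<Phi>V V k)" for k
    by (rule psh_map_\<Phi>V)
qed (use simplicial_presheaf_Q simplicial_presheaf_psh_nerve \<Phi>V_bij \<Phi>V_face \<Phi>V_degen in auto)

end

theorem proposition5p20:
  fixes X :: "'x diffsp"
  assumes "diffeological_space X"
  shows "(diffeological_category (Q_diffcat X) \<and>
          sdiffsp_isomorphic (Q_sdiffsp X) (dnerve (Q_diffcat X))) \<and>
         (presheaf_of_categories (Q_pshcat X) \<and>
          spsh_isomorphic (Q_spsh X) (psh_nerve (Q_pshcat X)))"
proof -
  interpret diffeology X by unfold_locales (rule assms)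
  show ?thesis
    using diffeological_category_Q sdiffsp_isomorphic_Q presheaf_of_categories_Q spsh_isomorphic_Q by simp
qed

end
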